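(* Let $T>0$ and $R>0$. For $\mu$-almost every environment $\omega\in\Omega$, with the processes $\xi^{1,n}$ ($n\ge1$), all started from $0$, and $X^1$ coupled on one probability space as in the context (with expectation denoted $\mathbb E^\omega_0$), define $$L^n_t(x):=\frac1{\sqrt n}\int_0^{nt}\mathbf 1_{\{\xi^{1,n}_s=x\}}\,ds,\qquad x\in\mathbb Z,\ t\ge 0 .$$ Then $$\lim_{n\to\infty}\ \sup_{t\in[0,T]}\ \max_{x\in\mathbb Z,\ |x|\le R\sqrt n}\ \mathbb E^\omega_0\left[\,\left|\frac{L^n_t(x)}{\pi(T^x\omega)}-L_t(x/\sqrt n)\right|\,\right]=0,$$ where $L_t(x)$, $x\in\mathbb R$, denotes the local time at $x$ of $X^1$ up to time $t$.
   Context: Environment. $(\Omega,\mathcal B,\mu)$ is a probability space with measurable maps $T^x:\Omega\to\Omega$, $x\in\mathbb Z$, such that (i) $T^x\circ T^y=T^{x+y}$ for all $x,y\in\mathbb Z$ and $T^0=\mathrm{Id}_\Omega$; (ii) $\mu(T^xA)=\mu(A)$ for all $A\in\mathcal B$, $x\in\mathbb Z$; (iii) if $A\in\mathcal B$ satisfies $T^xA=A$ for all $x\in\mathbb Z$ then $\mu(A)\in\{0,1\}$. Let $j:\Omega\times\{-1,1\}\to\mathbb R_+$ and $\pi:\Omega\to\mathbb R_+$ be measurable and $K>0$ a constant such that, for $\mu$-a.e. $\omega$ and $z\in\{-1,1\}$: $\pi(\omega)j(\omega,z)=\pi(T^z\omega)j(T^z\omega,-z)$; $\frac1K\le j(\omega,z)\le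 K$, $\frac1K\le\pi(\omega)\le K$; and $\int_\Omega\pi\,d\mu=1$. Random walk. Given $\omega$, "the random walk in the environment $\omega$" is the continuous-time Markov chain on $\mathbb Z$ jumping from $x$ to $x+z$ at rate $j(T^x\omega,z)$ for $z\in\{-1,1\}$ (and making no other jumps). Coupling. Set $\sigma^2=2\left(\int_\Omega\frac{1}{\pi(\omega)j(\omega,1)}\mu(d\omega)\right)^{-1}$. By a known quenched functional central limit theorem (the walk rescaled diffusively converges to Brownian motion with variance $\sigma^2$) and Skorokhod's representation theorem, for $\mu$-a.e. $\omega$ there is a probability space carrying processes $\xi^{1,n}$, $n\ge1$, and a Brownian motion $X^1$ started from $0$ with variance $\sigma^2$ per unit time, such that each $\xi^{1,n}$ is distributed as the random walk in the environment $\omega$ started from $0$, and $(\frac1{\sqrt n}\xi^{1,n}_{nt})_{t\in[0,T]}\to(X^1_t)_{t\in[0,T]}$ almost surely in $D([0,T],\mathbb R)$ (càdlàg functions with the Skorokhod topology). Local time. $L_t(x)$ is normalized (and taken jointly continuous in $(t,x)$) so that $L_t(x)=\lim_{\varepsilon\downarrow0}\frac1{2\varepsilon}\int_0^t\mathbf 1_{\{|X^1_s-x|\le\varepsilon\}}ds$. *)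

theory Defs
  imports "HOL-Probability.Probability"
begin

locale random_environment = prob_space \<mu>
  for \<mu> :: "'w measure" +
  fixes shift :: "int \<Rightarrow> 'w \<Rightarrow> 'w"
    and j :: "'w \<Rightarrow> int \<Rightarrow> real"
    and \<pi> :: "'w \<Rightarrow> real"
    and K :: real
  assumes shift_measurable: "\<And>x. shift x \<in> measurable \<mu> \<mu>"
    and shift_add: "\<And>x y \<omega>. \<omega> \<in> space \<mu> \<Longrightarrow> shift x (shift y \<omega>) = shift (x + y) \<omega>"
    and shift_zero: "\<And>\<omega>. \<omega> \<in> space \<mu> \<Longrightarrow> shift 0 \<omega> = \<omega>"
    and shift_preserving: "\<And>A x. A \<in> sets \<mu> \<Longrightarrow> emeasure \<mu> (shift x ` A) = emeasure \<mu> A"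
    and shift_ergodic: "\<And>A. A \<in> sets \<mu> \<Longrightarrow> (\<And>x. shift x ` A = A) \<Longrightarrow> measure \<mu> A \<in> {0, 1}"
    and j_measurable: "\<And>z. z \<in> {-1, 1} \<Longrightarrow> (\<lambda>\<omega>. j \<omega> z) \<in> borel_measurable \<mu>"
    and \<pi>_measurable: "\<pi> \<in> borel_measurable \<mu>"
    and j_nonneg: "\<And>\<omega> z. \<omega> \<in> space \<mu> \<Longrightarrow> z \<in> {-1, 1} \<Longrightarrow> 0 \<le> j \<omega> z"
    and \<pi>_nonneg: "\<And>\<omega>. \<omega> \<in> space \<mu> \<Longrightarrow> 0 \<le> \<pi> \<omega>"
    and K_pos: "0 < K"
    and reversible: "AE \<omega> in \<mu>. \<forall>z\<in>{-1, 1}. \<pi> \<omega> * j \<omega> z = \<pi> (shift z \<omega>) * j (shift z \<omega>) (- z)"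
    and j_bounds: "AE \<omega> in \<mu>. \<forall>z\<in>{-1, 1}. 1 / K \<le> j \<omega> z \<and> j \<omega> z \<le> K"
    and \<pi>_bounds: "AE \<omega> in \<mu>. 1 / K \<le> \<pi> \<omega> \<and> \<pi> \<omega> \<le> K"
    and \<pi>_normalized: "(\<integral>\<omega>. \<pi> \<omega> \<partial>\<mu>) = 1"

definition limit_variance :: "'w measure \<Rightarrow> ('w \<Rightarrow> int \<Rightarrow> real) \<Rightarrow> ('w \<Rightarrow> real) \<Rightarrow> real" where
  "limit_variance \<mu> j \<pi> = 2 * inverse (\<integral>\<omega>. 1 / (\<pi> \<omega> * j \<omega> 1) \<partial>\<mu>)"

definition cadlag :: "(real \<Rightarrow> real) \<Rightarrow> bool" where
  "cadlag f \<longleftrightarrow>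
    (\<forall>t\<ge>0. (f \<longlongrightarrow> f t) (at_right t)) \<and>
    (\<forall>t>0. \<exists>l. (f \<longlongrightarrow> l) (at_left t))"

(* Standard stochastic transition function of the chain on the integers that jumps from x to x + z
   at rate "rate x z", z = 1, -1, characterized by Kolmogorov's backward equation.
   The derivative at t = 0 is one-sided and gives the jump rates themselves.
   When the rates are bounded, as they are for almost every environment,
   exactly one such function exists on nonnegative times. *)
definition transition_function ::
    "(int \<Rightarrow> int \<Rightarrow> real) \<Rightarrow> (real \<Rightarrow> int \<Rightarrow> int \<Rightarrow> real) \<Rightarrow> bool" where
  "transition_function rate p \<longleftrightarrow>
    (\<forall>t\<ge>0. \<forall>x y. 0 \<le> p t x y) \<and>
    (\<forall>t\<ge>0. \<forall>x. ((\<lambda>y. p t x y) has_sum 1) UNIV) \<and>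
    (\<forall>x y. p 0 x y = (if x = y then 1 else 0)) \<and>
    (\<forall>s\<ge>0. \<forall>t\<ge>0. \<forall>x y. ((\<lambda>z. p s x z * p t z y) has_sum p (s + t) x y) UNIV) \<and>
    (\<forall>t\<ge>0. \<forall>x y. ((\<lambda>s. p s x y) has_real_derivative
       (\<Sum>z\<in>{-1, 1}. rate x z * (p t (x + z) y - p t x y))) (at t within {0..}))"

(* Every path is required to be cadlag, so that Y is a random element of the Skorokhod space.
   The case t 0 = 0 of the last clause gives Y 0 = x0 almost surely. *)
definition markov_walk ::
    "'b measure \<Rightarrow> (int \<Rightarrow> int \<Rightarrow> real) \<Rightarrow> int \<Rightarrow> (real \<Rightarrow> 'b \<Rightarrow> int) \<Rightarrow> bool" where
  "markov_walk M rate x0 Y \<longleftrightarrow>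
    (\<forall>t\<ge>0. Y t \<in> measurable M (count_space UNIV)) \<and>
    (\<forall>u\<in>space M. cadlag (\<lambda>t. real_of_int (Y t u))) \<and>
    (\<exists>p. transition_function rate p \<and>
      (\<forall>(m::nat) t y. 0 \<le> t 0 \<longrightarrow> (\<forall>i<m. t i \<le> t (Suc i)) \<longrightarrow>
        measure M {u \<in> space M. \<forall>i\<le>m. Y (t i) u = y i} =
          p (t 0) x0 (y 0) * (\<Prod>i<m. p (t (Suc i) - t i) (y i) (y (Suc i)))))"

definition brownian_motion :: "'b measure \<Rightarrow> real \<Rightarrow> (real \<Rightarrow> 'b \<Rightarrow> real) \<Rightarrow> bool" where
  "brownian_motion M v X \<longleftrightarrow>
    (\<forall>t\<ge>0. X t \<in> borel_measurable M) \<and>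
    (AE u in M. X 0 u = 0) \<and>
    (\<forall>(m::nat) t. 0 \<le> t 0 \<longrightarrow> (\<forall>i<m. t i \<le> t (Suc i)) \<longrightarrow>
      prob_space.indep_vars M (\<lambda>_. borel) (\<lambda>i u. X (t (Suc i)) u - X (t i) u) {..<m}) \<and>
    (\<forall>s t. 0 \<le> s \<longrightarrow> s < t \<longrightarrow>
      distributed M lborel (\<lambda>u. X t u - X s u) (normal_density 0 (sqrt (v * (t - s))))) \<and>
    (AE u in M. continuous_on {0..} (\<lambda>t. X t u))"

definition time_changes :: "real \<Rightarrow> (real \<Rightarrow> real) set" where
  "time_changes T = {\<tau>. bij_betw \<tau> {0..T} {0..T} \<and> strict_mono_on {0..T} \<tau>}"

(* Billingsley's metric for the Skorokhod (J1) topology on cadlag functions on {0..T}. *)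
definition skorokhod_dist :: "real \<Rightarrow> (real \<Rightarrow> real) \<Rightarrow> (real \<Rightarrow> real) \<Rightarrow> real" where
  "skorokhod_dist T f g =
    Inf {\<epsilon>. 0 < \<epsilon> \<and> (\<exists>\<tau>\<in>time_changes T.
      \<forall>t\<in>{0..T}. \<bar>\<tau> t - t\<bar> \<le> \<epsilon> \<and> \<bar>f t - g (\<tau> t)\<bar> \<le> \<epsilon>)}"

definition local_time ::
    "'b measure \<Rightarrow> (real \<Rightarrow> 'b \<Rightarrow> real) \<Rightarrow> (real \<Rightarrow> real \<Rightarrow> 'b \<Rightarrow> real) \<Rightarrow> bool" where
  "local_time M X L \<longleftrightarrow>
    (\<forall>t\<ge>0. \<forall>x. L t x \<in> borel_measurable M) \<and>
    (AE u in M. continuous_on ({0..} \<times> UNIV) (\<lambda>(t, x). L t x u) \<and>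
      (\<forall>t\<ge>0. \<forall>x. ((\<lambda>\<epsilon>. 1 / (2 * \<epsilon>) * (LBINT s:{0..t}. indicat_real {y. \<bar>y - x\<bar> \<le> \<epsilon>} (X s u)))
        \<longlongrightarrow> L t x u) (at_right 0)))"

definition scaled_occupation ::
    "(nat \<Rightarrow> real \<Rightarrow> 'b \<Rightarrow> int) \<Rightarrow> nat \<Rightarrow> real \<Rightarrow> int \<Rightarrow> 'b \<Rightarrow> real" where
  "scaled_occupation \<xi> n t x u =
    1 / sqrt (real n) * (LBINT s:{0..real n * t}. indicat_real {x} (\<xi> n s u))"

end

theory Submission
  imports Defs
begin

text \<open>
Let \<open>w x = \<pi> (T\<^sup>x \<omega>)\<close>. For a block \<open>{a..b}\<close> of sites containing \<open>x\<close>, the function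
\<open>\<phi> = \<delta>\<^sub>x / w x - 1\<^bsub>{a..b}\<^esub> / w {a..b}\<close> is the image under the generator of a function bounded by
\<open>K\<^sup>2 (b - a + 1)\<close>, so that the time integrals of \<open>P\<^sub>s \<phi>\<close> are bounded by twice this number.
By the Markov property the normalized occupation of \<open>x\<close> differs in \<open>L\<^sup>2\<close> from the average over the block
by the square root of the block length times the mean occupation; the latter is thereby bounded by a
constant times \<open>sqrt n\<close> up to time \<open>n T\<close>. The ergodic theorem makes \<open>w {a..b}\<close> proportional to
\<open>b - a + 1\<close>, so the local time of the walk is within \<open>O(sqrt \<epsilon>)\<close> of its average over a window of radius
\<open>\<epsilon> sqrt n\<close>, uniformly in \<open>n\<close>. For fixed \<open>\<epsilon>\<close> these averages converge to those of the limit \<open>X\<close>, and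
Fatou's lemma carries the \<open>O(sqrt \<epsilon>)\<close> estimate over to \<open>X\<close> and its local time.
\<close>

section \<open>Green function bounds for reversible nearest-neighbour rates\<close>

text \<open>Path convergence sees only windows of width of order \<open>sqrt n\<close>, never a
  single site; hence the detour through window averages, with an error uniform in \<open>n\<close>,
  \<open>t\<close> and \<open>x\<close>. The rate is a matter of scaling: a block of order
  \<open>\<epsilon> * sqrt n\<close> sites and a normalized mean occupation of order
  \<open>sqrt n\<close> give a mean square distance of order \<open>\<epsilon> * n\<close>, and
  local time divides the occupation by \<open>sqrt n\<close>. The variance estimates depend on the
  environment through \<open>K\<close> only, because the maximum principle is uniform in the
  starting point. They contain the very mean occupation that they are to control; this is no circle,
  since it enters under a square root. Window indicators are discontinuous, so closeness of the
  paths does not by itself make their time integrals close. What is missing is control of the time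
  spent near the ends of a window, and this again comes from the bound on the mean
  occupation.\<close>

locale reversible_rates =
  fixes r :: "int \<Rightarrow> int \<Rightarrow> real" and w :: "int \<Rightarrow> real" and K :: real
  assumes K_pos: "0 < K"
    and r_bounds: "\<And>x z. z \<in> {-1, 1} \<Longrightarrow> 1 / K \<le> r x z \<and> r x z \<le> K"
    and w_bounds: "\<And>x. 1 / K \<le> w x \<and> w x \<le> K"
    and detailed_balance: "\<And>x. w x * r x 1 = w (x + 1) * r (x + 1) (-1)"
begin

definition gen :: "(int \<Rightarrow> real) \<Rightarrow> int \<Rightarrow> real" where
  "gen f x = (\<Sum>z\<in>{-1, 1}. r x z * (f (x + z) - f x))"

lemma gen_eq: "gen f x = r x 1 * (f (x + 1) - f x) + r x (-1) * (f (x - 1) - f x)"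
  by (simp add: gen_def)

lemma w_pos: "0 < w x"
  using w_bounds[of x] K_pos by (smt (verit) divide_pos_pos)

lemma r_pos: "z \<in> {-1, 1} \<Longrightarrow> 0 < r x z"
  using r_bounds[of z x] K_pos by (smt (verit) divide_pos_pos)

text \<open>If \<open>S\<close> is the supremum of the solution on the time interval, the equation for
  \<open>exp (2 * K * s) * v s x\<close> improves the bound \<open>S\<close> to \<open>S - exp (- 2 * K * t) * (S - m)\<close>.\<close>

lemma maximum_principle:
  fixes v :: "real \<Rightarrow> int \<Rightarrow> real"
  assumes der: "\<And>s x. s \<in> {0..t} \<Longrightarrow>
      ((\<lambda>s. v s x) has_real_derivative gen (v s) x) (at s within {0..t})"
    and bnd: "\<And>s x. s \<in> {0..t} \<Longrightarrow> v s x \<le> C"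
    and init: "\<And>x. v 0 x \<le> m"
    and s: "s \<in> {0..t}"
  shows "v s x \<le> m"
proof -
  define A where "A = {v s x |s x. s \<in> {0..t}}"
  \<comment> \<open>The lattice is infinite and the supremum need not be attained, so instead of
    arguing at a maximum one improves the bound by the same amount at every site.\<close>
  define S where "S = Sup A"
  have t0: "0 \<le> t" using s by simp
  have bdd: "bdd_above A" unfolding A_def by (rule bdd_aboveI[of _ C]) (use bnd in auto)
  have ne: "A \<noteq> {}" unfolding A_def using t0 by force
  have le_S: "v s x \<le> S" if "s \<in> {0..t}" for s x
    unfolding S_def by (rule cSup_upper[OF _ bdd]) (use that in \<open>auto simp: A_def\<close>)
  have imp: "v s x \<le> S - exp (- (2 * K * t)) * (S - m)" if s: "s \<in> {0..t}" and Sm: "m < S" for s x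
  proof -
    define f where "f q = exp (2 * K * q) * (S - v q x)" for q
    define f' where "f' q = exp (2 * K * q) * (2 * K * (S - v q x) - gen (v q) x)" for q
    have f'_der: "(f has_real_derivative f' q) (at q within {0..s})" if "0 \<le> q" "q \<le> s" for q
    proof -
      have "((\<lambda>s. v s x) has_real_derivative gen (v q) x) (at q within {0..s})"
        by (rule DERIV_subset[OF der]) (use that s in auto)
      then show ?thesis unfolding f_def f'_def
        by (auto intro!: derivative_eq_intros simp: algebra_simps)
    qed
    have nonneg: "0 \<le> f' q" if "0 \<le> q" "q \<le> s" for q
    proof -
      have qt: "q \<in> {0..t}" using that s by auto
      have r1: "0 \<le> r x 1" "0 \<le> r x (-1)" "r x 1 \<le> K" "r x (-1) \<le> K"
        using r_pos[of 1 x] r_pos[of "-1" x] r_bounds[of 1 x] r_bounds[of "-1" x] by auto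
      \<comment> \<open>The constant \<open>2 * K\<close> dominates the total jump rate: after
        regrouping, every coefficient of a nonnegative gap \<open>S - v\<close> is itself
        nonnegative.\<close>
      have "2 * K * (S - v q x) - gen (v q) x =
        (K - r x 1) * (S - v q x) + (K - r x (-1)) * (S - v q x)
        + r x 1 * (S - v q (x + 1)) + r x (-1) * (S - v q (x - 1))"
        by (simp add: gen_eq algebra_simps)
      also have "0 \<le> \<dots>"
        using r1 le_S[OF qt] by (intro add_nonneg_nonneg mult_nonneg_nonneg) auto
      finally show ?thesis by (simp add: f'_def)
    qed
    have "\<exists>q\<in>{0..s}. f s - f 0 = (*) (f' q) (s - 0)"
      by (rule mvt_very_simple)
        (use s f'_der in \<open>auto simp: has_field_derivative_def\<close>)
    then have "f 0 \<le> f s"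
      using nonneg s by (auto simp: mult_nonneg_nonneg) (smt (verit) mult_nonneg_nonneg)
    moreover have "S - m \<le> f 0" using init[of x] by (simp add: f_def)
    ultimately have "S - m \<le> exp (2 * K * s) * (S - v s x)" by (simp add: f_def)
    then have "exp (- (2 * K * s)) * (S - m) \<le> S - v s x"
      by (simp add: exp_minus field_simps)
    moreover have "exp (- (2 * K * t)) * (S - m) \<le> exp (- (2 * K * s)) * (S - m)"
      using s Sm K_pos by (intro mult_right_mono) auto
    ultimately show ?thesis by simp
  qed
  have "S \<le> m"
  proof (rule ccontr)
    assume "\<not> S \<le> m"
    then have Sm: "m < S" by simp
    have "S \<le> S - exp (- (2 * K * t)) * (S - m)"
      unfolding S_def by (rule cSup_least[OF ne]) (use imp[OF _ Sm] in \<open>auto simp: A_def S_def\<close>)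
    then have "exp (- (2 * K * t)) * (S - m) \<le> 0" by simp
    then show False using Sm by (simp add: mult_le_0_iff)
  qed
  then show ?thesis using le_S[OF s, of x] by simp
qed

lemma gen_add: "gen (\<lambda>x. f x + g x) x = gen f x + gen g x"
  by (simp add: gen_eq algebra_simps)

lemma gen_uminus: "gen (\<lambda>x. - f x) x = - gen f x"
  by (simp add: gen_eq algebra_simps)

lemma gen_cmult: "gen (\<lambda>x. c * f x) x = c * gen f x"
  by (simp add: gen_eq algebra_simps)

lemma gen_sum: "gen (\<lambda>x. \<Sum>y\<in>S. f y x) x = (\<Sum>y\<in>S. gen (f y) x)"
  by (induction S rule: infinite_finite_induct) (simp_all add: gen_add, simp_all add: gen_eq)

lemma transition_le_1:
  assumes "transition_function r p" "0 \<le> t"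
  shows "p t x y \<le> 1"
proof -
  have hs: "((\<lambda>y. p t x y) has_sum 1) UNIV" and nn: "\<And>y. 0 \<le> p t x y"
    using assms by (auto simp: transition_function_def)
  have "sum (p t x) {y} \<le> 1"
    by (rule finite_sum_le_has_sum[OF hs]) (use nn in auto)
  then show ?thesis by simp
qed

lemma transition_continuous:
  assumes "transition_function r p" "A \<subseteq> {0..}"
  shows "continuous_on A (\<lambda>s. p s x y)"
proof -
  have "((\<lambda>s. p s x y) has_real_derivative gen (\<lambda>x. p t x y) x) (at t within {0..})"
    if "0 \<le> t" for t
    using assms(1) that unfolding transition_function_def gen_def by blast
  then have "continuous_on {0..} (\<lambda>s. p s x y)"
    by (auto simp: continuous_on_eq_continuous_within intro: DERIV_continuous)
  then show ?thesis using assms(2) by (rule continuous_on_subset)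
qed

text \<open>The function \<open>g + (\<integral>\<^sub>0\<^sup>t P\<^sub>s \<phi> ds)\<close> solves the backward equation with initial value \<open>g\<close>,
  so it stays within the bounds of \<open>g\<close>.\<close>

lemma time_integral_bound:
  assumes tf: "transition_function r p" and fin: "finite S"
    and supp: "\<And>x. x \<notin> S \<Longrightarrow> \<phi> x = 0"
    and gen_g: "\<And>x. gen g x = \<phi> x"
    and g_bound: "\<And>x. \<bar>g x\<bar> \<le> D"
    and t0: "0 \<le> t"
  shows "\<bar>\<Sum>y\<in>S. \<phi> y * integral {0..t} (\<lambda>s. p s x y)\<bar> \<le> 2 * D"
proof -
  define u where "u t x = (\<Sum>y\<in>S. \<phi> y * integral {0..t} (\<lambda>s. p s x y))" for t x
  define v where "v t x = g x + u t x" for t x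
  have backward: "((\<lambda>s. p s x y) has_real_derivative gen (\<lambda>x. p q x y) x) (at q within {0..})"
    if "0 \<le> q" for q x y
    using tf that unfolding transition_function_def gen_def by blast
  have int: "(\<lambda>s. p s x y) integrable_on {0..q}" for q x y
    by (rule integrable_continuous_real[OF transition_continuous[OF tf]]) auto
  \<comment> \<open>The backward equation integrated in time. As \<open>gen\<close> acts on the
    starting point and involves three sites only, it commutes with the integral.\<close>
  have gen_int: "gen (\<lambda>x. integral {0..q} (\<lambda>s. p s x y)) x = p q x y - (if x = y then 1 else 0)"
    if "0 \<le> q" for q x y
  proof -
    have 1: "((\<lambda>s. gen (\<lambda>x. p s x y) x) has_integral p q x y - p 0 x y) {0..q}"
      by (rule fundamental_theorem_of_calculus[OF that])
        (auto simp flip: has_real_derivative_iff_has_vector_derivative intro!: DERIV_subset[OF backward])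
    have 2: "((\<lambda>s. gen (\<lambda>x. p s x y) x) has_integral
        gen (\<lambda>x. integral {0..q} (\<lambda>s. p s x y)) x) {0..q}"
      unfolding gen_eq
      by (intro has_integral_add has_integral_mult_right has_integral_diff integrable_integral int)
    have "p 0 x y = (if x = y then 1 else 0)"
      using tf unfolding transition_function_def by blast
    then show ?thesis using has_integral_unique[OF 2 1] by (simp only:)
  qed
  have gen_v: "gen (v q) x = (\<Sum>y\<in>S. \<phi> y * p q x y)" if "0 \<le> q" for q x
  proof -
    have "gen (v q) x = \<phi> x + (\<Sum>y\<in>S. \<phi> y * (p q x y - (if x = y then 1 else 0)))"
      unfolding v_def u_def gen_add gen_sum gen_cmult gen_int[OF that] gen_g ..
    also have "\<dots> = \<phi> x + (\<Sum>y\<in>S. \<phi> y * p q x y) - (\<Sum>y\<in>S. if x = y then \<phi> y else 0)"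
      by (simp add: right_diff_distrib sum_subtractf if_distrib[of "(*) _"] cong: if_cong)
    \<comment> \<open>The initial values of \<open>p\<close> contribute \<open>- \<phi> x\<close>,
      which cancels \<open>gen g x = \<phi> x\<close>; this cancellation is the reason for adding
      \<open>g\<close>.\<close>
    also have "(\<Sum>y\<in>S. if x = y then \<phi> y else 0) = \<phi> x"
      using fin supp by (simp add: sum.delta')
    finally show ?thesis by simp
  qed
  have der: "((\<lambda>s. v s x) has_real_derivative gen (v q) x) (at q within {0..t})"
    if "q \<in> {0..t}" for q x
  proof -
    have "((\<lambda>b. integral {0..b} (\<lambda>s. p s x y)) has_real_derivative p q x y) (at q within {0..t})" for y
      by (rule integral_has_real_derivative[OF transition_continuous[OF tf]]) (use that in auto)
    then have "((\<lambda>s. v s x) has_real_derivative (\<Sum>y\<in>S. \<phi> y * p q x y)) (at q within {0..t})"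
      unfolding v_def u_def by (auto intro!: derivative_eq_intros simp: mult.commute)
    then show ?thesis using that by (simp add: gen_v)
  qed
  \<comment> \<open>A crude bound growing with \<open>t\<close>. It serves only to make the supremum
    in the maximum principle finite and leaves no trace in the result.\<close>
  have ubound: "\<bar>u q x\<bar> \<le> (\<Sum>y\<in>S. \<bar>\<phi> y\<bar> * t)" if "q \<in> {0..t}" for q x
  proof -
    have "\<bar>integral {0..q} (\<lambda>s. p s x y)\<bar> \<le> t" for y
    proof -
      have "norm (integral {0..q} (\<lambda>s. p s x y)) \<le> 1 * (q - 0)"
        by (rule integral_bound[OF _ transition_continuous[OF tf]])
          (use that tf transition_le_1[OF tf] in \<open>auto simp: transition_function_def\<close>)
      then show ?thesis using that by simp
    qed
    then show ?thesis unfolding u_def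
      by (intro order_trans[OF sum_abs] sum_mono) (auto simp: abs_mult intro!: mult_left_mono)
  qed
  have v0: "v 0 x = g x" for x by (simp add: v_def u_def)
  define C where "C = D + (\<Sum>y\<in>S. \<bar>\<phi> y\<bar> * t)"
  have vb: "\<bar>v q x\<bar> \<le> C" if "q \<in> {0..t}" for q x
    using ubound[OF that, of x] g_bound[of x] unfolding v_def C_def by linarith
  have "v t x \<le> D"
    by (rule maximum_principle[where t=t and C=C, OF der])
      (use vb v0 g_bound t0 in \<open>auto simp: abs_le_iff\<close>)
  moreover have "- v t x \<le> D"
    by (rule maximum_principle[where t=t and C=C and v="\<lambda>q x. - v q x"])
      (use vb v0 g_bound t0 der in \<open>auto simp: abs_le_iff gen_uminus intro!: derivative_intros\<close>)
  \<comment> \<open>The time integral is \<open>v - g\<close>, and both terms are bounded by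
    \<open>D\<close>; hence the factor 2.\<close>
  ultimately show ?thesis using g_bound[of x] unfolding v_def u_def by linarith
qed

text \<open>\<open>w k * r k 1\<close> is the conductance of the edge between \<open>k\<close> and
  \<open>k + 1\<close>; the bounded quantity is the resistance of that edge.\<close>

lemma conductance_ge: "1 / (w k * r k 1) \<le> K\<^sup>2"
proof -
  have "1 / K * (1 / K) \<le> w k * r k 1"
    using w_bounds[of k] r_bounds[of 1 k] K_pos w_pos[of k] by (intro mult_mono) auto
  moreover have "0 < w k * r k 1" using w_pos r_pos by simp
  ultimately show ?thesis using K_pos by (simp add: field_simps power2_eq_square)
qed

text \<open>In dimension one the Poisson equation is integrated twice: \<open>F\<close> is the flux.\<close>

lemma poisson_equation:
  assumes supp: "\<And>x. x \<notin> {a..b} \<Longrightarrow> \<phi> x = 0"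
    and zero: "(\<Sum>y\<in>{a..b}. w y * \<phi> y) = 0"
    and flux: "\<And>k. \<bar>\<Sum>y\<in>{a..k}. w y * \<phi> y\<bar> \<le> 1"
    and ab: "a \<le> b"
  obtains g where "\<And>x. gen g x = \<phi> x" "\<And>x. \<bar>g x\<bar> \<le> K\<^sup>2 * real_of_int (b - a + 1)"
proof
  define F where "F k = (\<Sum>y\<in>{a..k}. w y * \<phi> y)" for k
  \<comment> \<open>The increment of \<open>g\<close> over an edge is flux times resistance. By
    detailed balance, \<open>w x * gen g x\<close> is then the difference of the fluxes through the
    two edges at \<open>x\<close>.\<close>
  define g where "g x = (\<Sum>k\<in>{a..<x}. F k / (w k * r k 1))" for x
  have F_left: "F k = 0" if "k < a" for k using that by (simp add: F_def)
  have F_step: "F k = F (k - 1) + w k * \<phi> k" for k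
  proof (cases "a \<le> k")
    case True
    then have "{a..k} = insert k {a..k - 1}" by auto
    then show ?thesis by (simp add: F_def)
  next
    case False
    then show ?thesis using supp[of k] by (simp add: F_def)
  qed
  have F_right: "F k = 0" if "b \<le> k" for k
    using that
  proof (induction k rule: int_ge_induct)
    case base
    then show ?case using zero by (simp add: F_def)
  next
    case (step k)
    then show ?case using F_step[of "k + 1"] supp[of "k + 1"] by simp
  qed
  have g_step: "g (x + 1) - g x = F x / (w x * r x 1)" for x
  proof (cases "a \<le> x")
    case True
    then have "{a..<x + 1} = insert x {a..<x}" by auto
    then show ?thesis by (simp add: g_def)
  next
    case False
    then show ?thesis using F_left[of x] by (simp add: g_def)
  qed
  show "gen g x = \<phi> x" for x
  proof -
    have "gen g x = r x 1 * (g (x + 1) - g x) - r x (-1) * (g (x - 1 + 1) - g (x - 1))"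
      by (simp add: gen_eq algebra_simps)
    also have "\<dots> = r x 1 * (F x / (w x * r x 1)) - r x (-1) * (F (x - 1) / (w (x - 1) * r (x - 1) 1))"
      unfolding g_step ..
    also have "w (x - 1) * r (x - 1) 1 = w x * r x (-1)"
      using detailed_balance[of "x - 1"] by simp
    also have "r x 1 * (F x / (w x * r x 1)) - r x (-1) * (F (x - 1) / (w x * r x (-1)))
        = (F x - F (x - 1)) / w x"
      using r_pos[of 1 x] r_pos[of "-1" x] w_pos[of x] by (simp add: field_simps)
    also have "\<dots> = \<phi> x" using F_step[of x] w_pos[of x] by simp
    finally show ?thesis .
  qed
  show "\<bar>g x\<bar> \<le> K\<^sup>2 * real_of_int (b - a + 1)" for x
  proof -
    \<comment> \<open>From \<open>b\<close> onwards the flux vanishes because the total is zero. At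
      most \<open>b - a + 1\<close> terms remain, each a flux of size at most 1 times a
      resistance.\<close>
    have "g x = (\<Sum>k\<in>{a..<min x (b + 1)}. F k / (w k * r k 1))"
      unfolding g_def by (rule sum.mono_neutral_right) (auto simp: F_right)
    also have "\<bar>\<dots>\<bar> \<le> (\<Sum>k\<in>{a..<min x (b + 1)}. K\<^sup>2)"
    proof (intro order_trans[OF sum_abs] sum_mono)
      fix k
      have "\<bar>F k / (w k * r k 1)\<bar> = \<bar>F k\<bar> * (1 / (w k * r k 1))"
        using w_pos[of k] r_pos[of 1 k] by (simp add: abs_mult)
      also have "\<dots> \<le> 1 * K\<^sup>2"
        using flux[of k] conductance_ge[of k] w_pos[of k] r_pos[of 1 k]
        by (intro mult_mono) (auto simp: F_def)
      finally show "\<bar>F k / (w k * r k 1)\<bar> \<le> K\<^sup>2" by simp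
    qed
    also have "\<dots> = real (nat (min x (b + 1) - a)) * K\<^sup>2" by simp
    also have "\<dots> \<le> real_of_int (b - a + 1) * K\<^sup>2"
      using ab by (intro mult_right_mono) (auto simp: min_def)
    finally show ?thesis by (simp add: mult.commute)
  qed
qed

section \<open>Blocks of sites and their centred test functions\<close>

definition weight :: "int \<Rightarrow> int \<Rightarrow> real" where
  "weight a b = (\<Sum>y\<in>{a..b}. w y)"

lemma weight_ge: "a \<le> b \<Longrightarrow> real_of_int (b - a + 1) / K \<le> weight a b"
  using sum_bounded_below[of "{a..b}" "1 / K" w] w_bounds by (auto simp: weight_def)

lemma weight_le: "a \<le> b \<Longrightarrow> weight a b \<le> real_of_int (b - a + 1) * K"
  using sum_bounded_above[of "{a..b}" w K] w_bounds by (auto simp: weight_def)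

lemma weight_pos: "a \<le> b \<Longrightarrow> 0 < weight a b"
  unfolding weight_def by (intro sum_pos) (auto simp: w_pos)

text \<open>The difference of two probability densities with respect to \<open>w\<close>: the point
  mass at \<open>x\<close> and the uniform density on the block. Its \<open>w\<close>-sum is
  therefore zero, as solvability of the Poisson equation with vanishing outer flux requires.\<close>

definition block_test :: "int \<Rightarrow> int \<Rightarrow> int \<Rightarrow> int \<Rightarrow> real" where
  "block_test x a b y = indicat_real {x} y / w x - indicat_real {a..b} y / weight a b"

text \<open>The flux is a difference of two distribution functions, hence at most 1 in size. The
  resulting bound depends neither on \<open>t\<close> nor on the starting point
  \<open>z\<close>.\<close>

lemma block_test_green:
  assumes tf: "transition_function r p" and x: "x \<in> {a..b}" and t0: "0 \<le> t"
  shows "\<bar>\<Sum>y\<in>{a..b}. block_test x a b y * integral {0..t} (\<lambda>s. p s z y)\<bar>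
    \<le> 2 * (K\<^sup>2 * real_of_int (b - a + 1))"
proof -
  have ab: "a \<le> b" using x by auto
  have flux_eq: "(\<Sum>y\<in>{a..k}. w y * block_test x a b y) =
      indicat_real {..k} x - weight a (min k b) / weight a b" for k
  proof -
    have "(\<Sum>y\<in>{a..k}. w y * block_test x a b y) =
       (\<Sum>y\<in>{a..k}. if y = x then 1 else 0) - (\<Sum>y\<in>{a..k}. w y * indicat_real {a..b} y) / weight a b"
      unfolding sum_divide_distrib sum_subtractf[symmetric]
      by (rule sum.cong) (use w_pos in \<open>auto simp: block_test_def indicator_def field_simps less_imp_neq[symmetric]\<close>)
    also have "(\<Sum>y\<in>{a..k}. if y = x then 1 else (0::real)) = indicat_real {..k} x"
      using x by (auto simp: indicator_def)
    also have "(\<Sum>y\<in>{a..k}. w y * indicat_real {a..b} y) = weight a (min k b)"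
    proof -
      have "(\<Sum>y\<in>{a..k}. w y * indicat_real {a..b} y) = (\<Sum>y\<in>{a..k} \<inter> {a..b}. w y)"
        by (rule sum.mono_neutral_cong_right) (auto simp: indicator_def)
      also have "{a..k} \<inter> {a..b} = {a..min k b}" by auto
      finally show ?thesis by (simp add: weight_def)
    qed
    finally show ?thesis .
  qed
  have mono: "0 \<le> weight a (min k b)" "weight a (min k b) \<le> weight a b" for k
    unfolding weight_def by (auto intro!: sum_nonneg sum_mono2 less_imp_le[OF w_pos])
  obtain g where g: "\<And>y. gen g y = block_test x a b y" "\<And>y. \<bar>g y\<bar> \<le> K\<^sup>2 * real_of_int (b - a + 1)"
  proof (rule poisson_equation[where a=a and b=b and \<phi>="block_test x a b"])
    show "block_test x a b y = 0" if "y \<notin> {a..b}" for y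
      using that x by (auto simp: block_test_def)
    show "(\<Sum>y\<in>{a..b}. w y * block_test x a b y) = 0"
      using weight_pos[OF ab] x by (simp add: flux_eq)
    show "\<bar>\<Sum>y\<in>{a..k}. w y * block_test x a b y\<bar> \<le> 1" for k
    proof -
      have "0 \<le> weight a (min k b) / weight a b" "weight a (min k b) / weight a b \<le> 1"
        using mono[of k] weight_pos[OF ab] by auto
      then show ?thesis unfolding flux_eq by (auto simp: indicator_def)
    qed
  qed (use ab in auto)
  show ?thesis
    by (rule time_integral_bound[OF tf _ _ g t0]) (use x in \<open>auto simp: block_test_def\<close>)
qed

end

section \<open>Second moments of additive functionals\<close>

text \<open>Restricting the measure instead of the integrand keeps it finite: bounded measurable
  functions are integrable, also on products with a probability space, and Fubini applies
  directly.\<close>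

abbreviation time_measure :: "real \<Rightarrow> real measure" where
  "time_measure t \<equiv> restrict_space lborel {0..t}"

lemma finite_time_measure: "finite_measure (time_measure t)"
  by (rule finite_measureI)
    (cases "0 \<le> t"; simp add: emeasure_restrict_space space_restrict_space)

lemma measure_time_measure: "0 \<le> t \<Longrightarrow> measure (time_measure t) (space (time_measure t)) = t"
  by (simp add: measure_restrict_space space_restrict_space)

lemma set_integral_eq_time_measure:
  "(LBINT s:{0..t}. f s) = (\<integral>s. f s \<partial>time_measure t)" for f :: "real \<Rightarrow> real"
  by (simp add: set_lebesgue_integral_def integral_restrict_space)

text \<open>By right continuity the process is the pointwise limit of processes that read the path
  at the next grid point to the right of \<open>s\<close>; these take countably many times and are
  jointly measurable.\<close>

lemma measurable_pair_right_continuous: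
  fixes Z :: "real \<Rightarrow> 'b \<Rightarrow> real"
  assumes meas: "\<And>t. 0 \<le> t \<Longrightarrow> Z t \<in> borel_measurable M"
    and rc: "\<And>t u. 0 \<le> t \<Longrightarrow> u \<in> space M \<Longrightarrow> ((\<lambda>s. Z s u) \<longlongrightarrow> Z t u) (at_right t)"
  shows "(\<lambda>(u, s). Z s u) \<in> borel_measurable (M \<Otimes>\<^sub>M time_measure T)"
proof -
  \<comment> \<open>The \<open>+ 1\<close> puts the grid point strictly to the right of
    \<open>s\<close>, as a limit along \<open>at_right\<close> demands. The \<open>max 0\<close>
    keeps the time nonnegative for every integer value of the floor, where \<open>Z\<close> is known
    to be measurable.\<close>
  define Zk where "Zk k = (\<lambda>(u, s). Z (real_of_int (max 0 \<lfloor>real (Suc k) * s\<rfloor> + 1) / real (Suc k)) u)" for k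
  have Zk: "Zk k \<in> borel_measurable (M \<Otimes>\<^sub>M time_measure T)" for k
  proof -
    have 1: "(\<lambda>x. Z (real_of_int (max 0 i + 1) / real (Suc k)) (fst x))
        \<in> borel_measurable (M \<Otimes>\<^sub>M time_measure T)" for i
      by (rule measurable_compose[OF measurable_fst meas]) auto
    have "(\<lambda>s. \<lfloor>real (Suc k) * s\<rfloor>) \<in> measurable (time_measure T) (count_space UNIV)"
      by (rule measurable_restrict_space1) measurable
    then have 2: "(\<lambda>x. \<lfloor>real (Suc k) * snd x\<rfloor>)
        \<in> measurable (M \<Otimes>\<^sub>M time_measure T) (count_space UNIV)"
      by (rule measurable_compose[OF measurable_snd])
    show ?thesis unfolding Zk_def case_prod_unfold
      by (rule measurable_compose_countable[OF 1 2])
  qed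
  show ?thesis
  proof (rule borel_measurable_LIMSEQ_real[OF _ Zk])
    fix x assume "x \<in> space (M \<Otimes>\<^sub>M time_measure T)"
    then obtain u s where x: "x = (u, s)" and u: "u \<in> space M" and s: "0 \<le> s"
      by (auto simp: space_pair_measure space_restrict_space)
    define a where "a k = real_of_int (max 0 \<lfloor>real (Suc k) * s\<rfloor> + 1) / real (Suc k)" for k
    have fl: "0 \<le> \<lfloor>real (Suc k) * s\<rfloor>" for k using s by simp
    have a_gt: "s < a k" for k
    proof -
      have "real (Suc k) * s < real_of_int (\<lfloor>real (Suc k) * s\<rfloor> + 1)" by linarith
      then show ?thesis using fl[of k] by (simp add: a_def field_simps max_def)
    qed
    have a_le: "a k \<le> s + inverse (real (Suc k))" for k
    proof -
      have "real_of_int (\<lfloor>real (Suc k) * s\<rfloor> + 1) \<le> real (Suc k) * s + 1" by linarith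
      then have "a k \<le> (real (Suc k) * s + 1) / real (Suc k)"
        unfolding a_def using fl[of k] by (intro divide_right_mono) (auto simp: max_def)
      then show ?thesis by (simp add: field_simps)
    qed
    have "a \<longlonglongrightarrow> s"
    proof (rule tendsto_sandwich[of "\<lambda>_. s" _ _ "\<lambda>k. s + inverse (real (Suc k))"])
      show "(\<lambda>k. s + inverse (real (Suc k))) \<longlonglongrightarrow> s"
        using tendsto_add[OF tendsto_const LIMSEQ_inverse_real_of_nat, of s] by simp
    qed (use a_gt a_le in \<open>auto intro!: always_eventually less_imp_le\<close>)
    then have "filterlim a (at_right s) sequentially"
      using a_gt by (auto simp: filterlim_at intro!: always_eventually)
    then have "(\<lambda>k. Z (a k) u) \<longlonglongrightarrow> Z s u"
      by (rule filterlim_compose[OF rc[OF s u]])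
    then show "(\<lambda>k. Zk k x) \<longlonglongrightarrow> (case x of (u, s) \<Rightarrow> Z s u)"
      by (simp add: x Zk_def a_def)
  qed
qed

lemma measurable_pair_integer_process:
  fixes Y :: "real \<Rightarrow> 'b \<Rightarrow> int"
  assumes meas: "\<And>t. 0 \<le> t \<Longrightarrow> Y t \<in> measurable M (count_space UNIV)"
    and rc: "\<And>t u. 0 \<le> t \<Longrightarrow> u \<in> space M \<Longrightarrow>
      ((\<lambda>s. real_of_int (Y s u)) \<longlongrightarrow> real_of_int (Y t u)) (at_right t)"
  shows "(\<lambda>(u, s). Y s u) \<in> measurable (M \<Otimes>\<^sub>M time_measure T) (count_space UNIV)"
proof -
  have "(\<lambda>(u, s). real_of_int (Y s u)) \<in> borel_measurable (M \<Otimes>\<^sub>M time_measure T)"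
    by (rule measurable_pair_right_continuous)
      (use rc in \<open>auto intro!: measurable_compose[OF meas]\<close>)
  from measurable_compose[OF this measurable_real_floor] show ?thesis
    by (simp add: case_prod_unfold)
qed

text \<open>The square is a double integral over pairs of times; the diagonal is a null set and the
  two halves agree by symmetry. Ordered times are what the Markov property can handle.\<close>

lemma square_integral_ordered:
  fixes f :: "real \<Rightarrow> real"
  assumes meas [measurable]: "f \<in> borel_measurable (time_measure t)" and bnd: "\<And>s. \<bar>f s\<bar> \<le> C"
  shows "(\<integral>s. f s \<partial>time_measure t)\<^sup>2 =
    2 * (\<integral>s. (\<integral>s'. indicat_real {s..} s' * (f s * f s') \<partial>time_measure t) \<partial>time_measure t)"
proof -
  let ?I = "time_measure t"
  interpret I: finite_measure ?I by (rule finite_time_measure)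
  interpret II: pair_sigma_finite ?I ?I ..
  have fin: "finite_measure (?I \<Otimes>\<^sub>M ?I)"
    by (rule finite_measure_pair_measure) (rule finite_time_measure)+
  have C0: "0 \<le> C" using bnd[of 0] by simp
  have [measurable]: "(\<lambda>s. s) \<in> borel_measurable ?I" by (rule measurable_restrict_space1) simp
  have ff: "\<bar>f s * f s'\<bar> \<le> C * C" for s s'
    unfolding abs_mult using bnd C0 by (intro mult_mono) auto
  have int2: "integrable (?I \<Otimes>\<^sub>M ?I) (\<lambda>(s, s'). indicat_real {x. P (fst x) (snd x)} (s, s') * (f s * f s'))"
    if [measurable]: "Measurable.pred (?I \<Otimes>\<^sub>M ?I) (\<lambda>x. P (fst x) (snd x))" for P
    by (rule finite_measure.integrable_const_bound[OF fin, where B="C * C"])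
      (use ff C0 in \<open>auto simp: indicator_def case_prod_unfold intro!: AE_I2\<close>)
  have intf: "integrable ?I f"
    by (rule I.integrable_const_bound[where B=C]) (use bnd in auto)
  have int1: "integrable ?I (\<lambda>s'. indicat_real A s' * (f s * f s'))"
    if "A \<in> sets borel" for A s
    by (rule I.integrable_const_bound[where B="C * C"])
      (use ff C0 that in \<open>auto simp: indicator_def intro!: AE_I2\<close>)
  define G where "G = (\<integral>s. (\<integral>s'. indicat_real {s..} s' * (f s * f s') \<partial>?I) \<partial>?I)"
  have i1: "integrable (?I \<Otimes>\<^sub>M ?I) (\<lambda>(s, s'). indicat_real {s..} s' * (f s * f s'))"
    using int2[of "\<lambda>s s'. s \<le> s'"] by (simp add: indicator_def)
  have i2: "integrable (?I \<Otimes>\<^sub>M ?I) (\<lambda>(s, s'). indicat_real {..s} s' * (f s * f s'))"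
    using int2[of "\<lambda>s s'. s' \<le> s"] by (simp add: indicator_def)
  have "(\<integral>s. (\<integral>s'. indicat_real {..s} s' * (f s * f s') \<partial>?I) \<partial>?I)
      = (\<integral>s'. (\<integral>s. indicat_real {..s} s' * (f s * f s') \<partial>?I) \<partial>?I)"
    by (rule II.Fubini_integral[OF i2, symmetric])
  also have "\<dots> = G"
    unfolding G_def by (intro Bochner_Integration.integral_cong refl) (auto simp: indicator_def mult.commute)
  finally have G': "(\<integral>s. (\<integral>s'. indicat_real {..s} s' * (f s * f s') \<partial>?I) \<partial>?I) = G" .
  have "(\<integral>s. f s \<partial>?I)\<^sup>2 = (\<integral>s. (\<integral>s'. f s * f s' \<partial>?I) \<partial>?I)"
    by (simp add: power2_eq_square)
  also have "\<dots> = (\<integral>s. (\<integral>s'. indicat_real {s..} s' * (f s * f s') \<partial>?I)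
      + (\<integral>s'. indicat_real {..s} s' * (f s * f s') \<partial>?I) \<partial>?I)"
  proof (intro Bochner_Integration.integral_cong refl)
    fix s
    have "AE s' in ?I. s' \<noteq> s"
      using AE_lborel_singleton[of s] by (auto simp: AE_restrict_space_iff elim: eventually_mono)
    then have "(\<integral>s'. f s * f s' \<partial>?I) =
        (\<integral>s'. indicat_real {s..} s' * (f s * f s') + indicat_real {..s} s' * (f s * f s') \<partial>?I)"
      by (intro integral_cong_AE) (auto simp: indicator_def)
    also have "\<dots> = (\<integral>s'. indicat_real {s..} s' * (f s * f s') \<partial>?I)
      + (\<integral>s'. indicat_real {..s} s' * (f s * f s') \<partial>?I)"
      by (rule Bochner_Integration.integral_add[OF int1 int1]) auto
    finally show "(\<integral>s'. f s * f s' \<partial>?I) = \<dots>" .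
  qed
  also have "\<dots> = G + (\<integral>s. (\<integral>s'. indicat_real {..s} s' * (f s * f s') \<partial>?I) \<partial>?I)"
    unfolding G_def
    by (rule Bochner_Integration.integral_add[OF II.integrable_fst[OF i1] II.integrable_fst[OF i2]])
  finally show ?thesis by (simp add: G' G_def)
qed

lemma expectation_finite_support:
  fixes Y :: "'b \<Rightarrow> int" and \<psi> :: "int \<Rightarrow> real"
  assumes "prob_space M" and [measurable]: "Y \<in> measurable M (count_space UNIV)"
    and fin: "finite S" and supp: "\<And>y. y \<notin> S \<Longrightarrow> \<psi> y = 0"
  shows "(\<integral>u. \<psi> (Y u) \<partial>M) = (\<Sum>y\<in>S. \<psi> y * measure M {u \<in> space M. Y u = y})"
proof -
  interpret prob_space M by fact
  have "\<psi> (Y u) = (\<Sum>y\<in>S. \<psi> y * indicat_real {u. Y u = y} u)" for u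
    using fin supp by (cases "Y u \<in> S") (simp_all add: indicator_def if_distrib[of "(*) _"] cong: if_cong)
  then have "(\<integral>u. \<psi> (Y u) \<partial>M) = (\<integral>u. (\<Sum>y\<in>S. \<psi> y * indicat_real {u \<in> space M. Y u = y} u) \<partial>M)"
    by (intro Bochner_Integration.integral_cong) (auto simp: indicator_def intro!: sum.cong)
  also have "\<dots> = (\<Sum>y\<in>S. (\<integral>u. \<psi> y * indicat_real {u \<in> space M. Y u = y} u \<partial>M))"
    by (rule Bochner_Integration.integral_sum) (auto intro!: integrable_mult_right integrable_real_indicator simp: emeasure_eq_measure)
  also have "\<dots> = (\<Sum>y\<in>S. \<psi> y * measure M {u \<in> space M. Y u = y})"
    by (auto intro!: sum.cong arg_cong[where f="measure M"])
  finally show ?thesis .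
qed

lemma expectation_two_finite_support:
  fixes Y Y' :: "'b \<Rightarrow> int" and \<psi> :: "int \<Rightarrow> real"
  assumes "prob_space M" and [measurable]: "Y \<in> measurable M (count_space UNIV)"
    "Y' \<in> measurable M (count_space UNIV)"
    and fin: "finite S" and supp: "\<And>y. y \<notin> S \<Longrightarrow> \<psi> y = 0"
  shows "(\<integral>u. \<psi> (Y u) * \<psi> (Y' u) \<partial>M) =
    (\<Sum>y\<in>S. \<Sum>y'\<in>S. \<psi> y * \<psi> y' * measure M {u \<in> space M. Y u = y \<and> Y' u = y'})"
proof -
  interpret prob_space M by fact
  have *: "\<psi> (Y u) = (\<Sum>y\<in>S. \<psi> y * indicat_real {y} (Y u))" for Y :: "'b \<Rightarrow> int" and u
    using fin supp by (cases "Y u \<in> S") (simp_all add: indicator_def if_distrib[of "(*) _"] cong: if_cong)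
  have "\<psi> (Y u) * \<psi> (Y' u) = (\<Sum>y\<in>S. \<Sum>y'\<in>S. \<psi> y * \<psi> y' * indicat_real {u. Y u = y \<and> Y' u = y'} u)" for u
    unfolding *[of Y] *[of Y'] sum_product
    by (intro sum.cong refl) (auto simp: indicator_def)
  then have "(\<integral>u. \<psi> (Y u) * \<psi> (Y' u) \<partial>M) = (\<integral>u. (\<Sum>y\<in>S. \<Sum>y'\<in>S. \<psi> y * \<psi> y' *
      indicat_real {u \<in> space M. Y u = y \<and> Y' u = y'} u) \<partial>M)"
    by (intro Bochner_Integration.integral_cong) (auto simp: indicator_def intro!: sum.cong)
  also have "\<dots> = (\<Sum>y\<in>S. \<Sum>y'\<in>S. (\<integral>u. \<psi> y * \<psi> y' * indicat_real {u \<in> space M. Y u = y \<and> Y' u = y'} u \<partial>M))"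
    by (subst Bochner_Integration.integral_sum, (intro Bochner_Integration.integrable_sum integrable_mult_right integrable_real_indicator; simp add: emeasure_eq_measure))
      (intro sum.cong refl Bochner_Integration.integral_sum integrable_mult_right integrable_real_indicator; simp add: emeasure_eq_measure)
  finally show ?thesis by (simp add: Int_def conj_commute)
qed

lemma integral_time_shift:
  fixes h :: "real \<Rightarrow> real"
  assumes cont: "continuous_on {0..} h" and s: "0 \<le> s" "s \<le> t"
  shows "(\<integral>s'. indicat_real {s..} s' * h (s' - s) \<partial>time_measure t) = integral {0..t - s} h"
    and "integrable (time_measure t) (\<lambda>s'. indicat_real {s..} s' * h (s' - s))"
proof -
  have c: "continuous_on {s..t} (\<lambda>s'. h (s' - s))"
    by (rule continuous_on_compose2[OF cont]) (auto intro!: continuous_intros)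
  have si: "set_integrable lborel {s..t} (\<lambda>s'. h (s' - s))"
    unfolding set_integrable_def by (rule borel_integrable_compact[OF _ c]) simp
  have eq: "(\<lambda>s'. indicat_real {0..t} s' * (indicat_real {s..} s' * h (s' - s)))
      = (\<lambda>s'. indicat_real {s..t} s' * h (s' - s))"
    using s by (auto simp: indicator_def)
  show "integrable (time_measure t) (\<lambda>s'. indicat_real {s..} s' * h (s' - s))"
    using si by (simp add: integrable_restrict_space set_integrable_def eq)
  have "(\<integral>s'. indicat_real {s..} s' * h (s' - s) \<partial>time_measure t) = (LBINT s':{s..t}. h (s' - s))"
    by (simp add: integral_restrict_space set_lebesgue_integral_def eq)
  also have "\<dots> = integral {s..t} (\<lambda>s'. h (s' - s))"
    by (rule set_borel_integral_eq_integral[OF si])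
  also have "\<dots> = integral {0..t - s} h"
    using integral_shift[of s "- s" t h] continuous_on_subset[OF cont, of "{0..t - s}"]
    by (auto simp: o_def)
  finally show "(\<integral>s'. indicat_real {s..} s' * h (s' - s) \<partial>time_measure t) = integral {0..t - s} h" .
qed

text \<open>By the Markov property the second moment is twice the integral over \<open>s\<close> of
  \<open>\<phi> (Y s)\<close> times the expected future integral started from \<open>Y s\<close>.\<close>

lemma second_moment_bound:
  fixes Y :: "real \<Rightarrow> 'b \<Rightarrow> int" and p :: "real \<Rightarrow> int \<Rightarrow> int \<Rightarrow> real" and \<phi> :: "int \<Rightarrow> real"
  assumes M: "prob_space M" and t0: "0 \<le> t"
    and Y_pair [measurable]:
      "(\<lambda>(u, s). Y s u) \<in> measurable (M \<Otimes>\<^sub>M time_measure t) (count_space UNIV)"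
    and Y_meas: "\<And>s. 0 \<le> s \<Longrightarrow> Y s \<in> measurable M (count_space UNIV)"
    and fin: "finite S" and supp: "\<And>y. y \<notin> S \<Longrightarrow> \<phi> y = 0"
    and one: "\<And>s y. 0 \<le> s \<Longrightarrow> measure M {u \<in> space M. Y s u = y} = p s x0 y"
    and two: "\<And>s s' y y'. 0 \<le> s \<Longrightarrow> s \<le> s' \<Longrightarrow>
      measure M {u \<in> space M. Y s u = y \<and> Y s' u = y'} = p s x0 y * p (s' - s) y y'"
    and p_cont: "\<And>y y'. continuous_on {0..} (\<lambda>s. p s y y')"
    and green: "\<And>v y. 0 \<le> v \<Longrightarrow> \<bar>\<Sum>y'\<in>S. \<phi> y' * integral {0..v} (\<lambda>s. p s y y')\<bar> \<le> B"
  shows "(\<integral>u. (\<integral>s. \<phi> (Y s u) \<partial>time_measure t)\<^sup>2 \<partial>M)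
    \<le> 2 * B * (\<integral>u. (\<integral>s. \<bar>\<phi> (Y s u)\<bar> \<partial>time_measure t) \<partial>M)"
proof -
  let ?I = "time_measure t"
  interpret M: prob_space M by fact
  interpret I: finite_measure ?I by (rule finite_time_measure)
  interpret MI: pair_sigma_finite M ?I ..
  have finMI: "finite_measure (M \<Otimes>\<^sub>M ?I)"
    by (rule finite_measure_pair_measure) unfold_locales
  define C where "C = (\<Sum>y\<in>S. \<bar>\<phi> y\<bar>)"
  have C: "\<bar>\<phi> y\<bar> \<le> C" for y
  proof (cases "y \<in> S")
    case True
    then show ?thesis unfolding C_def by (rule member_le_sum) (use fin in auto)
  next
    case False
    then show ?thesis using supp by (simp add: C_def sum_nonneg)
  qed
  have C0: "0 \<le> C" unfolding C_def by (simp add: sum_nonneg)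
  have CC: "\<bar>\<phi> y * \<phi> y'\<bar> \<le> C * C" for y y'
    unfolding abs_mult using C C0 by (intro mult_mono) auto
  have [measurable]: "\<phi> \<in> measurable (count_space UNIV) borel" by simp
  have sp: "s \<in> space ?I \<longleftrightarrow> 0 \<le> s \<and> s \<le> t" for s by (auto simp: space_restrict_space)
  have Ys [measurable]: "(\<lambda>s. Y s u) \<in> measurable ?I (count_space UNIV)" if "u \<in> space M" for u
    using measurable_compose[OF measurable_Pair1'[OF that] Y_pair] by simp
  have Yu [measurable]: "(\<lambda>u. Y s u) \<in> measurable M (count_space UNIV)" if "s \<in> space ?I" for s
    using Y_meas that sp by blast
  have [measurable]: "(\<lambda>s. s) \<in> borel_measurable ?I" by (rule measurable_restrict_space1) simp
  define h where "h u s = (\<integral>s'. indicat_real {s..} s' * (\<phi> (Y s u) * \<phi> (Y s' u)) \<partial>?I)" for u s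
  have h_meas: "(\<lambda>(u, s). h u s) \<in> borel_measurable (M \<Otimes>\<^sub>M ?I)"
  proof -
    have 1: "(\<lambda>x. Y (snd (fst x)) (fst (fst x))) \<in> measurable ((M \<Otimes>\<^sub>M ?I) \<Otimes>\<^sub>M ?I) (count_space UNIV)"
      using measurable_compose[OF measurable_fst Y_pair] by (simp add: case_prod_unfold)
    have "(\<lambda>x. (fst (fst x), snd x)) \<in> measurable ((M \<Otimes>\<^sub>M ?I) \<Otimes>\<^sub>M ?I) (M \<Otimes>\<^sub>M ?I)" by measurable
    from measurable_compose[OF this Y_pair]
    have 2: "(\<lambda>x. Y (snd x) (fst (fst x))) \<in> measurable ((M \<Otimes>\<^sub>M ?I) \<Otimes>\<^sub>M ?I) (count_space UNIV)"
      by simp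
    have "(\<lambda>x. indicat_real {x. snd (fst x) \<le> snd x} x * (\<phi> (Y (snd (fst x)) (fst (fst x))) * \<phi> (Y (snd x) (fst (fst x)))))
        \<in> borel_measurable ((M \<Otimes>\<^sub>M ?I) \<Otimes>\<^sub>M ?I)"
      using 1 2 by measurable
    then have "(\<lambda>(q, s'). indicat_real {snd q..} s' * (\<phi> (Y (snd q) (fst q)) * \<phi> (Y s' (fst q))))
        \<in> borel_measurable ((M \<Otimes>\<^sub>M ?I) \<Otimes>\<^sub>M ?I)"
      by (simp add: case_prod_unfold indicator_def)
    from I.borel_measurable_lebesgue_integral[OF this] show ?thesis
      by (simp add: h_def case_prod_unfold)
  qed
  have h_bound: "\<bar>h u s\<bar> \<le> C * C * t" if "u \<in> space M" for u s
  proof -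
    have "\<bar>h u s\<bar> \<le> (\<integral>s'. C * C \<partial>?I)"
      unfolding h_def
      by (rule order_trans[OF integral_abs_bound integral_mono_AE'])
        (use CC C0 in \<open>auto simp: indicator_def abs_mult intro!: AE_I2\<close>)
    then show ?thesis using measure_time_measure[OF t0] by (simp add: mult_ac)
  qed
  have h_int: "integrable (M \<Otimes>\<^sub>M ?I) (\<lambda>(u, s). h u s)"
    by (rule finite_measure.integrable_const_bound[OF finMI, where B="C * C * t"])
      (use h_meas h_bound in \<open>auto intro!: AE_I2 simp: space_pair_measure\<close>)
  have inner: "(\<integral>u. h u s \<partial>M) \<le> B * (\<integral>u. \<bar>\<phi> (Y s u)\<bar> \<partial>M)" if s: "s \<in> space ?I" for s
  proof -
    have s0: "0 \<le> s" "s \<le> t" using s sp by auto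
    have int: "integrable (M \<Otimes>\<^sub>M ?I) (\<lambda>(u, s'). indicat_real {s..} s' * (\<phi> (Y s u) * \<phi> (Y s' u)))"
    proof (rule finite_measure.integrable_const_bound[OF finMI, where B="C * C"])
      have 1: "(\<lambda>x. Y s (fst x)) \<in> measurable (M \<Otimes>\<^sub>M ?I) (count_space UNIV)"
        by (rule measurable_compose[OF measurable_fst Yu[OF s]])
      show "(\<lambda>(u, s'). indicat_real {s..} s' * (\<phi> (Y s u) * \<phi> (Y s' u))) \<in> borel_measurable (M \<Otimes>\<^sub>M ?I)"
        using 1 Y_pair unfolding case_prod_unfold by measurable
    qed (use CC C0 in \<open>auto simp: indicator_def intro!: AE_I2\<close>)
    have "(\<integral>u. h u s \<partial>M) = (\<integral>s'. (\<integral>u. indicat_real {s..} s' * (\<phi> (Y s u) * \<phi> (Y s' u)) \<partial>M) \<partial>?I)"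
      unfolding h_def by (rule MI.Fubini_integral[OF int, symmetric])
    also have "\<dots> = (\<integral>s'. (\<Sum>y\<in>S. \<Sum>y'\<in>S. \<phi> y * p s x0 y * \<phi> y' * (indicat_real {s..} s' * p (s' - s) y y')) \<partial>?I)"
    proof (intro Bochner_Integration.integral_cong refl)
      fix s' assume s': "s' \<in> space ?I"
      show "(\<integral>u. indicat_real {s..} s' * (\<phi> (Y s u) * \<phi> (Y s' u)) \<partial>M) =
        (\<Sum>y\<in>S. \<Sum>y'\<in>S. \<phi> y * p s x0 y * \<phi> y' * (indicat_real {s..} s' * p (s' - s) y y'))"
      proof (cases "s \<le> s'")
        case True
        then show ?thesis
          using expectation_two_finite_support[OF M Yu[OF s] Yu[OF s'] fin supp]
          by (simp add: two[OF s0(1)] mult.assoc mult.left_commute)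
      qed simp
    qed
    also have "\<dots> = (\<Sum>y\<in>S. \<Sum>y'\<in>S. \<phi> y * p s x0 y * \<phi> y' * integral {0..t - s} (\<lambda>s. p s y y'))"
      by (simp add: Bochner_Integration.integral_sum integral_time_shift[OF p_cont s0])
    \<comment> \<open>The inner sum is the expected integral of \<open>\<phi>\<close> over the
      remaining time \<open>t - s\<close> for a walk started from \<open>y\<close>, the quantity
      bounded by \<open>green\<close>.\<close>
    also have "\<dots> = (\<Sum>y\<in>S. \<phi> y * p s x0 y * (\<Sum>y'\<in>S. \<phi> y' * integral {0..t - s} (\<lambda>s. p s y y')))"
      by (simp add: sum_distrib_left mult.assoc)
    also have "\<dots> \<le> (\<Sum>y\<in>S. \<bar>\<phi> y\<bar> * p s x0 y * B)"
    proof (rule sum_mono)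
      fix y
      have p0: "0 \<le> p s x0 y" using one[OF s0(1), of y] by (metis measure_nonneg)
      have "\<phi> y * p s x0 y * (\<Sum>y'\<in>S. \<phi> y' * integral {0..t - s} (\<lambda>s. p s y y'))
        \<le> \<bar>\<phi> y * p s x0 y\<bar> * \<bar>\<Sum>y'\<in>S. \<phi> y' * integral {0..t - s} (\<lambda>s. p s y y')\<bar>"
        by (simp flip: abs_mult)
      also have "\<dots> \<le> \<bar>\<phi> y * p s x0 y\<bar> * B"
        by (rule mult_left_mono[OF green]) (use s0 in auto)
      finally show "\<phi> y * p s x0 y * (\<Sum>y'\<in>S. \<phi> y' * integral {0..t - s} (\<lambda>s. p s y y')) \<le> \<bar>\<phi> y\<bar> * p s x0 y * B"
        using p0 by (simp add: abs_mult)
    qed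
    also have "\<dots> = B * (\<Sum>y\<in>S. \<bar>\<phi> y\<bar> * p s x0 y)"
      by (simp add: sum_distrib_left mult.commute)
    also have "(\<Sum>y\<in>S. \<bar>\<phi> y\<bar> * p s x0 y) = (\<integral>u. \<bar>\<phi> (Y s u)\<bar> \<partial>M)"
      using expectation_finite_support[OF M Yu[OF s] fin, of "\<lambda>y. \<bar>\<phi> y\<bar>"] supp
      by (simp add: one[OF s0(1)])
    finally show ?thesis .
  qed
  have abs_int: "integrable (M \<Otimes>\<^sub>M ?I) (\<lambda>(u, s). \<bar>\<phi> (Y s u)\<bar>)"
    by (rule finite_measure.integrable_const_bound[OF finMI, where B=C])
      (use C in \<open>auto intro!: AE_I2 simp: case_prod_unfold\<close>)
  have "(\<integral>u. (\<integral>s. \<phi> (Y s u) \<partial>?I)\<^sup>2 \<partial>M) = (\<integral>u. 2 * (\<integral>s. h u s \<partial>?I) \<partial>M)"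
  proof (intro Bochner_Integration.integral_cong refl)
    fix u assume u: "u \<in> space M"
    show "(\<integral>s. \<phi> (Y s u) \<partial>?I)\<^sup>2 = 2 * (\<integral>s. h u s \<partial>?I)"
      unfolding h_def by (rule square_integral_ordered[OF _ C]) (use Ys[OF u] in measurable)
  qed
  also have "\<dots> = 2 * (\<integral>s. (\<integral>u. h u s \<partial>M) \<partial>?I)"
    by (simp add: MI.Fubini_integral[OF h_int])
  also have "\<dots> \<le> 2 * (\<integral>s. B * (\<integral>u. \<bar>\<phi> (Y s u)\<bar> \<partial>M) \<partial>?I)"
    by (intro mult_left_mono integral_mono MI.integrable_snd[OF h_int] integrable_mult_right
        MI.integrable_snd[OF abs_int] inner) auto
  also have "\<dots> = 2 * B * (\<integral>u. (\<integral>s. \<bar>\<phi> (Y s u)\<bar> \<partial>?I) \<partial>M)"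
    using MI.Fubini_integral[OF abs_int] by simp
  finally show ?thesis .
qed


lemma (in prob_space) expectation_abs_le_sqrt:
  fixes f :: "'a \<Rightarrow> real"
  assumes "integrable M f" "integrable M (\<lambda>u. (f u)\<^sup>2)"
  shows "expectation (\<lambda>u. \<bar>f u\<bar>) \<le> sqrt (expectation (\<lambda>u. (f u)\<^sup>2))"
proof -
  have "0 \<le> variance (\<lambda>u. \<bar>f u\<bar>)" by (rule variance_positive)
  also have "\<dots> = expectation (\<lambda>u. (f u)\<^sup>2) - (expectation (\<lambda>u. \<bar>f u\<bar>))\<^sup>2"
    using assms by (subst variance_eq) auto
  finally show ?thesis by (intro real_le_rsqrt) simp
qed

section \<open>Occupation times and the two-time law of a walk\<close>

definition occupation :: "(real \<Rightarrow> 'b \<Rightarrow> int) \<Rightarrow> real \<Rightarrow> int set \<Rightarrow> 'b \<Rightarrow> real" where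
  "occupation Y \<tau> S u = (\<integral>s. indicat_real S (Y s u) \<partial>time_measure \<tau>)"

lemma occupation_nonneg: "0 \<le> occupation Y \<tau> S u"
  unfolding occupation_def by (rule integral_nonneg_AE) auto

lemma occupation_le: "0 \<le> \<tau> \<Longrightarrow> occupation Y \<tau> S u \<le> \<tau>"
proof -
  assume "0 \<le> \<tau>"
  interpret finite_measure "time_measure \<tau>" by (rule finite_time_measure)
  have "occupation Y \<tau> S u \<le> (\<integral>s. 1 \<partial>time_measure \<tau>)"
    unfolding occupation_def by (rule integral_mono_AE') auto
  then show ?thesis using measure_time_measure[OF \<open>0 \<le> \<tau>\<close>] by simp
qed

lemma occupation_measurable:
  assumes [measurable]: "(\<lambda>(u, s). Y s u) \<in> measurable (M \<Otimes>\<^sub>M time_measure \<tau>) (count_space UNIV)"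
  shows "occupation Y \<tau> S \<in> borel_measurable M"
proof -
  interpret finite_measure "time_measure \<tau>" by (rule finite_time_measure)
  have "(\<lambda>(u, s). indicat_real S (Y s u)) \<in> borel_measurable (M \<Otimes>\<^sub>M time_measure \<tau>)"
    using measurable_compose[OF assms, of "indicat_real S" borel] by (simp add: case_prod_unfold)
  from borel_measurable_lebesgue_integral[OF this] show ?thesis
    by (simp add: occupation_def[abs_def])
qed

lemma occupation_integrable:
  assumes "prob_space M" "0 \<le> \<tau>"
    "(\<lambda>(u, s). Y s u) \<in> measurable (M \<Otimes>\<^sub>M time_measure \<tau>) (count_space UNIV)"
  shows "integrable M (occupation Y \<tau> S)"
proof -
  interpret prob_space M by fact
  show ?thesis
    by (rule integrable_const_bound[where B=\<tau>])
      (use assms occupation_nonneg[of Y \<tau> S] occupation_le[of \<tau> Y S] in \<open>auto intro: occupation_measurable\<close>)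
qed

lemma path_measurable:
  assumes "(\<lambda>(u, s). Y s u) \<in> measurable (M \<Otimes>\<^sub>M N) L" "u \<in> space M"
  shows "(\<lambda>s. Y s u) \<in> measurable N L"
  using measurable_compose[OF measurable_Pair1'[OF assms(2)] assms(1)] by simp

lemma integrable_indicator_path:
  assumes "f \<in> measurable (time_measure \<tau>) (count_space UNIV)"
  shows "integrable (time_measure \<tau>) (\<lambda>s. indicat_real S (f s))"
proof -
  interpret finite_measure "time_measure \<tau>" by (rule finite_time_measure)
  show ?thesis
    by (rule integrable_const_bound[where B=1])
      (use measurable_compose[OF assms, of "indicat_real S" borel] in auto)
qed

lemma occupation_eq_sum:
  assumes "(\<lambda>s. Y s u) \<in> measurable (time_measure \<tau>) (count_space UNIV)" "finite S"
  shows "occupation Y \<tau> S u = (\<Sum>y\<in>S. occupation Y \<tau> {y} u)"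
proof -
  have "indicat_real S z = (\<Sum>y\<in>S. indicat_real {y} z)" for z
    using assms(2) by (simp add: indicator_def if_distrib[of "(*) _"] cong: if_cong)
  then show ?thesis unfolding occupation_def
    by (simp only: Bochner_Integration.integral_sum[OF integrable_indicator_path[OF assms(1)]])
qed

lemma markov_walk_pair_measurable:
  assumes "markov_walk M r x0 Y"
  shows "(\<lambda>(u, s). Y s u) \<in> measurable (M \<Otimes>\<^sub>M time_measure \<tau>) (count_space UNIV)"
  by (rule measurable_pair_integer_process)
    (use assms in \<open>auto simp: markov_walk_def cadlag_def\<close>)

text \<open>Second moments of time integrals involve the law at no more than two times: the cases
  \<open>m = 0\<close> and \<open>m = 1\<close> of the finite-dimensional laws.\<close>

lemma markov_walk_law:
  assumes "markov_walk M r x0 Y"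
  obtains p where "transition_function r p"
    "\<And>s y. 0 \<le> s \<Longrightarrow> measure M {u \<in> space M. Y s u = y} = p s x0 y"
    "\<And>s s' y y'. 0 \<le> s \<Longrightarrow> s \<le> s' \<Longrightarrow>
      measure M {u \<in> space M. Y s u = y \<and> Y s' u = y'} = p s x0 y * p (s' - s) y y'"
proof -
  obtain p where tf: "transition_function r p" and fdd: "\<And>(m::nat) t y. 0 \<le> t 0 \<Longrightarrow>
      (\<And>i. i < m \<Longrightarrow> t i \<le> t (Suc i)) \<Longrightarrow>
      measure M {u \<in> space M. \<forall>i\<le>m. Y (t i) u = y i} =
          p (t 0) x0 (y 0) * (\<Prod>i<m. p (t (Suc i) - t i) (y i) (y (Suc i)))"
    using assms unfolding markov_walk_def by blast
  have 1: "measure M {u \<in> space M. Y s u = y} = p s x0 y" if "0 \<le> s" for s y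
    using fdd[of "\<lambda>_. s" 0 "\<lambda>_. y"] that by simp
  have 2: "measure M {u \<in> space M. Y s u = y \<and> Y s' u = y'} = p s x0 y * p (s' - s) y y'"
    if "0 \<le> s" "s \<le> s'" for s s' y y'
  proof -
    have all: "(\<forall>i\<le>Suc 0. P i) \<longleftrightarrow> P 0 \<and> P (Suc 0)" for P by (auto simp: le_Suc_eq)
    show ?thesis
      using fdd[of "\<lambda>i. if i = 0 then s else s'" "Suc 0" "\<lambda>i. if i = 0 then y else y'"] that
      by (simp add: all)
  qed
  show ?thesis by (rule that[OF tf 1 2])
qed

section \<open>Occupation times of blocks\<close>

context reversible_rates
begin

text \<open>The outcome of the bootstrap below for a block of \<open>N\<close> sites with
  \<open>sqrt n \<le> N \<le> 2 * sqrt n\<close>: the first term comes from the block average, the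
  second is \<open>4 * K\<^sup>2 * 2\<close>.\<close>

definition occupation_bound :: "real \<Rightarrow> real" where
  "occupation_bound T = 3 * T * K + 8 * K\<^sup>2"

context
  fixes M :: "'b measure" and Y :: "real \<Rightarrow> 'b \<Rightarrow> int" and x0 :: int
  assumes prob: "prob_space M" and walk: "markov_walk M r x0 Y"
begin

interpretation prob_space M by (rule prob)

lemmas Y_pair = markov_walk_pair_measurable[OF walk]
lemmas occ_int = occupation_integrable[OF prob _ Y_pair]

definition mean_occ :: "real \<Rightarrow> int set \<Rightarrow> real" where
  "mean_occ \<tau> S = expectation (occupation Y \<tau> S)"

lemma mean_occ_nonneg: "0 \<le> mean_occ \<tau> S"
  unfolding mean_occ_def by (rule integral_nonneg_AE) (auto simp: occupation_nonneg)

lemma mean_occ_le: "0 \<le> \<tau> \<Longrightarrow> mean_occ \<tau> S \<le> \<tau>"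
  using integral_le_const[OF occ_int] unfolding mean_occ_def by (auto simp: occupation_le)

lemma mean_occ_sum: "0 \<le> \<tau> \<Longrightarrow> finite S \<Longrightarrow> mean_occ \<tau> S = (\<Sum>y\<in>S. mean_occ \<tau> {y})"
proof -
  assume \<tau>: "0 \<le> \<tau>" and fin: "finite S"
  have "mean_occ \<tau> S = expectation (\<lambda>u. \<Sum>y\<in>S. occupation Y \<tau> {y} u)"
    unfolding mean_occ_def
    by (intro Bochner_Integration.integral_cong refl occupation_eq_sum fin path_measurable[OF Y_pair])
  then show ?thesis
    by (simp add: mean_occ_def Bochner_Integration.integral_sum[OF occ_int[OF \<tau>]])
qed

definition block_diff :: "real \<Rightarrow> int \<Rightarrow> int \<Rightarrow> int \<Rightarrow> 'b \<Rightarrow> real" where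
  "block_diff \<tau> x a b u = occupation Y \<tau> {x} u / w x - occupation Y \<tau> {a..b} u / weight a b"

lemma block_diff_integrable:
  assumes "0 \<le> \<tau>"
  shows "integrable M (block_diff \<tau> x a b)" "integrable M (\<lambda>u. (block_diff \<tau> x a b u)\<^sup>2)"
proof -
  show 1: "integrable M (block_diff \<tau> x a b)"
    unfolding block_diff_def[abs_def] using occ_int[OF assms] by auto
  have "\<bar>block_diff \<tau> x a b u\<bar> \<le> \<tau> / \<bar>w x\<bar> + \<tau> / \<bar>weight a b\<bar>" for u
    unfolding block_diff_def
    by (rule order_trans[OF abs_triangle_ineq4])
      (auto simp: abs_divide occupation_nonneg intro!: add_mono divide_right_mono occupation_le[OF assms])
  then have "(block_diff \<tau> x a b u)\<^sup>2 \<le> (\<tau> / \<bar>w x\<bar> + \<tau> / \<bar>weight a b\<bar>)\<^sup>2" for u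
    using power_mono[of "\<bar>block_diff \<tau> x a b u\<bar>" _ 2] by simp
  then show "integrable M (\<lambda>u. (block_diff \<tau> x a b u)\<^sup>2)"
    by (intro integrable_const_bound[where B="(\<tau> / \<bar>w x\<bar> + \<tau> / \<bar>weight a b\<bar>)\<^sup>2"])
      (use borel_measurable_integrable[OF 1] in auto)
qed

text \<open>\<open>block_diff\<close> is the time integral of \<open>block_test\<close> along the
  path, so the general second moment bound applies with \<open>B\<close> taken from
  \<open>block_test_green\<close>. Estimating the absolute value of \<open>block_test\<close> by the
  sum of its two parts turns the remaining factor into mean occupations.\<close>

lemma block_variance:
  assumes \<tau>: "0 \<le> \<tau>" and x: "x \<in> {a..b}"
  shows "expectation (\<lambda>u. (block_diff \<tau> x a b u)\<^sup>2) \<le>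
    4 * K\<^sup>2 * real_of_int (b - a + 1) * (mean_occ \<tau> {x} / w x + mean_occ \<tau> {a..b} / weight a b)"
proof -
  let ?I = "time_measure \<tau>"
  obtain p where tf: "transition_function r p"
    and one: "\<And>s y. 0 \<le> s \<Longrightarrow> measure M {u \<in> space M. Y s u = y} = p s x0 y"
    and two: "\<And>s s' y y'. 0 \<le> s \<Longrightarrow> s \<le> s' \<Longrightarrow>
      measure M {u \<in> space M. Y s u = y \<and> Y s' u = y'} = p s x0 y * p (s' - s) y y'"
    by (rule markov_walk_law[OF walk]) (rule that)
  have ab: "a \<le> b" using x by auto
  have Ym: "Y s \<in> measurable M (count_space UNIV)" if "0 \<le> s" for s
    using walk that by (simp add: markov_walk_def)
  have int: "integrable ?I (\<lambda>s. indicat_real S (Y s u))" if "u \<in> space M" for u S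
    by (rule integrable_indicator_path[OF path_measurable[OF Y_pair that]])
  have eq: "(\<integral>s. block_test x a b (Y s u) \<partial>?I) = block_diff \<tau> x a b u" if u: "u \<in> space M" for u
    unfolding block_test_def block_diff_def occupation_def
    by (subst Bochner_Integration.integral_diff) (use int[OF u] in auto)
  have le: "(\<integral>s. \<bar>block_test x a b (Y s u)\<bar> \<partial>?I)
      \<le> occupation Y \<tau> {x} u / w x + occupation Y \<tau> {a..b} u / weight a b" if u: "u \<in> space M" for u
  proof -
    have "(\<integral>s. \<bar>block_test x a b (Y s u)\<bar> \<partial>?I) \<le>
      (\<integral>s. indicat_real {x} (Y s u) / w x + indicat_real {a..b} (Y s u) / weight a b \<partial>?I)"
      unfolding block_test_def
      by (intro integral_mono integrable_abs Bochner_Integration.integrable_diff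
          Bochner_Integration.integrable_add integrable_divide int[OF u])
        (auto intro!: order_trans[OF abs_triangle_ineq4] simp: less_imp_le[OF w_pos] less_imp_le[OF weight_pos[OF ab]])
    also have "\<dots> = occupation Y \<tau> {x} u / w x + occupation Y \<tau> {a..b} u / weight a b"
      unfolding occupation_def
      by (subst Bochner_Integration.integral_add) (use int[OF u] in auto)
    finally show ?thesis .
  qed
  have "expectation (\<lambda>u. (block_diff \<tau> x a b u)\<^sup>2) = expectation (\<lambda>u. (\<integral>s. block_test x a b (Y s u) \<partial>?I)\<^sup>2)"
    by (intro Bochner_Integration.integral_cong refl) (simp add: eq)
  also have "\<dots> \<le> 2 * (2 * (K\<^sup>2 * real_of_int (b - a + 1))) * expectation (\<lambda>u. (\<integral>s. \<bar>block_test x a b (Y s u)\<bar> \<partial>?I))"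
    by (rule second_moment_bound[where S="{a..b}", OF prob \<tau> Y_pair Ym _ _ one two transition_continuous[OF tf]
          block_test_green[OF tf x]])
      (use x in \<open>auto simp: block_test_def\<close>)
  also have "\<dots> \<le> 2 * (2 * (K\<^sup>2 * real_of_int (b - a + 1))) *
      expectation (\<lambda>u. occupation Y \<tau> {x} u / w x + occupation Y \<tau> {a..b} u / weight a b)"
    by (intro mult_left_mono integral_mono_AE')
      (use ab le occ_int[OF \<tau>] in \<open>auto intro!: add_nonneg_nonneg divide_nonneg_nonneg
        simp: occupation_nonneg less_imp_le[OF w_pos] less_imp_le[OF weight_pos[OF ab]]\<close>)
  also have "expectation (\<lambda>u. occupation Y \<tau> {x} u / w x + occupation Y \<tau> {a..b} u / weight a b)
    = mean_occ \<tau> {x} / w x + mean_occ \<tau> {a..b} / weight a b"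
    unfolding mean_occ_def by (subst Bochner_Integration.integral_add) (use occ_int[OF \<tau>] in auto)
  finally show ?thesis by (simp add: mult.assoc)
qed

lemma expectation_block_diff:
  assumes "0 \<le> \<tau>"
  shows "expectation (block_diff \<tau> x a b) = mean_occ \<tau> {x} / w x - mean_occ \<tau> {a..b} / weight a b"
  unfolding block_diff_def[abs_def] mean_occ_def
  by (subst Bochner_Integration.integral_diff) (use occ_int[OF assms] in auto)

text \<open>The variance of the difference is controlled by the mean occupation itself,
  which is therefore bounded by the mean occupation of a block and the length of that block.\<close>

lemma mean_occ_bootstrap:
  assumes \<tau>: "0 \<le> \<tau>" and N: "1 \<le> N"
  shows "mean_occ \<tau> {x} / w x \<le> 3 * (\<tau> * K / real_of_int N) + 4 * K\<^sup>2 * real_of_int N"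
proof -
  define b where "b = x + N - 1"
  define U where "U = mean_occ \<tau> {x} / w x"
  define V where "V = mean_occ \<tau> {x..b} / weight x b"
  have xb: "x \<in> {x..b}" "x \<le> b" "b - x + 1 = N" using N by (auto simp: b_def)
  have U0: "0 \<le> U" unfolding U_def by (intro divide_nonneg_pos mean_occ_nonneg w_pos)
  have V0: "0 \<le> V" unfolding V_def by (intro divide_nonneg_pos mean_occ_nonneg weight_pos xb)
  have "real_of_int N / K \<le> weight x b" using weight_ge[OF xb(2)] xb(3) by simp
  \<comment> \<open>The block average is bounded trivially: no set is occupied for longer than
    \<open>\<tau>\<close>.\<close>
  then have "V \<le> \<tau> / (real_of_int N / K)"
    unfolding V_def using mean_occ_le[OF \<tau>, of "{x..b}"] N K_pos \<tau>
    by (intro frac_le) auto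
  then have V: "V \<le> \<tau> * K / real_of_int N" by simp
  have "U - V \<le> expectation (\<lambda>u. \<bar>block_diff \<tau> x x b u\<bar>)"
    unfolding U_def V_def expectation_block_diff[OF \<tau>, symmetric]
    by (intro integral_mono block_diff_integrable[OF \<tau>] integrable_abs) auto
  also have "\<dots> \<le> sqrt (expectation (\<lambda>u. (block_diff \<tau> x x b u)\<^sup>2))"
    by (rule expectation_abs_le_sqrt[OF block_diff_integrable[OF \<tau>]])
  also have "\<dots> \<le> sqrt (4 * K\<^sup>2 * real_of_int N * (U + V))"
    using block_variance[OF \<tau> xb(1)] unfolding xb(3) U_def[symmetric] V_def[symmetric] by simp
  \<comment> \<open>The arithmetic-geometric mean inequality leaves only half of \<open>U\<close> on
    the right, where it can be absorbed; doubling the rest produces the factors 3 and 4.\<close>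
  also have "\<dots> \<le> (4 * K\<^sup>2 * real_of_int N + (U + V)) / 2"
    by (rule arith_geo_mean_sqrt) (use N U0 V0 in auto)
  finally have "U \<le> 3 * V + 4 * K\<^sup>2 * real_of_int N" by (simp add: field_simps)
  then show ?thesis using V by (simp add: U_def)
qed

context
  fixes n :: nat and T \<tau> :: real
  assumes n: "1 \<le> n" and \<tau>: "0 \<le> \<tau>" "\<tau> \<le> real n * T"
begin

lemma mean_occ_point_le: "mean_occ \<tau> {x} \<le> occupation_bound T * sqrt (real n) * w x"
proof -
  \<comment> \<open>With \<open>\<tau>\<close> of order \<open>n\<close>, a block of about
    \<open>sqrt n\<close> sites makes the two terms of the bootstrap, \<open>\<tau> / N\<close> and
    \<open>N\<close>, of the same order.\<close>
  define N where "N = \<lceil>sqrt (real n)\<rceil>"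
  define q where "q = sqrt (real n)"
  have q1: "1 \<le> q" using n by (simp add: q_def)
  have qq: "q * q = real n" by (simp add: q_def)
  have N1: "1 \<le> N" using q1 by (simp add: N_def q_def)
  have N_ge: "q \<le> real_of_int N" by (simp add: N_def q_def)
  have N_le: "real_of_int N \<le> 2 * q" using q1 unfolding N_def q_def by linarith
  have "\<tau> * K / real_of_int N \<le> q * q * T * K / q"
    using \<tau> K_pos N_ge q1 qq by (intro frac_le mult_right_mono) auto
  then have 1: "\<tau> * K / real_of_int N \<le> T * K * q" using q1 by (simp add: mult_ac)
  have 2: "4 * K\<^sup>2 * real_of_int N \<le> 4 * K\<^sup>2 * (2 * q)"
    using N_le by (intro mult_left_mono) auto
  have "mean_occ \<tau> {x} / w x \<le> 3 * (T * K * q) + 4 * K\<^sup>2 * (2 * q)"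
    using mean_occ_bootstrap[OF \<tau>(1) N1, of x] 1 2 by linarith
  also have "\<dots> = occupation_bound T * q" by (simp add: occupation_bound_def algebra_simps)
  finally show ?thesis using w_pos[of x] by (simp add: pos_divide_le_eq q_def)
qed

lemma mean_occ_block_le: "mean_occ \<tau> {a..b} \<le> occupation_bound T * sqrt (real n) * weight a b"
  unfolding weight_def sum_distrib_left mean_occ_sum[OF \<tau>(1) finite_atLeastAtMost_int]
  by (rule sum_mono[OF mean_occ_point_le])

lemma block_diff_L1:
  assumes x: "x \<in> {a..b}"
  shows "expectation (\<lambda>u. \<bar>block_diff \<tau> x a b u\<bar>) \<le>
    sqrt (8 * K\<^sup>2 * occupation_bound T * real_of_int (b - a + 1) * sqrt (real n))"
proof -
  have ab: "a \<le> b" using x by auto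
  have 1: "mean_occ \<tau> {x} / w x \<le> occupation_bound T * sqrt (real n)"
    using mean_occ_point_le w_pos by (simp add: pos_divide_le_eq)
  have 2: "mean_occ \<tau> {a..b} / weight a b \<le> occupation_bound T * sqrt (real n)"
    using mean_occ_block_le weight_pos[OF ab] by (simp add: pos_divide_le_eq)
  have "expectation (\<lambda>u. \<bar>block_diff \<tau> x a b u\<bar>) \<le> sqrt (expectation (\<lambda>u. (block_diff \<tau> x a b u)\<^sup>2))"
    by (rule expectation_abs_le_sqrt[OF block_diff_integrable[OF \<tau>(1)]])
  also have "\<dots> \<le> sqrt (4 * K\<^sup>2 * real_of_int (b - a + 1) *
      (occupation_bound T * sqrt (real n) + occupation_bound T * sqrt (real n)))"
    by (rule real_sqrt_le_mono[OF order_trans[OF block_variance[OF \<tau>(1) x] mult_left_mono[OF add_mono[OF 1 2]]]])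
      (use ab in simp)
  finally show ?thesis by (simp add: algebra_simps)
qed

text \<open>Two errors add up: the fluctuation measured by \<open>block_diff\<close>, and the
  passage from the random normalization \<open>weight a b\<close> to the nominal window width
  \<open>2 * \<epsilon> * sqrt n\<close>. The second is paid for with the mean occupation of the
  block.\<close>

lemma occupation_smoothing:
  assumes x: "x \<in> {a..b}" and \<epsilon>: "0 < \<epsilon>"
  shows "expectation (\<lambda>u. \<bar>occupation Y \<tau> {x} u / (sqrt (real n) * w x) -
      occupation Y \<tau> {a..b} u / (2 * \<epsilon> * real n)\<bar>) \<le>
    sqrt (8 * K\<^sup>2 * occupation_bound T * (real_of_int (b - a + 1) / sqrt (real n))) +
    occupation_bound T * \<bar>1 - weight a b / (2 * \<epsilon> * sqrt (real n))\<bar>"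
proof -
  define q where "q = sqrt (real n)"
  have q: "0 < q" "q * q = real n" using n by (auto simp: q_def)
  have ab: "a \<le> b" using x by auto
  define W where "W = weight a b"
  have W: "0 < W" using weight_pos[OF ab] by (simp add: W_def)
  define c where "c = \<bar>1 - W / (2 * \<epsilon> * q)\<bar> / (q * W)"
  have c0: "0 \<le> c" using q W by (simp add: c_def)
  have pw: "\<bar>occupation Y \<tau> {x} u / (q * w x) - occupation Y \<tau> {a..b} u / (2 * \<epsilon> * real n)\<bar>
      \<le> \<bar>block_diff \<tau> x a b u\<bar> / q + c * occupation Y \<tau> {a..b} u" for u
  proof -
    have "occupation Y \<tau> {x} u / (q * w x) - occupation Y \<tau> {a..b} u / (2 * \<epsilon> * real n)
      = block_diff \<tau> x a b u / q + (1 - W / (2 * \<epsilon> * q)) / (q * W) * occupation Y \<tau> {a..b} u"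
      using q W \<epsilon> w_pos[of x] unfolding block_diff_def W_def[symmetric] q(2)[symmetric]
      by (simp add: field_simps)
    also have "\<bar>\<dots>\<bar> \<le> \<bar>block_diff \<tau> x a b u\<bar> / q + c * occupation Y \<tau> {a..b} u"
      using q W occupation_nonneg[of Y \<tau> "{a..b}" u]
      by (intro order_trans[OF abs_triangle_ineq]) (simp add: abs_mult c_def)
    finally show ?thesis .
  qed
  have "expectation (\<lambda>u. \<bar>occupation Y \<tau> {x} u / (q * w x) - occupation Y \<tau> {a..b} u / (2 * \<epsilon> * real n)\<bar>)
    \<le> expectation (\<lambda>u. \<bar>block_diff \<tau> x a b u\<bar> / q + c * occupation Y \<tau> {a..b} u)"
    by (intro integral_mono pw integrable_abs Bochner_Integration.integrable_diff integrable_divide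
        Bochner_Integration.integrable_add integrable_mult_right occ_int[OF \<tau>(1)] block_diff_integrable[OF \<tau>(1)])
  also have "\<dots> = expectation (\<lambda>u. \<bar>block_diff \<tau> x a b u\<bar>) / q + c * mean_occ \<tau> {a..b}"
    unfolding mean_occ_def
    by (subst Bochner_Integration.integral_add)
      (use occ_int[OF \<tau>(1)] block_diff_integrable[OF \<tau>(1)] in auto)
  also have "\<dots> \<le> sqrt (8 * K\<^sup>2 * occupation_bound T * real_of_int (b - a + 1) * q) / q
      + c * (occupation_bound T * q * W)"
    using q c0 block_diff_L1[OF x] mean_occ_block_le[of a b]
    by (intro add_mono divide_right_mono mult_left_mono) (auto simp: q_def W_def)
  also have "c * (occupation_bound T * q * W) = occupation_bound T * \<bar>1 - W / (2 * \<epsilon> * q)\<bar>"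
    using q W by (simp add: c_def)
  also have "sqrt (8 * K\<^sup>2 * occupation_bound T * real_of_int (b - a + 1) * q) / q =
      sqrt (8 * K\<^sup>2 * occupation_bound T * (real_of_int (b - a + 1) / q))"
  proof -
    have "sqrt (8 * K\<^sup>2 * occupation_bound T * real_of_int (b - a + 1) * q) / q =
      sqrt (8 * K\<^sup>2 * occupation_bound T * real_of_int (b - a + 1) * q / q\<^sup>2)"
      using q by (simp add: real_sqrt_divide)
    also have "8 * K\<^sup>2 * occupation_bound T * real_of_int (b - a + 1) * q / q\<^sup>2 =
        8 * K\<^sup>2 * occupation_bound T * (real_of_int (b - a + 1) / q)"
      using q(1) by (simp add: power2_eq_square)
    finally show ?thesis .
  qed
  finally show ?thesis by (simp add: q_def W_def)
qed

end
end
end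

section \<open>The ergodic theorem for the environment\<close>

context random_environment
begin

lemma shift_space: "\<omega> \<in> space \<mu> \<Longrightarrow> shift x \<omega> \<in> space \<mu>"
  using measurable_space[OF shift_measurable] .

lemma shift_inverse: "\<omega> \<in> space \<mu> \<Longrightarrow> shift (- x) (shift x \<omega>) = \<omega>"
  by (simp add: shift_add shift_zero)

text \<open>Invariance is assumed for images. The shifts being invertible, a preimage under
  \<open>shift x\<close> is an image under \<open>shift (- x)\<close>.\<close>

lemma distr_shift: "distr \<mu> \<mu> (shift x) = \<mu>"
proof (rule measure_eqI)
  fix A assume "A \<in> sets (distr \<mu> \<mu> (shift x))"
  then have A: "A \<in> sets \<mu>" by simp
  have "shift x -` A \<inter> space \<mu> = shift (- x) ` A"
  proof (intro set_eqI iffI)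
    fix \<omega> assume "\<omega> \<in> shift x -` A \<inter> space \<mu>"
    then show "\<omega> \<in> shift (- x) ` A" using shift_inverse[of \<omega> x] by (auto intro!: image_eqI)
  next
    fix \<omega> assume "\<omega> \<in> shift (- x) ` A"
    then show "\<omega> \<in> shift x -` A \<inter> space \<mu>"
      using sets.sets_into_space[OF A] shift_inverse[of _ "- x"] shift_space by auto
  qed
  then show "emeasure (distr \<mu> \<mu> (shift x)) A = emeasure \<mu> A"
    using shift_preserving[OF A, of "- x"] by (simp add: emeasure_distr[OF shift_measurable A])
qed simp

lemma AE_shift: "(AE \<omega> in \<mu>. P \<omega>) \<Longrightarrow> (AE \<omega> in \<mu>. P (shift x \<omega>))"
proof -
  assume "AE \<omega> in \<mu>. P \<omega>"
  then have "AE \<omega> in distr \<mu> \<mu> (shift x). P \<omega>" unfolding distr_shift .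
  then show "AE \<omega> in \<mu>. P (shift x \<omega>)" by (rule AE_distrD[OF shift_measurable])
qed

lemma AE_all_shifts: "(AE \<omega> in \<mu>. P \<omega>) \<Longrightarrow> (AE \<omega> in \<mu>. \<forall>x. P (shift x \<omega>))"
  by (simp add: AE_all_countable AE_shift)

lemma integral_shift_invariant:
  fixes f :: "'w \<Rightarrow> real"
  assumes "f \<in> borel_measurable \<mu>"
  shows "(\<integral>\<omega>. f (shift x \<omega>) \<partial>\<mu>) = (\<integral>\<omega>. f \<omega> \<partial>\<mu>)"
  using integral_distr[OF shift_measurable assms, of x] by (simp add: distr_shift)

text \<open>The direction \<open>z\<close>, later 1 or -1, lets one statement serve both half
  lines.\<close>

definition birkhoff_sum :: "('w \<Rightarrow> real) \<Rightarrow> int \<Rightarrow> nat \<Rightarrow> 'w \<Rightarrow> real" where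
  "birkhoff_sum f z n \<omega> = (\<Sum>k<n. f (shift (z * int k) \<omega>))"

lemma birkhoff_sum_measurable [measurable]:
  assumes "f \<in> borel_measurable \<mu>"
  shows "birkhoff_sum f z n \<in> borel_measurable \<mu>"
  unfolding birkhoff_sum_def[abs_def]
  by (intro borel_measurable_sum measurable_compose[OF shift_measurable assms])

lemma birkhoff_sum_Suc:
  assumes "\<omega> \<in> space \<mu>"
  shows "birkhoff_sum f z (Suc n) \<omega> = f \<omega> + birkhoff_sum f z n (shift z \<omega>)"
  using assms
  by (simp add: birkhoff_sum_def sum.lessThan_Suc_shift shift_zero shift_add algebra_simps
      del: sum.lessThan_Suc)

text \<open>Garsia's argument. Where the running maximum \<open>m N\<close> is positive it exceeds
  its own shift by at most \<open>f\<close>; integrating removes the difference of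
  \<open>m N\<close> and its shift, and by \<open>pos\<close> the set where \<open>m N\<close> is
  positive exhausts the space as \<open>N\<close> grows.\<close>

lemma maximal_ergodic:
  fixes f :: "'w \<Rightarrow> real"
  assumes f [measurable]: "f \<in> borel_measurable \<mu>" and C: "\<And>\<omega>. \<omega> \<in> space \<mu> \<Longrightarrow> \<bar>f \<omega>\<bar> \<le> C"
    and pos: "AE \<omega> in \<mu>. \<exists>n. 0 < birkhoff_sum f z n \<omega>"
  shows "0 \<le> (\<integral>\<omega>. f \<omega> \<partial>\<mu>)"
proof -
  let ?S = "birkhoff_sum f z"
  define m where "m N \<omega> = Max ((\<lambda>k. ?S k \<omega>) ` {..N})" for N \<omega>
  have m_ge: "?S k \<omega> \<le> m N \<omega>" if "k \<le> N" for k N \<omega>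
    unfolding m_def by (rule Max_ge) (use that in auto)
  have m0: "0 \<le> m N \<omega>" for N \<omega>
    using m_ge[of 0 N \<omega>] by (simp add: birkhoff_sum_def)
  have m_ex: "\<exists>k\<le>N. m N \<omega> = ?S k \<omega>" for N \<omega>
  proof -
    have "m N \<omega> \<in> (\<lambda>k. ?S k \<omega>) ` {..N}" unfolding m_def by (rule Max_in) auto
    then show ?thesis by auto
  qed
  have m_meas [measurable]: "m N \<in> borel_measurable \<mu>" for N
    unfolding m_def[abs_def] by (rule borel_measurable_Max) auto
  have S_bound: "\<bar>?S k \<omega>\<bar> \<le> real k * C" if "\<omega> \<in> space \<mu>" for k \<omega>
    unfolding birkhoff_sum_def
    using sum_bounded_above[of "{..<k}" "\<lambda>k. \<bar>f (shift (z * int k) \<omega>)\<bar>" C] C[OF shift_space[OF that]]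
    by (intro order_trans[OF sum_abs]) auto
  have m_int: "integrable \<mu> (m N)" for N
  proof (rule integrable_const_bound[where B="real N * \<bar>C\<bar>"])
    show "AE \<omega> in \<mu>. norm (m N \<omega>) \<le> real N * \<bar>C\<bar>"
    proof (rule AE_I2)
      fix \<omega> assume \<omega>: "\<omega> \<in> space \<mu>"
      obtain k where k: "k \<le> N" "m N \<omega> = ?S k \<omega>" using m_ex by blast
      have "real k * C \<le> real k * \<bar>C\<bar>" by (intro mult_left_mono) auto
      also have "\<dots> \<le> real N * \<bar>C\<bar>" using k by (intro mult_right_mono) auto
      finally have "real k * C \<le> real N * \<bar>C\<bar>" .
      then show "norm (m N \<omega>) \<le> real N * \<bar>C\<bar>" using S_bound[OF \<omega>, of k] k by simp
    qed
  qed simp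
  have f_int: "integrable \<mu> f"
    by (rule integrable_const_bound[where B=C]) (use C in auto)
  have ind_int: "integrable \<mu> (\<lambda>\<omega>. indicat_real {\<omega>. 0 < m N \<omega>} \<omega> * f \<omega>)" for N
    by (rule Bochner_Integration.integrable_bound[OF f_int]) (auto simp: indicator_def)
  have m_shift_int: "integrable \<mu> (\<lambda>\<omega>. m N (shift z \<omega>))" for N
    using m_int[of N] integrable_distr[OF shift_measurable[of z], of "m N"] by (simp add: distr_shift)
  have step: "m N \<omega> - m N (shift z \<omega>) \<le> indicat_real {\<omega>. 0 < m N \<omega>} \<omega> * f \<omega>"
    if \<omega>: "\<omega> \<in> space \<mu>" for N \<omega>
  proof (cases "0 < m N \<omega>")
    case True
    obtain k where k: "k \<le> N" "m N \<omega> = ?S k \<omega>" using m_ex by blast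
    \<comment> \<open>The maximum includes the empty sum, so a positive value is attained at some
      \<open>Suc k'\<close>, from which the first summand \<open>f \<omega>\<close> splits
      off.\<close>
    then obtain k' where k': "k = Suc k'" using True by (cases k) (auto simp: birkhoff_sum_def)
    have "?S k' (shift z \<omega>) \<le> m N (shift z \<omega>)" using k k' by (intro m_ge) simp
    then show ?thesis using True k k' birkhoff_sum_Suc[OF \<omega>] by simp
  next
    case False
    then show ?thesis using m0[of N \<omega>] m0[of N "shift z \<omega>"] by simp
  qed
  have nonneg: "0 \<le> (\<integral>\<omega>. indicat_real {\<omega>. 0 < m N \<omega>} \<omega> * f \<omega> \<partial>\<mu>)" for N
  proof -
    have "0 = (\<integral>\<omega>. m N \<omega> - m N (shift z \<omega>) \<partial>\<mu>)"
      using m_int m_shift_int integral_shift_invariant[OF m_meas] by simp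
    also have "\<dots> \<le> (\<integral>\<omega>. indicat_real {\<omega>. 0 < m N \<omega>} \<omega> * f \<omega> \<partial>\<mu>)"
      by (intro integral_mono step ind_int Bochner_Integration.integrable_diff m_int m_shift_int)
    finally show ?thesis .
  qed
  have "(\<lambda>N. \<integral>\<omega>. indicat_real {\<omega>. 0 < m N \<omega>} \<omega> * f \<omega> \<partial>\<mu>) \<longlonglongrightarrow> (\<integral>\<omega>. f \<omega> \<partial>\<mu>)"
  proof (rule integral_dominated_convergence[where w="\<lambda>_. C"])
    show "AE \<omega> in \<mu>. (\<lambda>N. indicat_real {\<omega>. 0 < m N \<omega>} \<omega> * f \<omega>) \<longlonglongrightarrow> f \<omega>"
      using pos
    proof eventually_elim
      case (elim \<omega>)
      then obtain n where "0 < ?S n \<omega>" by blast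
      then have "0 < m N \<omega>" if "n \<le> N" for N using m_ge[OF that, of \<omega>] by simp
      then have "\<forall>\<^sub>F N in sequentially. indicat_real {\<omega>. 0 < m N \<omega>} \<omega> * f \<omega> = f \<omega>"
        by (auto simp: eventually_sequentially intro!: exI[of _ n])
      then show ?case by (rule tendsto_eventually)
    qed
    show "AE \<omega> in \<mu>. norm (indicat_real {\<omega>. 0 < m N \<omega>} \<omega> * f \<omega>) \<le> C" for N
      using C by (intro AE_I2) (auto simp: indicator_def intro: order_trans[OF abs_ge_zero])
  qed auto
  then show ?thesis by (rule LIMSEQ_le_const) (use nonneg in auto)
qed

text \<open>If the sums of \<open>f - \<alpha>\<close> were unbounded above with positive probability, then almost surely
  by ergodicity, and the maximal inequality would give \<open>\<alpha> \<le> \<integral>f d\<mu>\<close>.\<close>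

lemma birkhoff_sum_upper:
  fixes f :: "'w \<Rightarrow> real"
  assumes f [measurable]: "f \<in> borel_measurable \<mu>" and C: "\<And>\<omega>. \<omega> \<in> space \<mu> \<Longrightarrow> \<bar>f \<omega>\<bar> \<le> C"
    and \<alpha>: "(\<integral>\<omega>. f \<omega> \<partial>\<mu>) < \<alpha>" and z: "z \<in> {-1, 1}"
  shows "AE \<omega> in \<mu>. \<exists>c. \<forall>n. birkhoff_sum f z n \<omega> \<le> \<alpha> * real n + c"
proof -
  define g where "g \<omega> = f \<omega> - \<alpha>" for \<omega>
  let ?S = "birkhoff_sum g z"
  define C' where "C' = C + \<bar>\<alpha>\<bar>"
  have g [measurable]: "g \<in> borel_measurable \<mu>" unfolding g_def[abs_def] by measurable
  have gC: "\<bar>g \<omega>\<bar> \<le> C'" if "\<omega> \<in> space \<mu>" for \<omega>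
    using C[OF that] unfolding g_def C'_def by linarith
  have S_eq: "?S n \<omega> = birkhoff_sum f z n \<omega> - \<alpha> * real n" for n \<omega>
    by (simp add: birkhoff_sum_def g_def sum_subtractf mult.commute)
  \<comment> \<open>Ergodicity is available for sets that are exactly invariant. Unboundedness above
    survives any bounded change of the sums, so this event is invariant at every point and not
    merely up to a null set.\<close>
  define A where "A = {\<omega> \<in> space \<mu>. \<forall>c::nat. \<exists>n. real c < ?S n \<omega>}"
  have A: "A \<in> sets \<mu>" unfolding A_def by measurable
  \<comment> \<open>Shifting once replaces the first summand by a new last one.\<close>
  have near: "\<bar>?S n (shift z \<omega>) - ?S n \<omega>\<bar> \<le> 2 * C'" if \<omega>: "\<omega> \<in> space \<mu>" for n \<omega>
  proof -
    have "?S n (shift z \<omega>) - ?S n \<omega> = g (shift (z * int n) \<omega>) - g \<omega>"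
      using birkhoff_sum_Suc[OF \<omega>, of g z n] by (simp add: birkhoff_sum_def)
    then show ?thesis using gC[OF \<omega>] gC[OF shift_space[OF \<omega>, of "z * int n"]] by linarith
  qed
  have transfer: "\<omega>' \<in> A" if "\<omega> \<in> A" "\<omega>' \<in> space \<mu>" "\<And>n. ?S n \<omega> \<le> ?S n \<omega>' + 2 * C'" for \<omega> \<omega>'
  proof -
    have "\<exists>n. real c < ?S n \<omega>'" for c :: nat
    proof -
      have "\<forall>c::nat. \<exists>n. real c < ?S n \<omega>" using that(1) by (simp add: A_def)
      then obtain n where "real (c + nat \<lceil>2 * C'\<rceil>) < ?S n \<omega>" by blast
      then have "real c < ?S n \<omega>'" using that(3)[of n] by (simp; linarith)
      then show ?thesis ..
    qed
    then show ?thesis using that(2) by (simp add: A_def)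
  qed
  have up: "shift z \<omega> \<in> A" if "\<omega> \<in> A" for \<omega>
  proof (rule transfer[OF that])
    have \<omega>: "\<omega> \<in> space \<mu>" using that by (simp add: A_def)
    then show "shift z \<omega> \<in> space \<mu>" by (rule shift_space)
    show "?S n \<omega> \<le> ?S n (shift z \<omega>) + 2 * C'" for n using near[OF \<omega>, of n] by linarith
  qed
  have down: "shift (- z) \<omega> \<in> A" if "\<omega> \<in> A" for \<omega>
  proof (rule transfer[OF that])
    have \<omega>: "\<omega> \<in> space \<mu>" using that by (simp add: A_def)
    then show \<omega>': "shift (- z) \<omega> \<in> space \<mu>" by (rule shift_space)
    show "?S n \<omega> \<le> ?S n (shift (- z) \<omega>) + 2 * C'" for n
      using near[OF \<omega>', of n] shift_inverse[OF \<omega>, of "- z"] by (simp; linarith)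
  qed
  have one: "shift 1 \<omega> \<in> A" "shift (-1) \<omega> \<in> A" if "\<omega> \<in> A" for \<omega>
    using up[OF that] down[OF that] z by auto
  have A_space: "\<omega> \<in> space \<mu>" if "\<omega> \<in> A" for \<omega> using that by (simp add: A_def)
  have inv: "shift x \<omega> \<in> A" if \<omega>: "\<omega> \<in> A" for x \<omega>
  proof (induction x rule: int_induct[where k=0])
    case base
    then show ?case using \<omega> A_space[OF \<omega>] by (simp add: shift_zero)
  next
    case (step1 i)
    then show ?case using one(1)[of "shift i \<omega>"] A_space[OF \<omega>] by (simp add: shift_add add.commute)
  next
    case (step2 i)
    then show ?case using one(2)[of "shift i \<omega>"] A_space[OF \<omega>] by (simp add: shift_add)
  qed
  have img: "shift x ` A = A" for x
  proof (intro equalityI subsetI)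
    fix \<omega> assume \<omega>: "\<omega> \<in> A"
    have "\<omega> = shift x (shift (- x) \<omega>)" using shift_inverse[OF A_space[OF \<omega>], of "- x"] by simp
    then show "\<omega> \<in> shift x ` A" using inv[OF \<omega>] by blast
  qed (use inv in auto)
  have "prob A \<noteq> 1"
  proof
    assume "prob A = 1"
    then have "AE \<omega> in \<mu>. \<omega> \<in> A" using prob_Collect_eq_1[of "\<lambda>\<omega>. \<omega> \<in> A"] A A_space
      by (metis (mono_tags, lifting) AE_in_set_eq_1)
    then have "AE \<omega> in \<mu>. \<exists>n. 0 < ?S n \<omega>"
    proof (rule eventually_mono)
      fix \<omega> assume "\<omega> \<in> A"
      then have "\<exists>n. real 0 < ?S n \<omega>" unfolding A_def by blast
      then show "\<exists>n. 0 < ?S n \<omega>" by simp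
    qed
    from maximal_ergodic[OF g gC this] have "0 \<le> (\<integral>\<omega>. g \<omega> \<partial>\<mu>)" .
    moreover have "integrable \<mu> f"
      by (rule integrable_const_bound[where B=C]) (use C in auto)
    ultimately show False using \<alpha> by (simp add: g_def[abs_def] prob_space)
  qed
  then have "prob A = 0" using shift_ergodic[OF A img] by auto
  then have "AE \<omega> in \<mu>. \<omega> \<notin> A" using A by (simp add: AE_iff_measurable[OF A] emeasure_eq_measure prob_eq_0)
  then show ?thesis
    using AE_space
  proof eventually_elim
    case (elim \<omega>)
    then obtain c :: nat where "\<forall>n. ?S n \<omega> \<le> real c" by (auto simp: A_def not_less)
    then show ?case by (intro exI[of _ "real c"]) (auto simp: S_eq algebra_simps)
  qed
qed

text \<open>The upper bound for \<open>f\<close> and for \<open>- f\<close>. A linear bound with an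
  additive constant holds for all \<open>n\<close> at once and can be subtracted between the ends of
  arbitrary blocks, which a bare limit would not allow directly.\<close>

lemma birkhoff_sum_deviation:
  fixes f :: "'w \<Rightarrow> real"
  assumes f [measurable]: "f \<in> borel_measurable \<mu>" and C: "\<And>\<omega>. \<omega> \<in> space \<mu> \<Longrightarrow> \<bar>f \<omega>\<bar> \<le> C"
    and \<eta>: "0 < \<eta>" and z: "z \<in> {-1, 1}"
  shows "AE \<omega> in \<mu>. \<exists>c. \<forall>n. \<bar>birkhoff_sum f z n \<omega> - (\<integral>\<omega>. f \<omega> \<partial>\<mu>) * real n\<bar> \<le> \<eta> * real n + c"
proof -
  let ?m = "\<integral>\<omega>. f \<omega> \<partial>\<mu>"
  have neg: "birkhoff_sum (\<lambda>\<omega>. - f \<omega>) z n \<omega> = - birkhoff_sum f z n \<omega>" for n \<omega>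
    by (simp add: birkhoff_sum_def sum_negf)
  have "AE \<omega> in \<mu>. \<exists>c. \<forall>n. birkhoff_sum f z n \<omega> \<le> (?m + \<eta>) * real n + c"
    by (rule birkhoff_sum_upper[OF f C _ z]) (use \<eta> in auto)
  moreover have "AE \<omega> in \<mu>. \<exists>c. \<forall>n. birkhoff_sum (\<lambda>\<omega>. - f \<omega>) z n \<omega> \<le> (- ?m + \<eta>) * real n + c"
    by (rule birkhoff_sum_upper[OF _ _ _ z]) (use \<eta> C in auto)
  ultimately show ?thesis
  proof eventually_elim
    case (elim \<omega>)
    obtain c1 where c1: "\<And>n. birkhoff_sum f z n \<omega> \<le> (?m + \<eta>) * real n + c1"
      using elim(1) by blast
    obtain c2 where c2: "\<And>n. - birkhoff_sum f z n \<omega> \<le> (- ?m + \<eta>) * real n + c2"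
      using elim(2) neg by auto
    have "\<bar>birkhoff_sum f z n \<omega> - ?m * real n\<bar> \<le> \<eta> * real n + max c1 c2" for n
      using c1[of n] c2[of n] by (auto simp: abs_le_iff algebra_simps)
    then show ?case by blast
  qed
qed

end

section \<open>From half-line sums to arbitrary blocks\<close>

lemma sum_int_interval_nat:
  fixes e :: "int \<Rightarrow> real"
  shows "(\<Sum>y\<in>{0..<int n}. e y) = (\<Sum>k<n. e (int k))"
    and "(\<Sum>y\<in>{- int n<..0}. e y) = (\<Sum>k<n. e (- int k))"
proof -
  have "bij_betw int {..<n} {0..<int n}"
    by (rule bij_betw_byWitness[where f'=nat]) auto
  from sum.reindex_bij_betw[OF this, of e] show "(\<Sum>y\<in>{0..<int n}. e y) = (\<Sum>k<n. e (int k))" by simp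
  have "bij_betw (\<lambda>k. - int k) {..<n} {- int n<..0}"
    by (rule bij_betw_byWitness[where f'="\<lambda>y. nat (- y)"]) auto
  from sum.reindex_bij_betw[OF this, of e] show "(\<Sum>y\<in>{- int n<..0}. e y) = (\<Sum>k<n. e (- int k))" by simp
qed

text \<open>A block is a difference of two segments starting at the origin or a union of one in each
  direction. The term \<open>2 * \<eta>\<close> covers shifts of end points by one, and
  \<open>e 0\<close> the site shared by both directions. The error is measured by the distance to
  the origin rather than by the length, which is enough for windows whose distance to the origin and
  width are both of order \<open>sqrt n\<close>.\<close>

lemma interval_sum_deviation:
  fixes e :: "int \<Rightarrow> real"
  assumes "0 \<le> \<eta>" and pos: "\<And>n. \<bar>\<Sum>k<n. e (int k)\<bar> \<le> \<eta> * real n + c"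
    and neg: "\<And>n. \<bar>\<Sum>k<n. e (- int k)\<bar> \<le> \<eta> * real n + c" and ab: "a \<le> b"
  shows "\<bar>\<Sum>y\<in>{a..b}. e y\<bar> \<le> \<eta> * (\<bar>real_of_int a\<bar> + \<bar>real_of_int b\<bar>) + (2 * c + 2 * \<eta> + \<bar>e 0\<bar>)"
proof -
  have P: "\<bar>\<Sum>y\<in>{0..<m}. e y\<bar> \<le> \<eta> * real_of_int m + c" if "0 \<le> m" for m
    using pos[of "nat m"] sum_int_interval_nat(1)[of e "nat m"] that by simp
  have N: "\<bar>\<Sum>y\<in>{m<..0}. e y\<bar> \<le> \<eta> * real_of_int (- m) + c" if "m \<le> 0" for m
    using neg[of "nat (- m)"] sum_int_interval_nat(2)[of e "nat (- m)"] that by simp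
  consider "0 \<le> a" | "b \<le> 0" | "a < 0" "0 < b" by linarith
  then show ?thesis
  proof cases
    case 1
    have "{0..<b + 1} = {0..<a} \<union> {a..b}" using 1 ab by auto
    then have "(\<Sum>y\<in>{0..<b + 1}. e y) = (\<Sum>y\<in>{0..<a}. e y) + (\<Sum>y\<in>{a..b}. e y)"
      by (simp only:) (rule sum.union_disjoint; auto)
    then show ?thesis using P[of a] P[of "b + 1"] 1 ab assms(1) by (simp add: algebra_simps; linarith)
  next
    case 2
    have "{a - 1<..0} = {a..b} \<union> {b<..0}" using 2 ab by auto
    then have "(\<Sum>y\<in>{a - 1<..0}. e y) = (\<Sum>y\<in>{a..b}. e y) + (\<Sum>y\<in>{b<..0}. e y)"
      by (simp only:) (rule sum.union_disjoint; auto)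
    then show ?thesis using N[of "a - 1"] N[of b] 2 ab assms(1) by (simp add: algebra_simps; linarith)
  next
    case 3
    have "{a..b} = {a - 1<..0} \<union> {1..b}" using 3 by auto
    then have 1: "(\<Sum>y\<in>{a..b}. e y) = (\<Sum>y\<in>{a - 1<..0}. e y) + (\<Sum>y\<in>{1..b}. e y)"
      by (simp only:) (rule sum.union_disjoint; auto)
    have "{0..<b + 1} = insert 0 {1..b}" using 3 by auto
    then have "(\<Sum>y\<in>{0..<b + 1}. e y) = e 0 + (\<Sum>y\<in>{1..b}. e y)" by simp
    then show ?thesis using 1 N[of "a - 1"] P[of "b + 1"] 3 assms(1)
      by (simp add: algebra_simps; linarith)
  qed
qed

context random_environment
begin

lemma AE_reversible_rates:
  "AE \<omega> in \<mu>. reversible_rates (\<lambda>x z. j (shift x \<omega>) z) (\<lambda>x. \<pi> (shift x \<omega>)) K"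
  using AE_all_shifts[OF reversible] AE_all_shifts[OF j_bounds] AE_all_shifts[OF \<pi>_bounds] AE_space
proof eventually_elim
  case (elim \<omega>)
  show ?case
  proof
    show "\<pi> (shift x \<omega>) * j (shift x \<omega>) 1 = \<pi> (shift (x + 1) \<omega>) * j (shift (x + 1) \<omega>) (-1)" for x
    proof -
      have "\<pi> (shift x \<omega>) * j (shift x \<omega>) 1 =
          \<pi> (shift 1 (shift x \<omega>)) * j (shift 1 (shift x \<omega>)) (- 1)"
        using elim(1) by blast
      then show ?thesis by (simp only: shift_add[OF elim(4)] add.commute[of 1])
    qed
  qed (use elim K_pos in auto)
qed

lemma AE_weight_averages:
  "AE \<omega> in \<mu>. \<forall>\<eta>>0. \<exists>c. \<forall>a b. a \<le> b \<longrightarrow>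
    \<bar>(\<Sum>y\<in>{a..b}. \<pi> (shift y \<omega>)) - real_of_int (b - a + 1)\<bar> \<le> \<eta> * (\<bar>real_of_int a\<bar> + \<bar>real_of_int b\<bar>) + c"
proof -
  \<comment> \<open>The ergodic lemmas ask for a bound at every point, while \<pi> is bounded almost
    everywhere only; the truncation changes it on a null set.\<close>
  define f where "f \<omega> = min (\<pi> \<omega>) K" for \<omega>
  have f: "f \<in> borel_measurable \<mu>" unfolding f_def[abs_def] using \<pi>_measurable by measurable
  have fK: "\<bar>f \<omega>\<bar> \<le> K" if "\<omega> \<in> space \<mu>" for \<omega>
    using \<pi>_nonneg[OF that] K_pos by (auto simp: f_def)
  have eq: "AE \<omega> in \<mu>. f \<omega> = \<pi> \<omega>" using \<pi>_bounds by eventually_elim (simp add: f_def)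
  have int_f: "(\<integral>\<omega>. f \<omega> \<partial>\<mu>) = 1"
    using integral_cong_AE[OF f \<pi>_measurable eq] \<pi>_normalized by simp
  \<comment> \<open>Countably many rates are treated at once, so that a single null set serves every
    \<open>\<eta>\<close>.\<close>
  have dev: "AE \<omega> in \<mu>. \<forall>i::nat. \<exists>c. \<forall>n. \<bar>birkhoff_sum f z n \<omega> - real n\<bar> \<le> inverse (real (Suc i)) * real n + c"
    if "z \<in> {-1, 1}" for z
    unfolding AE_all_countable
    using birkhoff_sum_deviation[OF f fK _ that] by (simp add: int_f)
  show ?thesis
    using dev[OF insertI2[OF singletonI]] dev[OF insertI1] AE_all_shifts[OF eq]
  proof eventually_elim
    case (elim \<omega>)
    show ?case
    proof (intro allI impI)
      fix \<eta> :: real assume \<eta>: "0 < \<eta>"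
      then obtain i where i: "inverse (real (Suc i)) < \<eta>" using reals_Archimedean by blast
      define e where "e y = \<pi> (shift y \<omega>) - 1" for y
      have S: "birkhoff_sum f z n \<omega> - real n = (\<Sum>k<n. e (z * int k))" for z n
        using elim(3) by (simp add: birkhoff_sum_def e_def sum_subtractf)
      obtain c1 c2 where c: "\<And>n. \<bar>\<Sum>k<n. e (1 * int k)\<bar> \<le> inverse (real (Suc i)) * real n + c1"
        "\<And>n. \<bar>\<Sum>k<n. e (- 1 * int k)\<bar> \<le> inverse (real (Suc i)) * real n + c2"
        using elim(1,2) unfolding S by blast
      have le: "inverse (real (Suc i)) * real n \<le> \<eta> * real n" for n
        using i by (intro mult_right_mono) auto
      have "\<bar>\<Sum>k<n. e (int k)\<bar> \<le> \<eta> * real n + max c1 c2" "\<bar>\<Sum>k<n. e (- int k)\<bar> \<le> \<eta> * real n + max c1 c2" for n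
        using c(1)[of n] c(2)[of n] le[of n] by (simp_all del: of_nat_Suc)
      from interval_sum_deviation[OF _ this] \<eta>
      have "\<bar>\<Sum>y\<in>{a..b}. e y\<bar> \<le> \<eta> * (\<bar>real_of_int a\<bar> + \<bar>real_of_int b\<bar>) + (2 * max c1 c2 + 2 * \<eta> + \<bar>e 0\<bar>)"
        if "a \<le> b" for a b using that by simp
      moreover have "(\<Sum>y\<in>{a..b}. e y) = (\<Sum>y\<in>{a..b}. \<pi> (shift y \<omega>)) - real_of_int (b - a + 1)"
        if "a \<le> b" for a b using that by (simp add: e_def sum_subtractf)
      ultimately show "\<exists>c. \<forall>a b. a \<le> b \<longrightarrow> \<bar>(\<Sum>y\<in>{a..b}. \<pi> (shift y \<omega>)) - real_of_int (b - a + 1)\<bar>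
          \<le> \<eta> * (\<bar>real_of_int a\<bar> + \<bar>real_of_int b\<bar>) + c"
        by (intro exI[of _ "2 * max c1 c2 + 2 * \<eta> + \<bar>e 0\<bar>"]) auto
    qed
  qed
qed

end

section \<open>Skorokhod convergence and sojourn times\<close>

text \<open>One-sided limits give boundedness near each point; bisection passes from small intervals
  to the whole one.\<close>

lemma cadlag_bounded:
  assumes "cadlag f" "0 \<le> T"
  obtains B where "\<And>t. t \<in> {0..T} \<Longrightarrow> \<bar>f t\<bar> \<le> B"
proof -
  \<comment> \<open>The small intervals around 0 produced by bisection may reach below 0, where
    \<open>cadlag\<close> says nothing; hence the intersection.\<close>
  define P where "P a b \<longleftrightarrow> (\<exists>B. \<forall>t\<in>{a..b} \<inter> {0..}. \<bar>f t\<bar> \<le> B)" for a b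
  have near: "\<forall>\<^sub>F t in F. \<bar>f t\<bar> \<le> \<bar>l\<bar> + 1" if "(f \<longlongrightarrow> l) F" for F l
    using order_tendstoD(2)[OF tendsto_rabs[OF that], of "\<bar>l\<bar> + 1"]
    by (auto elim: eventually_mono)
  have "P 0 T"
    using assms(2)
  proof (induction rule: Bolzano)
    case (trans a b c)
    then obtain B1 B2 where "\<forall>t\<in>{a..b} \<inter> {0..}. \<bar>f t\<bar> \<le> B1" "\<forall>t\<in>{b..c} \<inter> {0..}. \<bar>f t\<bar> \<le> B2"
      by (auto simp: P_def)
    then have "\<forall>t\<in>{a..c} \<inter> {0..}. \<bar>f t\<bar> \<le> max B1 B2"
      by (metis IntE IntI atLeastAtMost_iff le_max_iff_disj linorder_le_cases)
    then show ?case by (auto simp: P_def)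
  next
    case (local x)
    have "(f \<longlongrightarrow> f x) (at_right x)" using assms(1) local by (simp add: cadlag_def)
    from near[OF this] obtain d1 where d1: "x < d1" "\<And>t. x < t \<Longrightarrow> t < d1 \<Longrightarrow> \<bar>f t\<bar> \<le> \<bar>f x\<bar> + 1"
      by (auto simp: eventually_at_right_field)
    have "\<exists>d2<x. \<exists>B. \<forall>t. d2 < t \<longrightarrow> t < x \<longrightarrow> 0 \<le> t \<longrightarrow> \<bar>f t\<bar> \<le> B"
    proof (cases "0 < x")
      case True
      then obtain l where "(f \<longlongrightarrow> l) (at_left x)" using assms(1) by (auto simp: cadlag_def)
      from near[OF this] show ?thesis by (auto simp: eventually_at_left_field)
    next
      case False
      then show ?thesis using local by (intro exI[of _ "x - 1"]) auto
    qed
    then obtain d2 B where d2: "d2 < x" "\<And>t. d2 < t \<Longrightarrow> t < x \<Longrightarrow> 0 \<le> t \<Longrightarrow> \<bar>f t\<bar> \<le> B" by blast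
    show ?case
    proof (intro exI[of _ "min (d1 - x) (x - d2)"] conjI allI impI)
      fix a b assume ab: "a \<le> x \<and> x \<le> b \<and> b - a < min (d1 - x) (x - d2)"
      have "\<bar>f t\<bar> \<le> max B (\<bar>f x\<bar> + 1)" if "t \<in> {a..b} \<inter> {0..}" for t
        using that ab d1(2)[of t] d2(2)[of t] by (cases t x rule: linorder_cases) auto
      then show "P a b" unfolding P_def by blast
    qed (use d1 d2 in auto)
  qed
  then obtain B where "\<forall>t\<in>{0..T} \<inter> {0..}. \<bar>f t\<bar> \<le> B" unfolding P_def by blast
  then show ?thesis using that[of B] by simp
qed

text \<open>The set of admissible errors in the Skorokhod distance has to be nonempty, since the
  infimum of the empty set of reals carries no information; hence the boundedness assumption.\<close>

lemma skorokhod_limit_uniform: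
  assumes T: "0 \<le> T" and conv: "(\<lambda>n. skorokhod_dist T (f n) g) \<longlonglongrightarrow> 0"
    and cont: "continuous_on {0..T} g"
    and bounded: "\<And>n. 1 \<le> n \<Longrightarrow> \<exists>B. \<forall>t\<in>{0..T}. \<bar>f n t\<bar> \<le> B"
    and \<delta>: "0 < \<delta>"
  shows "\<forall>\<^sub>F n in sequentially. \<forall>t\<in>{0..T}. \<bar>f n t - g t\<bar> \<le> \<delta>"
proof -
  \<comment> \<open>Uniform continuity of the limit undoes the time change, which moves each
    \<open>t\<close> by less than \<open>d\<close>.\<close>
  have "uniformly_continuous_on {0..T} g"
    by (rule compact_uniformly_continuous[OF cont]) simp
  then obtain d where d: "0 < d"
    "\<And>s t. s \<in> {0..T} \<Longrightarrow> t \<in> {0..T} \<Longrightarrow> \<bar>s - t\<bar> < d \<Longrightarrow> \<bar>g s - g t\<bar> < \<delta> / 2"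
    unfolding uniformly_continuous_on_def dist_real_def using \<delta> by (metis half_gt_zero)
  have "bounded (g ` {0..T})"
    by (rule compact_imp_bounded[OF compact_continuous_image[OF cont]]) simp
  then obtain Bg where "\<forall>t\<in>{0..T}. \<bar>g t\<bar> \<le> Bg" unfolding bounded_iff by auto
  then have Bg: "\<bar>g t\<bar> \<le> Bg" if "t \<in> {0..T}" for t using that by blast
  have "\<forall>\<^sub>F n in sequentially. skorokhod_dist T (f n) g < min d (\<delta> / 2)"
    using conv \<delta> d(1) by (intro order_tendstoD) auto
  then show ?thesis
    using eventually_ge_at_top[of 1]
  proof eventually_elim
    case (elim n)
    define E where "E = {\<epsilon>. 0 < \<epsilon> \<and> (\<exists>\<tau>\<in>time_changes T.
      \<forall>t\<in>{0..T}. \<bar>\<tau> t - t\<bar> \<le> \<epsilon> \<and> \<bar>f n t - g (\<tau> t)\<bar> \<le> \<epsilon>)}"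
    obtain Bf where Bf: "\<forall>t\<in>{0..T}. \<bar>f n t\<bar> \<le> Bf" using bounded elim by blast
    have "\<bar>Bf\<bar> + \<bar>Bg\<bar> + 1 \<in> E"
      unfolding E_def
    proof (intro CollectI conjI bexI[of _ "\<lambda>t. t"] ballI)
      show "(\<lambda>t. t) \<in> time_changes T"
        by (auto simp: time_changes_def strict_mono_on_def bij_betw_def)
      fix t assume t: "t \<in> {0..T}"
      show "\<bar>f n t - g t\<bar> \<le> \<bar>Bf\<bar> + \<bar>Bg\<bar> + 1"
        using bspec[OF Bf t] Bg[OF t] by linarith
    qed auto
    then have "E \<noteq> {}" by blast
    moreover have "Inf E < min d (\<delta> / 2)" using elim(1) by (simp add: skorokhod_dist_def E_def)
    ultimately obtain \<epsilon> where "\<epsilon> \<in> E" and \<epsilon>: "\<epsilon> < min d (\<delta> / 2)" by (meson cInf_lessD)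
    then obtain \<tau> where \<tau>: "\<tau> \<in> time_changes T"
      "\<And>t. t \<in> {0..T} \<Longrightarrow> \<bar>\<tau> t - t\<bar> \<le> \<epsilon> \<and> \<bar>f n t - g (\<tau> t)\<bar> \<le> \<epsilon>" by (auto simp: E_def)
    show ?case
    proof
      fix t assume t: "t \<in> {0..T}"
      have "\<tau> t \<in> {0..T}" using \<tau>(1) t by (auto simp: time_changes_def bij_betw_def)
      then have "\<bar>g (\<tau> t) - g t\<bar> < \<delta> / 2" using d(2) t \<tau>(2)[OF t] \<epsilon> by auto
      then show "\<bar>f n t - g t\<bar> \<le> \<delta>" using \<tau>(2)[OF t] \<epsilon> by linarith
    qed
  qed
qed

section \<open>Sojourn times and window densities\<close>

lemma time_measure_scale:
  fixes f :: "real \<Rightarrow> real"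
  assumes "0 < c"
  shows "(\<integral>s. f (c * s) \<partial>time_measure t) = (\<integral>s. f s \<partial>time_measure (c * t)) / c"
proof -
  have "(\<integral>s. f s \<partial>time_measure (c * t)) = (\<integral>s. indicat_real {0..c * t} s * f s \<partial>lborel)"
    by (simp add: integral_restrict_space)
  also have "\<dots> = \<bar>c\<bar> *\<^sub>R (\<integral>s. indicat_real {0..c * t} (0 + c * s) * f (0 + c * s) \<partial>lborel)"
    by (rule lborel_integral_real_affine) (use assms in simp)
  also have "(\<lambda>s. indicat_real {0..c * t} (0 + c * s) * f (0 + c * s)) =
      (\<lambda>s. indicat_real {0..t} s * f (c * s))"
    using assms by (auto simp: indicator_def zero_le_mult_iff)
  finally show ?thesis using assms by (simp add: integral_restrict_space)
qed

definition sojourn :: "(real \<Rightarrow> 'b \<Rightarrow> real) \<Rightarrow> real \<Rightarrow> real set \<Rightarrow> 'b \<Rightarrow> real" where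
  "sojourn Z t S u = (\<integral>s. indicat_real S (Z s u) \<partial>time_measure t)"

lemma sojourn_nonneg: "0 \<le> sojourn Z t S u"
  unfolding sojourn_def by (rule integral_nonneg_AE) auto

lemma sojourn_le:
  assumes "0 \<le> t"
  shows "sojourn Z t S u \<le> t"
proof -
  interpret finite_measure "time_measure t" by (rule finite_time_measure)
  have "sojourn Z t S u \<le> (\<integral>s. 1 \<partial>time_measure t)"
    unfolding sojourn_def by (rule integral_mono_AE') auto
  then show ?thesis using measure_time_measure[OF assms] by simp
qed

lemma integrable_indicator_real_path:
  assumes "f \<in> borel_measurable (time_measure t)" "S \<in> sets borel"
  shows "integrable (time_measure t) (\<lambda>s. indicat_real S (f s))"
proof -
  interpret finite_measure "time_measure t" by (rule finite_time_measure)
  show ?thesis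
    by (rule integrable_const_bound[where B=1])
      (use measurable_compose[OF assms(1), of "indicat_real S" borel] assms(2) in auto)
qed

lemma sojourn_integrable:
  assumes "prob_space M" "0 \<le> t" "S \<in> sets borel"
    and Z: "(\<lambda>(u, s). Z s u) \<in> borel_measurable (M \<Otimes>\<^sub>M time_measure t)"
  shows "integrable M (sojourn Z t S)"
proof -
  interpret prob_space M by fact
  interpret I: finite_measure "time_measure t" by (rule finite_time_measure)
  have "(\<lambda>(u, s). indicat_real S (Z s u)) \<in> borel_measurable (M \<Otimes>\<^sub>M time_measure t)"
    using measurable_compose[OF Z, of "indicat_real S" borel] assms(3) by (simp add: case_prod_unfold)
  from I.borel_measurable_lebesgue_integral[OF this]
  have "sojourn Z t S \<in> borel_measurable M" by (simp add: sojourn_def[abs_def])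
  then show ?thesis
    by (intro integrable_const_bound[where B=t])
      (use assms(2) sojourn_nonneg[of Z t S] sojourn_le[of t Z S] in auto)
qed

definition density_at :: "real \<Rightarrow> (real \<Rightarrow> 'b \<Rightarrow> real) \<Rightarrow> real \<Rightarrow> real \<Rightarrow> 'b \<Rightarrow> real" where
  "density_at \<epsilon> Z t y u = sojourn Z t {z. \<bar>z - y\<bar> \<le> \<epsilon>} u / (2 * \<epsilon>)"

lemma closed_window [measurable]: "{z::real. \<bar>z - y\<bar> \<le> \<epsilon>} \<in> sets borel"
  by measurable

text \<open>If two paths are \<open>\<delta>\<close>-close at some time, the window indicators can
  disagree only while \<open>Z\<close> is within \<open>\<delta>\<close> of an end
  \<open>y + \<epsilon>\<close> or \<open>y - \<epsilon>\<close>. Only sojourns of \<open>Z\<close>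
  near the ends occur, since \<open>Z\<close> will be the walk, for which they are controlled in
  mean. The time spent apart is taken up to \<open>T\<close>, so that this term is independent of
  \<open>t\<close>.\<close>

lemma density_at_diff_le:
  assumes f: "(\<lambda>s. Z s u) \<in> borel_measurable (time_measure T)"
      "(\<lambda>s. Z' s u) \<in> borel_measurable (time_measure T)"
    and t: "0 \<le> t" "t \<le> T" and \<epsilon>: "0 < \<epsilon>"
  shows "\<bar>density_at \<epsilon> Z t y u - density_at \<epsilon> Z' t y u\<bar> \<le>
    (sojourn Z t {z. \<bar>z - (y + \<epsilon>)\<bar> \<le> \<delta>} u + sojourn Z t {z. \<bar>z - (y - \<epsilon>)\<bar> \<le> \<delta>} u
      + sojourn (\<lambda>s u. Z s u - Z' s u) T {z. \<delta> < \<bar>z\<bar>} u) / (2 * \<epsilon>)"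
proof -
  have restrict: "g \<in> borel_measurable (time_measure t)" if "g \<in> borel_measurable (time_measure T)" for g :: "real \<Rightarrow> real"
  proof -
    have "restrict_space (time_measure T) {0..t} = time_measure t"
      using t by (subst restrict_restrict_space) (auto intro!: arg_cong[where f="restrict_space lborel"])
    then show ?thesis using measurable_restrict_space1[OF that, of "{0..t}"] by simp
  qed
  have fd: "(\<lambda>s. Z s u - Z' s u) \<in> borel_measurable (time_measure T)" using f by simp
  have out: "{z::real. \<delta> < \<bar>z\<bar>} \<in> sets borel" by measurable
  note int = integrable_indicator_real_path[OF restrict[OF f(1)]]
    integrable_indicator_real_path[OF restrict[OF f(2)]]
    integrable_indicator_real_path[OF restrict[OF fd] out]
  have mono: "sojourn (\<lambda>s u. Z s u - Z' s u) t {z. \<delta> < \<bar>z\<bar>} u \<le> sojourn (\<lambda>s u. Z s u - Z' s u) T {z. \<delta> < \<bar>z\<bar>} u"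
  proof -
    have i: "integrable lborel (\<lambda>s. indicat_real {0..T} s *\<^sub>R indicat_real {z. \<delta> < \<bar>z\<bar>} (Z s u - Z' s u))"
      using integrable_indicator_real_path[OF fd out] by (simp add: integrable_restrict_space)
    show ?thesis
      unfolding sojourn_def using t i
      by (simp add: integral_restrict_space) (intro integral_mono_AE'; auto simp: indicator_def)
  qed
  have "\<bar>sojourn Z t {z. \<bar>z - y\<bar> \<le> \<epsilon>} u - sojourn Z' t {z. \<bar>z - y\<bar> \<le> \<epsilon>} u\<bar> =
    \<bar>\<integral>s. indicat_real {z. \<bar>z - y\<bar> \<le> \<epsilon>} (Z s u) - indicat_real {z. \<bar>z - y\<bar> \<le> \<epsilon>} (Z' s u) \<partial>time_measure t\<bar>"
    unfolding sojourn_def by (subst Bochner_Integration.integral_diff) (use int in auto)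
  also have "\<dots> \<le> (\<integral>s. \<bar>indicat_real {z. \<bar>z - y\<bar> \<le> \<epsilon>} (Z s u) - indicat_real {z. \<bar>z - y\<bar> \<le> \<epsilon>} (Z' s u)\<bar> \<partial>time_measure t)"
    by (rule integral_abs_bound)
  also have "\<dots> \<le> (\<integral>s. indicat_real {z. \<bar>z - (y + \<epsilon>)\<bar> \<le> \<delta>} (Z s u) + indicat_real {z. \<bar>z - (y - \<epsilon>)\<bar> \<le> \<delta>} (Z s u)
      + indicat_real {z. \<delta> < \<bar>z\<bar>} (Z s u - Z' s u) \<partial>time_measure t)"
    by (intro integral_mono integrable_abs Bochner_Integration.integrable_diff
        Bochner_Integration.integrable_add int closed_window) (auto simp: indicator_def)
  also have "\<dots> = sojourn Z t {z. \<bar>z - (y + \<epsilon>)\<bar> \<le> \<delta>} u + sojourn Z t {z. \<bar>z - (y - \<epsilon>)\<bar> \<le> \<delta>} u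
      + sojourn (\<lambda>s u. Z s u - Z' s u) t {z. \<delta> < \<bar>z\<bar>} u"
    unfolding sojourn_def
    by (simp add: Bochner_Integration.integral_add int)
  finally show ?thesis
    using mono \<epsilon> unfolding density_at_def diff_divide_distrib[symmetric] abs_divide
    by (simp add: divide_right_mono)
qed

section \<open>From the walks to the limit process\<close>

lemma eventually_sqrt_ge: "\<forall>\<^sub>F n in sequentially. Q \<le> sqrt (real n)"
  using filterlim_compose[OF sqrt_at_top filterlim_real_sequentially]
  by (simp add: filterlim_at_top)

text \<open>Continuity of \<open>X\<close> is required on every path because it yields joint
  measurability; a modification on a null set provides it later. Skorokhod convergence enters in its
  uniform form, available since the limit is continuous.\<close>

locale coupled_walks = reversible_rates r w K + prob_space M
  for r :: "int \<Rightarrow> int \<Rightarrow> real" and w :: "int \<Rightarrow> real" and K :: real and M :: "'b measure" +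
  fixes \<xi> :: "nat \<Rightarrow> real \<Rightarrow> 'b \<Rightarrow> int" and X :: "real \<Rightarrow> 'b \<Rightarrow> real" and T R :: real
  assumes T: "0 < T" and R: "0 < R"
    and walk: "\<And>n. 1 \<le> n \<Longrightarrow> markov_walk M r 0 (\<xi> n)"
    and averages: "\<And>\<eta>. 0 < \<eta> \<Longrightarrow> \<exists>c. \<forall>a b. a \<le> b \<longrightarrow>
      \<bar>weight a b - real_of_int (b - a + 1)\<bar> \<le> \<eta> * (\<bar>real_of_int a\<bar> + \<bar>real_of_int b\<bar>) + c"
    and X_measurable: "\<And>t. 0 \<le> t \<Longrightarrow> X t \<in> borel_measurable M"
    and X_continuous: "\<And>u. u \<in> space M \<Longrightarrow> continuous_on {0..} (\<lambda>t. X t u)"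
    and convergence: "AE u in M. \<forall>\<delta>>0. \<forall>\<^sub>F n in sequentially. \<forall>t\<in>{0..T}.
      \<bar>1 / sqrt (real n) * real_of_int (\<xi> n (real n * t) u) - X t u\<bar> \<le> \<delta>"
begin

definition scaled_walk :: "nat \<Rightarrow> real \<Rightarrow> 'b \<Rightarrow> real" where
  "scaled_walk n s u = 1 / sqrt (real n) * real_of_int (\<xi> n (real n * s) u)"

definition lo :: "nat \<Rightarrow> real \<Rightarrow> real \<Rightarrow> int" where
  "lo n y \<epsilon> = \<lceil>(y - \<epsilon>) * sqrt (real n)\<rceil>"

definition hi :: "nat \<Rightarrow> real \<Rightarrow> real \<Rightarrow> int" where
  "hi n y \<epsilon> = \<lfloor>(y + \<epsilon>) * sqrt (real n)\<rfloor>"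

abbreviation C where "C \<equiv> occupation_bound T"

lemma C_pos: "0 < C"
  using T K_pos by (simp add: occupation_bound_def add_pos_pos)

lemma window_iff:
  assumes "1 \<le> n"
  shows "\<bar>real_of_int x / sqrt (real n) - y\<bar> \<le> \<epsilon> \<longleftrightarrow> x \<in> {lo n y \<epsilon>..hi n y \<epsilon>}"
proof -
  have q: "0 < sqrt (real n)" using assms by simp
  have "\<bar>real_of_int x / sqrt (real n) - y\<bar> \<le> \<epsilon> \<longleftrightarrow>
      y - \<epsilon> \<le> real_of_int x / sqrt (real n) \<and> real_of_int x / sqrt (real n) \<le> y + \<epsilon>"
    by (auto simp: abs_le_iff)
  also have "\<dots> \<longleftrightarrow> x \<in> {lo n y \<epsilon>..hi n y \<epsilon>}"
    using q by (simp add: lo_def hi_def ceiling_le_iff le_floor_iff pos_le_divide_eq pos_divide_le_eq)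
  finally show ?thesis .
qed

lemma lo_hi_bounds:
  shows "(y - \<epsilon>) * sqrt (real n) \<le> real_of_int (lo n y \<epsilon>)"
    and "real_of_int (lo n y \<epsilon>) < (y - \<epsilon>) * sqrt (real n) + 1"
    and "(y + \<epsilon>) * sqrt (real n) - 1 < real_of_int (hi n y \<epsilon>)"
    and "real_of_int (hi n y \<epsilon>) \<le> (y + \<epsilon>) * sqrt (real n)"
    and "real_of_int (hi n y \<epsilon> - lo n y \<epsilon> + 1) \<le> 2 * \<epsilon> * sqrt (real n) + 1"
proof -
  show 1: "(y - \<epsilon>) * sqrt (real n) \<le> real_of_int (lo n y \<epsilon>)"
    "real_of_int (lo n y \<epsilon>) < (y - \<epsilon>) * sqrt (real n) + 1"
    "(y + \<epsilon>) * sqrt (real n) - 1 < real_of_int (hi n y \<epsilon>)"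
    "real_of_int (hi n y \<epsilon>) \<le> (y + \<epsilon>) * sqrt (real n)"
    unfolding lo_def hi_def by linarith+
  have "(y + \<epsilon>) * sqrt (real n) - (y - \<epsilon>) * sqrt (real n) = 2 * \<epsilon> * sqrt (real n)"
    by (simp add: algebra_simps)
  then show "real_of_int (hi n y \<epsilon> - lo n y \<epsilon> + 1) \<le> 2 * \<epsilon> * sqrt (real n) + 1"
    using 1 by simp
qed

lemma scaled_walk_pair: "(\<lambda>(u, s). scaled_walk n s u) \<in> borel_measurable (M \<Otimes>\<^sub>M time_measure t)"
proof (cases "1 \<le> n")
  case True
  have meas: "\<xi> n s \<in> measurable M (count_space UNIV)" if "0 \<le> s" for s
    using walk[OF True] that by (simp add: markov_walk_def)
  have "scaled_walk n s \<in> borel_measurable M" if "0 \<le> s" for s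
    unfolding scaled_walk_def[abs_def]
    by (intro borel_measurable_times borel_measurable_const measurable_compose[OF meas]) (use that in auto)
  moreover have "((\<lambda>s. scaled_walk n s u) \<longlongrightarrow> scaled_walk n s u) (at_right s)"
    if s: "0 \<le> s" and u: "u \<in> space M" for s u
  proof -
    have "((\<lambda>s. real_of_int (\<xi> n s u)) \<longlongrightarrow> real_of_int (\<xi> n (real n * s) u)) (at_right (real n * s))"
      using walk[OF True] s u by (simp add: markov_walk_def cadlag_def)
    moreover have "filterlim (\<lambda>s. real n * s) (at_right (real n * s)) (at_right s)"
      unfolding filterlim_at using True
      by (auto intro!: tendsto_intros intro: eventually_mono[OF eventually_at_right_less[of s]])
    ultimately show ?thesis
      unfolding scaled_walk_def by (intro tendsto_mult_left) (rule filterlim_compose)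
  qed
  ultimately show ?thesis by (rule measurable_pair_right_continuous)
next
  \<comment> \<open>Here \<open>1 / sqrt 0\<close> is 0, so the scaled walk vanishes
    identically.\<close>
  case False
  then have "n = 0" by simp
  then show ?thesis by (simp add: scaled_walk_def case_prod_unfold)
qed

lemma X_pair: "(\<lambda>(u, s). X s u) \<in> borel_measurable (M \<Otimes>\<^sub>M time_measure t)"
proof (rule measurable_pair_right_continuous[OF X_measurable])
  fix s :: real and u assume "0 \<le> s" "u \<in> space M"
  then have "((\<lambda>s. X s u) \<longlongrightarrow> X s u) (at s within {0..})"
    using X_continuous by (simp add: continuous_on)
  then show "((\<lambda>s. X s u) \<longlongrightarrow> X s u) (at_right s)"
    by (rule tendsto_within_subset) (use \<open>0 \<le> s\<close> in auto)
qed

lemma sojourn_scaled_walk: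
  assumes "1 \<le> n"
  shows "sojourn (scaled_walk n) t {z. \<bar>z - y\<bar> \<le> \<epsilon>} u =
    occupation (\<xi> n) (real n * t) {lo n y \<epsilon>..hi n y \<epsilon>} u / real n"
proof -
  have "indicat_real {z. \<bar>z - y\<bar> \<le> \<epsilon>} (scaled_walk n s u) = indicat_real {lo n y \<epsilon>..hi n y \<epsilon>} (\<xi> n (real n * s) u)" for s
    using window_iff[OF assms, of "\<xi> n (real n * s) u" y \<epsilon>]
    by (simp add: scaled_walk_def indicator_def)
  then show ?thesis
    unfolding sojourn_def occupation_def
    using time_measure_scale[where c="real n" and t=t and f="\<lambda>s. indicat_real {lo n y \<epsilon>..hi n y \<epsilon>} (\<xi> n s u)"] assms by simp
qed

lemma density_at_scaled_walk:
  assumes "1 \<le> n"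
  shows "density_at \<epsilon> (scaled_walk n) t y u =
    occupation (\<xi> n) (real n * t) {lo n y \<epsilon>..hi n y \<epsilon>} u / (2 * \<epsilon> * real n)"
  unfolding density_at_def sojourn_scaled_walk[OF assms] by (simp add: mult_ac)

text \<open>Uniformly in \<open>y\<close>, the walk spends little time in a narrow window; this will
  be applied to the ends of larger windows. The term \<open>1 / sqrt n\<close> accounts for the
  single site that even a window of width zero may contain.\<close>

lemma mean_sojourn_le:
  assumes n: "1 \<le> n" and t: "0 \<le> t" "t \<le> T" and \<delta>: "0 \<le> \<delta>"
  shows "expectation (sojourn (scaled_walk n) t {z. \<bar>z - y\<bar> \<le> \<delta>}) \<le> C * K * (2 * \<delta> + 1 / sqrt (real n))"
proof -
  define q where "q = sqrt (real n)"
  have q: "0 < q" "q * q = real n" using n by (auto simp: q_def)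
  let ?a = "lo n y \<delta>" and ?b = "hi n y \<delta>"
  have wt: "weight ?a ?b \<le> (2 * \<delta> * q + 1) * K"
  proof (cases "?a \<le> ?b")
    case True
    from weight_le[OF this] show ?thesis
      by (rule order_trans) (intro mult_right_mono, use lo_hi_bounds(5) K_pos in \<open>auto simp: q_def\<close>)
  next
    case False
    then show ?thesis using q \<delta> K_pos by (simp add: weight_def)
  qed
  have "expectation (sojourn (scaled_walk n) t {z. \<bar>z - y\<bar> \<le> \<delta>})
      = expectation (occupation (\<xi> n) (real n * t) {?a..?b}) / real n"
    unfolding sojourn_scaled_walk[OF n, abs_def] by simp
  also have "\<dots> \<le> C * q * weight ?a ?b / real n"
    using mean_occ_block_le[OF prob_space_axioms walk[OF n] n, of "real n * t" T ?a ?b] t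
    by (intro divide_right_mono) (auto simp: mean_occ_def[OF prob_space_axioms walk[OF n]] q_def mult_left_mono)
  also have "\<dots> \<le> C * q * ((2 * \<delta> * q + 1) * K) / real n"
    using wt C_pos q by (intro divide_right_mono mult_left_mono) auto
  also have "\<dots> = C * K * (2 * \<delta> + 1 / q)"
    using q(1) unfolding q(2)[symmetric] by (simp add: field_simps)
  finally show ?thesis by (simp add: q_def)
qed

lemma weight_window:
  assumes \<epsilon>: "0 < \<epsilon>" and \<eta>: "0 < \<eta>"
  shows "\<forall>\<^sub>F n in sequentially. \<forall>y. \<bar>y\<bar> \<le> R \<longrightarrow>
    real_of_int (hi n y \<epsilon> - lo n y \<epsilon> + 1) \<le> 3 * \<epsilon> * sqrt (real n) \<and>
    \<bar>1 - weight (lo n y \<epsilon>) (hi n y \<epsilon>) / (2 * \<epsilon> * sqrt (real n))\<bar> \<le> \<eta>"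
proof -
  \<comment> \<open>The block ends lie within \<open>(R + \<epsilon>) * sqrt n\<close> of the origin
    up to rounding, so the ergodic error is about \<open>\<eta> * \<epsilon> * sqrt n\<close>: half
    of what is allowed, uniformly in \<open>y\<close>.\<close>
  define \<eta>' where "\<eta>' = \<eta> * \<epsilon> / (2 * (R + \<epsilon>))"
  have \<eta>': "0 < \<eta>'" "\<eta>' * (2 * (R + \<epsilon>)) = \<eta> * \<epsilon>" using \<epsilon> \<eta> R by (simp_all add: \<eta>'_def)
  obtain c where c: "\<And>a b. a \<le> b \<Longrightarrow>
      \<bar>weight a b - real_of_int (b - a + 1)\<bar> \<le> \<eta>' * (\<bar>real_of_int a\<bar> + \<bar>real_of_int b\<bar>) + c"
    using averages[OF \<eta>'(1)] by blast
  \<comment> \<open>The first threshold makes the block nonempty and its length at most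
    \<open>3 * \<epsilon> * sqrt n\<close>; the second lets the other half of the allowance absorb
    rounding and the constant \<open>c\<close>.\<close>
  have "\<forall>\<^sub>F n in sequentially. max (1 / \<epsilon>) ((1 + \<bar>c\<bar> + 2 * \<eta>') / (\<epsilon> * \<eta>)) \<le> sqrt (real n)"
    by (rule eventually_sqrt_ge)
  then show ?thesis
  proof (rule eventually_mono, intro allI impI)
    fix n y assume Q: "max (1 / \<epsilon>) ((1 + \<bar>c\<bar> + 2 * \<eta>') / (\<epsilon> * \<eta>)) \<le> sqrt (real n)" and y: "\<bar>y\<bar> \<le> R"
    define q where "q = sqrt (real n)"
    define a b where "a = lo n y \<epsilon>" and "b = hi n y \<epsilon>"
    note Q' = Q[folded q_def]
    have q1: "1 \<le> \<epsilon> * q" using Q' \<epsilon> by (simp add: field_simps)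
    have q2: "1 + \<bar>c\<bar> + 2 * \<eta>' \<le> \<eta> * \<epsilon> * q" using Q' \<epsilon> \<eta> by (simp add: pos_divide_le_eq mult_ac)
    have q0: "0 < q" using q1 \<epsilon> by (smt (verit) mult_nonneg_nonpos)
    have diff: "(y + \<epsilon>) * q - (y - \<epsilon>) * q = 2 * (\<epsilon> * q)" by (simp add: algebra_simps)
    note bounds = lo_hi_bounds[where y=y and \<epsilon>=\<epsilon> and n=n, folded q_def a_def b_def]
    have ab: "a \<le> b"
    proof -
      have "real_of_int a < real_of_int b + 1" using bounds diff q1 by linarith
      then show ?thesis by linarith
    qed
    have len: "real_of_int (b - a + 1) \<le> 2 * (\<epsilon> * q) + 1" "2 * (\<epsilon> * q) - 1 \<le> real_of_int (b - a + 1)"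
      using bounds diff by auto
    have "\<bar>(y + \<epsilon>) * q\<bar> \<le> (R + \<epsilon>) * q" "\<bar>(y - \<epsilon>) * q\<bar> \<le> (R + \<epsilon>) * q"
      unfolding abs_mult using y \<epsilon> q0 by (auto intro!: mult_mono)
    then have "\<bar>real_of_int a\<bar> + \<bar>real_of_int b\<bar> \<le> 2 * ((R + \<epsilon>) * q) + 2" using bounds by linarith
    then have "\<eta>' * (\<bar>real_of_int a\<bar> + \<bar>real_of_int b\<bar>) \<le> \<eta>' * (2 * ((R + \<epsilon>) * q) + 2)"
      using \<eta>' by (intro mult_left_mono) auto
    also have "\<dots> = \<eta>' * (2 * (R + \<epsilon>)) * q + 2 * \<eta>'" by (simp add: algebra_simps)
    finally have "\<bar>weight a b - real_of_int (b - a + 1)\<bar> \<le> \<eta> * \<epsilon> * q + 2 * \<eta>' + c"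
      using c[OF ab] unfolding \<eta>'(2) by linarith
    then have "\<bar>2 * (\<epsilon> * q) - weight a b\<bar> \<le> 2 * (\<eta> * \<epsilon> * q)" using len q2 by linarith
    moreover have "\<bar>1 - weight a b / (2 * \<epsilon> * q)\<bar> = \<bar>2 * (\<epsilon> * q) - weight a b\<bar> / (2 * (\<epsilon> * q))"
    proof -
      have "1 - weight a b / (2 * \<epsilon> * q) = (2 * (\<epsilon> * q) - weight a b) / (2 * (\<epsilon> * q))"
        using \<epsilon> q0 by (simp add: field_simps)
      then show ?thesis using \<epsilon> q0 by (simp add: abs_divide)
    qed
    ultimately have "\<bar>1 - weight a b / (2 * \<epsilon> * q)\<bar> \<le> \<eta>"
      using \<epsilon> q0 by (simp add: pos_divide_le_eq mult_ac)
    moreover have "real_of_int (b - a + 1) \<le> 3 * \<epsilon> * q" using len q1 by simp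
    ultimately show "real_of_int (hi n y \<epsilon> - lo n y \<epsilon> + 1) \<le> 3 * \<epsilon> * sqrt (real n) \<and>
      \<bar>1 - weight (lo n y \<epsilon>) (hi n y \<epsilon>) / (2 * \<epsilon> * sqrt (real n))\<bar> \<le> \<eta>"
      by (simp add: a_def b_def q_def)
  qed
qed

text \<open>The factor 24 is the 8 of \<open>occupation_smoothing\<close> times 3, from the block
  length \<open>3 * \<epsilon> * sqrt n\<close>.\<close>

definition smoothing :: "real \<Rightarrow> real" where
  "smoothing \<epsilon> = sqrt (24 * K\<^sup>2 * C * \<epsilon>)"

text \<open>The site need only lie in the window, not at its centre. This allows both a fixed centre
  \<open>y\<close> with a nearby site depending on \<open>n\<close>, and a centre moving with the
  site.\<close>

lemma occupation_near_density:
  assumes \<epsilon>: "0 < \<epsilon>" and \<eta>: "0 < \<eta>"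
  shows "\<forall>\<^sub>F n in sequentially. \<forall>t\<in>{0..T}. \<forall>y x. \<bar>y\<bar> \<le> R \<longrightarrow> \<bar>real_of_int x / sqrt (real n) - y\<bar> \<le> \<epsilon> \<longrightarrow>
    expectation (\<lambda>u. \<bar>occupation (\<xi> n) (real n * t) {x} u / (sqrt (real n) * w x)
      - density_at \<epsilon> (scaled_walk n) t y u\<bar>) \<le> smoothing \<epsilon> + \<eta>"
proof -
  have "0 < \<eta> / C" using \<eta> C_pos by simp
  from weight_window[OF \<epsilon> this] eventually_ge_at_top[of 1] show ?thesis
  proof eventually_elim
    case (elim n)
    show ?case
    proof (intro ballI allI impI)
      fix t y x
      assume t: "t \<in> {0..T}" and y: "\<bar>y\<bar> \<le> R" and x: "\<bar>real_of_int x / sqrt (real n) - y\<bar> \<le> \<epsilon>"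
      define a b where "a = lo n y \<epsilon>" and "b = hi n y \<epsilon>"
      have q: "0 < sqrt (real n)" using elim(2) by simp
      have xab: "x \<in> {a..b}" using x window_iff[OF elim(2)] by (simp add: a_def b_def)
      have win: "real_of_int (b - a + 1) \<le> 3 * \<epsilon> * sqrt (real n)"
        "\<bar>1 - weight a b / (2 * \<epsilon> * sqrt (real n))\<bar> \<le> \<eta> / C"
        using elim(1) y by (auto simp: a_def b_def)
      have \<tau>: "0 \<le> real n * t" "real n * t \<le> real n * T" using t by (auto intro: mult_left_mono)
      have "expectation (\<lambda>u. \<bar>occupation (\<xi> n) (real n * t) {x} u / (sqrt (real n) * w x)
          - density_at \<epsilon> (scaled_walk n) t y u\<bar>)
        \<le> sqrt (8 * K\<^sup>2 * C * (real_of_int (b - a + 1) / sqrt (real n))) +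
          C * \<bar>1 - weight a b / (2 * \<epsilon> * sqrt (real n))\<bar>"
        using occupation_smoothing[OF prob_space_axioms walk[OF elim(2)] elim(2) \<tau> xab \<epsilon>]
        by (simp add: density_at_scaled_walk[OF elim(2)] a_def b_def)
      also have "\<dots> \<le> sqrt (8 * K\<^sup>2 * C * (3 * \<epsilon>)) + C * (\<eta> / C)"
        using win C_pos q by (intro add_mono real_sqrt_le_mono mult_left_mono) (auto simp: pos_divide_le_eq)
      also have "\<dots> = smoothing \<epsilon> + \<eta>" using C_pos by (simp add: smoothing_def)
      finally show "expectation (\<lambda>u. \<bar>occupation (\<xi> n) (real n * t) {x} u / (sqrt (real n) * w x)
          - density_at \<epsilon> (scaled_walk n) t y u\<bar>) \<le> smoothing \<epsilon> + \<eta>" .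
    qed
  qed
qed

lemma density_at_integrable:
  assumes "0 \<le> t"
  shows "integrable M (density_at \<epsilon> X t y)" "integrable M (density_at \<epsilon> (scaled_walk n) t y)"
  unfolding density_at_def[abs_def]
  by (intro integrable_divide sojourn_integrable[OF prob_space_axioms assms closed_window]
      X_pair scaled_walk_pair)+

text \<open>Almost surely the paths are eventually \<open>\<delta>\<close>-close on all of
  \<open>{0..T}\<close>, and then the time spent apart is exactly zero; it never exceeds
  \<open>T\<close>. Being a time integral, it is measurable by joint measurability, with no supremum
  over uncountably many times.\<close>

lemma mean_deviation_time_tendsto:
  assumes "0 < \<delta>"
  shows "(\<lambda>n. expectation (sojourn (\<lambda>s u. scaled_walk n s u - X s u) T {z. \<delta> < \<bar>z\<bar>})) \<longlonglongrightarrow> 0"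
proof -
  let ?f = "\<lambda>n. sojourn (\<lambda>s u. scaled_walk n s u - X s u) T {z. \<delta> < \<bar>z\<bar>}"
  have out: "{z::real. \<delta> < \<bar>z\<bar>} \<in> sets borel" by measurable
  have pair: "(\<lambda>(u, s). scaled_walk n s u - X s u) \<in> borel_measurable (M \<Otimes>\<^sub>M time_measure T)" for n
    using borel_measurable_diff[OF scaled_walk_pair[of n T] X_pair[of T]] by (simp add: case_prod_unfold)
  have "(\<lambda>n. expectation (?f n)) \<longlonglongrightarrow> expectation (\<lambda>_. 0)"
  proof (rule integral_dominated_convergence[where w="\<lambda>_. T"])
    show "?f n \<in> borel_measurable M" for n
      using sojourn_integrable[OF prob_space_axioms less_imp_le[OF T] out pair] by (rule borel_measurable_integrable)
    show "AE u in M. norm (?f n u) \<le> T" for n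
      by (rule AE_I2) (simp add: abs_of_nonneg sojourn_nonneg sojourn_le[OF less_imp_le[OF T]])
    show "AE u in M. (\<lambda>n. ?f n u) \<longlonglongrightarrow> 0"
      using convergence
    proof eventually_elim
      case (elim u)
      have "\<forall>\<^sub>F n in sequentially. \<forall>t\<in>{0..T}. \<bar>scaled_walk n t u - X t u\<bar> \<le> \<delta>"
        using elim assms by (simp add: scaled_walk_def)
      then have "\<forall>\<^sub>F n in sequentially. ?f n u = 0"
      proof eventually_elim
        case (elim n)
        have "?f n u = (\<integral>s. 0 \<partial>time_measure T)"
          unfolding sojourn_def using elim
          by (intro Bochner_Integration.integral_cong) (auto simp: indicator_def space_restrict_space not_less[symmetric])
        then show ?case by simp
      qed
      then show ?case by (rule tendsto_eventually)
    qed
  qed auto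
  then show ?thesis by simp
qed

lemma density_at_approximation:
  assumes \<epsilon>: "0 < \<epsilon>" and \<eta>: "0 < \<eta>"
  shows "\<forall>\<^sub>F n in sequentially. \<forall>t\<in>{0..T}. \<forall>y.
    expectation (\<lambda>u. \<bar>density_at \<epsilon> (scaled_walk n) t y u - density_at \<epsilon> X t y u\<bar>) \<le> \<eta>"
proof -
  \<comment> \<open>Chosen so that each of the three terms, two ends and the time spent apart, is at
    most \<open>2 * \<epsilon> * \<eta> / 3\<close>. At an end one half of this comes from
    \<open>\<delta>\<close>, the other from \<open>1 / sqrt n\<close>.\<close>
  define \<delta> where "\<delta> = \<epsilon> * \<eta> / (6 * (C * K))"
  have CK: "0 < C * K" using C_pos K_pos by simp
  have \<delta>: "0 < \<delta>" "C * K * \<delta> = \<epsilon> * \<eta> / 6" using \<epsilon> \<eta> CK by (auto simp: \<delta>_def)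
  let ?f = "\<lambda>n. sojourn (\<lambda>s u. scaled_walk n s u - X s u) T {z. \<delta> < \<bar>z\<bar>}"
  have "\<forall>\<^sub>F n in sequentially. expectation (?f n) < 2 * (\<epsilon> * \<eta>) / 3"
    using mean_deviation_time_tendsto[OF \<delta>(1)] \<epsilon> \<eta> by (intro order_tendstoD) auto
  moreover have "\<forall>\<^sub>F n in sequentially. 3 * (C * K) / (\<epsilon> * \<eta>) \<le> sqrt (real n)"
    by (rule eventually_sqrt_ge)
  ultimately show ?thesis
    using eventually_ge_at_top[of 1]
  proof eventually_elim
    case (elim n)
    have q: "0 < sqrt (real n)" using elim(3) by simp
    have Q: "C * K * (1 / sqrt (real n)) \<le> \<epsilon> * \<eta> / 3"
      using elim(2) q \<epsilon> \<eta> by (simp add: field_simps)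
    have out: "{z::real. \<delta> < \<bar>z\<bar>} \<in> sets borel" by measurable
    have pair: "(\<lambda>(u, s). scaled_walk n s u - X s u) \<in> borel_measurable (M \<Otimes>\<^sub>M time_measure T)"
      using borel_measurable_diff[OF scaled_walk_pair[of n T] X_pair[of T]] by (simp add: case_prod_unfold)
    have f_int: "integrable M (?f n)"
      by (rule sojourn_integrable[OF prob_space_axioms less_imp_le[OF T] out pair])
    show ?case
    proof (intro ballI allI)
      fix t y assume "t \<in> {0..T}"
      then have t: "0 \<le> t" "t \<le> T" by auto
      let ?A = "sojourn (scaled_walk n) t {z. \<bar>z - (y + \<epsilon>)\<bar> \<le> \<delta>}"
      let ?B = "sojourn (scaled_walk n) t {z. \<bar>z - (y - \<epsilon>)\<bar> \<le> \<delta>}"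
      have int: "integrable M ?A" "integrable M ?B"
        by (intro sojourn_integrable[OF prob_space_axioms t(1) closed_window scaled_walk_pair])+
      have m: "expectation (sojourn (scaled_walk n) t {z. \<bar>z - y'\<bar> \<le> \<delta>}) \<le> 2 * (\<epsilon> * \<eta>) / 3" for y'
      proof -
        have "expectation (sojourn (scaled_walk n) t {z. \<bar>z - y'\<bar> \<le> \<delta>}) \<le> C * K * (2 * \<delta> + 1 / sqrt (real n))"
          by (rule mean_sojourn_le[OF elim(3) t less_imp_le[OF \<delta>(1)]])
        also have "\<dots> = 2 * (C * K * \<delta>) + C * K * (1 / sqrt (real n))"
          by (simp add: algebra_simps)
        finally show ?thesis using Q \<delta>(2) by linarith
      qed
      have "expectation (\<lambda>u. \<bar>density_at \<epsilon> (scaled_walk n) t y u - density_at \<epsilon> X t y u\<bar>)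
        \<le> expectation (\<lambda>u. (?A u + ?B u + ?f n u) / (2 * \<epsilon>))"
      proof (rule integral_mono)
        show "\<bar>density_at \<epsilon> (scaled_walk n) t y u - density_at \<epsilon> X t y u\<bar> \<le> (?A u + ?B u + ?f n u) / (2 * \<epsilon>)"
          if "u \<in> space M" for u
          by (rule density_at_diff_le[where Z="scaled_walk n" and Z'=X, OF path_measurable[OF scaled_walk_pair that]
              path_measurable[OF X_pair that] t \<epsilon>])
      qed (use int f_int density_at_integrable[OF t(1)] in auto)
      also have "\<dots> = (expectation ?A + expectation ?B + expectation (?f n)) / (2 * \<epsilon>)"
        using int f_int by simp
      also have "\<dots> \<le> (2 * (\<epsilon> * \<eta>) / 3 + 2 * (\<epsilon> * \<eta>) / 3 + 2 * (\<epsilon> * \<eta>) / 3) / (2 * \<epsilon>)"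
        using m elim(1) \<epsilon> by (intro divide_right_mono add_mono) auto
      also have "\<dots> = \<eta>" using \<epsilon> by simp
      finally show "expectation (\<lambda>u. \<bar>density_at \<epsilon> (scaled_walk n) t y u - density_at \<epsilon> X t y u\<bar>) \<le> \<eta>" .
    qed
  qed
qed

lemma expectation_abs_triangle:
  fixes f g h :: "'b \<Rightarrow> real"
  assumes "integrable M f" "integrable M g" "integrable M h"
  shows "expectation (\<lambda>u. \<bar>f u - h u\<bar>) \<le> expectation (\<lambda>u. \<bar>f u - g u\<bar>) + expectation (\<lambda>u. \<bar>g u - h u\<bar>)"
proof -
  have "expectation (\<lambda>u. \<bar>f u - h u\<bar>) \<le> expectation (\<lambda>u. \<bar>f u - g u\<bar> + \<bar>g u - h u\<bar>)"
    by (rule integral_mono) (use assms in auto)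
  then show ?thesis using assms by simp
qed

text \<open>The occupation of a single site near \<open>y\<close> by the walk with large index \<open>n\<close> is compared
  with the densities on both scales; letting \<open>n\<close> tend to infinity removes the walk.\<close>

lemma density_at_cauchy:
  assumes \<epsilon>: "0 < \<epsilon>" "0 < \<epsilon>'" and t: "t \<in> {0..T}" and y: "\<bar>y\<bar> \<le> R"
  shows "expectation (\<lambda>u. \<bar>density_at \<epsilon> X t y u - density_at \<epsilon>' X t y u\<bar>) \<le> smoothing \<epsilon> + smoothing \<epsilon>'"
proof (rule field_le_epsilon)
  fix \<eta> :: real assume \<eta>: "0 < \<eta>"
  have t0: "0 \<le> t" using t by simp
  let ?D = "\<lambda>n \<epsilon>. density_at \<epsilon> (scaled_walk n) t y" and ?DX = "\<lambda>\<epsilon>. density_at \<epsilon> X t y"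
  \<comment> \<open>The site \<open>\<lfloor>y * sqrt n\<rfloor>\<close> is within
    \<open>1 / sqrt n\<close> of \<open>y\<close> after scaling, so it eventually lies in the
    windows of both radii and can link the two densities.\<close>
  have half: "\<forall>\<^sub>F n in sequentially.
      expectation (\<lambda>u. \<bar>occupation (\<xi> n) (real n * t) {\<lfloor>y * sqrt (real n)\<rfloor>} u / (sqrt (real n) * w \<lfloor>y * sqrt (real n)\<rfloor>) - ?D n \<epsilon> u\<bar>)
        \<le> smoothing \<epsilon> + \<eta> / 4 \<and> expectation (\<lambda>u. \<bar>?D n \<epsilon> u - ?DX \<epsilon> u\<bar>) \<le> \<eta> / 4"
    if "0 < \<epsilon>" for \<epsilon>
  proof -
    have "0 < \<eta> / 4" using \<eta> by simp
    from occupation_near_density[OF that this] density_at_approximation[OF that this]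
      eventually_sqrt_ge[of "max 1 (1 / \<epsilon>)"] show ?thesis
    proof eventually_elim
      case (elim n)
      define q where "q = sqrt (real n)"
      have q: "0 < q" "1 / q \<le> \<epsilon>" using elim(3) that by (auto simp: q_def[symmetric] field_simps)
      have "\<bar>real_of_int \<lfloor>y * q\<rfloor> - y * q\<bar> \<le> 1" by linarith
      moreover have "\<bar>real_of_int \<lfloor>y * q\<rfloor> / q - y\<bar> = \<bar>real_of_int \<lfloor>y * q\<rfloor> - y * q\<bar> / q"
      proof -
        have "real_of_int \<lfloor>y * q\<rfloor> / q - y = (real_of_int \<lfloor>y * q\<rfloor> - y * q) / q"
          using q by (simp add: diff_divide_distrib)
        then show ?thesis using q by (simp add: abs_divide)
      qed
      ultimately have "\<bar>real_of_int \<lfloor>y * q\<rfloor> / q - y\<bar> \<le> 1 / q"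
        using q by (simp add: divide_right_mono)
      then have "\<bar>real_of_int \<lfloor>y * sqrt (real n)\<rfloor> / sqrt (real n) - y\<bar> \<le> \<epsilon>"
        using q by (simp add: q_def)
      then show ?case using elim t y by blast
    qed
  qed
  have "\<forall>\<^sub>F n in sequentially. expectation (\<lambda>u. \<bar>?DX \<epsilon> u - ?DX \<epsilon>' u\<bar>) \<le> smoothing \<epsilon> + smoothing \<epsilon>' + \<eta>"
    using half[OF \<epsilon>(1)] half[OF \<epsilon>(2)] eventually_ge_at_top[of 1]
  proof eventually_elim
    case (elim n)
    define x where "x = \<lfloor>y * sqrt (real n)\<rfloor>"
    define l where "l = (\<lambda>u. occupation (\<xi> n) (real n * t) {x} u / (sqrt (real n) * w x))"
    have l_int: "integrable M l"
      unfolding l_def using t0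
      by (intro integrable_divide occupation_integrable[OF prob_space_axioms _ markov_walk_pair_measurable[OF walk[OF elim(3)]]]) auto
    note e = elim[folded x_def]
    note int = density_at_integrable[OF t0]
    have "expectation (\<lambda>u. \<bar>?DX \<epsilon> u - ?DX \<epsilon>' u\<bar>)
      \<le> expectation (\<lambda>u. \<bar>?DX \<epsilon> u - ?D n \<epsilon> u\<bar>) + (expectation (\<lambda>u. \<bar>?D n \<epsilon> u - l u\<bar>)
        + (expectation (\<lambda>u. \<bar>l u - ?D n \<epsilon>' u\<bar>) + expectation (\<lambda>u. \<bar>?D n \<epsilon>' u - ?DX \<epsilon>' u\<bar>)))"
      using expectation_abs_triangle[OF int(1)[of \<epsilon> y] int(2)[of \<epsilon> n y] int(1)[of \<epsilon>' y]]
        expectation_abs_triangle[OF int(2)[of \<epsilon> n y] l_int int(1)[of \<epsilon>' y]]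
        expectation_abs_triangle[OF l_int int(2)[of \<epsilon>' n y] int(1)[of \<epsilon>' y]] by linarith
    also have "expectation (\<lambda>u. \<bar>?DX \<epsilon> u - ?D n \<epsilon> u\<bar>) = expectation (\<lambda>u. \<bar>?D n \<epsilon> u - ?DX \<epsilon> u\<bar>)"
      by (simp add: abs_minus_commute)
    also have "expectation (\<lambda>u. \<bar>?D n \<epsilon> u - l u\<bar>) = expectation (\<lambda>u. \<bar>l u - ?D n \<epsilon> u\<bar>)"
      by (simp add: abs_minus_commute)
    finally show ?case using e(1,2) unfolding l_def by linarith
  qed
  then show "expectation (\<lambda>u. \<bar>?DX \<epsilon> u - ?DX \<epsilon>' u\<bar>) \<le> smoothing \<epsilon> + smoothing \<epsilon>' + \<eta>"
    by (simp add: eventually_const_iff)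
qed

lemma smoothing_tendsto: "(smoothing \<longlongrightarrow> 0) (at_right 0)"
  unfolding smoothing_def[abs_def] by (auto intro!: tendsto_eq_intros)

text \<open>A nonnegative integral is used because integrability of \<open>L\<close> is not known
  beforehand; Fatou's lemma asks for measurability only. It is applied along the radii
  \<open>e k\<close>, for which the second smoothing error vanishes.\<close>

lemma density_at_near_local_time:
  assumes \<epsilon>: "0 < \<epsilon>" and t: "t \<in> {0..T}" and y: "\<bar>y\<bar> \<le> R"
    and L [measurable]: "L \<in> borel_measurable M"
    and lim: "AE u in M. ((\<lambda>\<epsilon>. density_at \<epsilon> X t y u) \<longlongrightarrow> L u) (at_right 0)"
  shows "(\<integral>\<^sup>+ u. ennreal \<bar>density_at \<epsilon> X t y u - L u\<bar> \<partial>M) \<le> ennreal (smoothing \<epsilon>)"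
proof -
  have t0: "0 \<le> t" using t by simp
  define e where "e k = inverse (real (Suc k))" for k
  have e_pos: "0 < e k" for k by (simp add: e_def)
  have e_lim: "filterlim e (at_right 0) sequentially"
    unfolding filterlim_at using LIMSEQ_inverse_real_of_nat e_pos
    by (auto simp: e_def[abs_def] simp del: of_nat_Suc)
  let ?DX = "\<lambda>\<epsilon>. density_at \<epsilon> X t y"
  note int = density_at_integrable(1)[OF t0]
  have bound: "(\<integral>\<^sup>+ u. ennreal \<bar>?DX \<epsilon> u - ?DX (e k) u\<bar> \<partial>M) \<le> ennreal (smoothing \<epsilon> + smoothing (e k))" for k
    using density_at_cauchy[OF \<epsilon> e_pos t y, of k] int
    by (subst nn_integral_eq_integral) (auto intro!: ennreal_leI)
  have "(\<integral>\<^sup>+ u. ennreal \<bar>?DX \<epsilon> u - L u\<bar> \<partial>M) = (\<integral>\<^sup>+ u. liminf (\<lambda>k. ennreal \<bar>?DX \<epsilon> u - ?DX (e k) u\<bar>) \<partial>M)"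
  proof (rule nn_integral_cong_AE)
    show "AE u in M. ennreal \<bar>?DX \<epsilon> u - L u\<bar> = liminf (\<lambda>k. ennreal \<bar>?DX \<epsilon> u - ?DX (e k) u\<bar>)"
      using lim
    proof eventually_elim
      case (elim u)
      have "(\<lambda>k. ?DX (e k) u) \<longlonglongrightarrow> L u" by (rule filterlim_compose[OF elim e_lim])
      then have "(\<lambda>k. ennreal \<bar>?DX \<epsilon> u - ?DX (e k) u\<bar>) \<longlonglongrightarrow> ennreal \<bar>?DX \<epsilon> u - L u\<bar>"
        by (intro tendsto_intros)
      then show ?case by (rule lim_imp_Liminf[symmetric, rotated]) simp
    qed
  qed
  also have "\<dots> \<le> liminf (\<lambda>k. \<integral>\<^sup>+ u. ennreal \<bar>?DX \<epsilon> u - ?DX (e k) u\<bar> \<partial>M)"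
    by (rule nn_integral_liminf) (use int in measurable)
  also have "\<dots> \<le> liminf (\<lambda>k. ennreal (smoothing \<epsilon> + smoothing (e k)))"
    by (intro Liminf_mono always_eventually allI bound)
  also have "\<dots> = ennreal (smoothing \<epsilon>)"
  proof (rule lim_imp_Liminf)
    have "(\<lambda>k. smoothing (e k)) \<longlonglongrightarrow> 0" by (rule filterlim_compose[OF smoothing_tendsto e_lim])
    then have "(\<lambda>k. smoothing \<epsilon> + smoothing (e k)) \<longlonglongrightarrow> smoothing \<epsilon> + 0" by (intro tendsto_intros)
    then show "(\<lambda>k. ennreal (smoothing \<epsilon> + smoothing (e k))) \<longlonglongrightarrow> ennreal (smoothing \<epsilon>)"
      by (intro tendsto_ennrealI) simp
  qed simp
  finally show ?thesis .
qed

lemma occupation_near_local_time: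
  assumes L: "\<And>t y. 0 \<le> t \<Longrightarrow> L t y \<in> borel_measurable M"
    and lim: "\<And>t y. 0 \<le> t \<Longrightarrow> AE u in M. ((\<lambda>\<epsilon>. density_at \<epsilon> X t y u) \<longlongrightarrow> L t y u) (at_right 0)"
    and \<eta>: "0 < \<eta>"
  shows "\<forall>\<^sub>F n in sequentially. \<forall>t\<in>{0..T}. \<forall>x. \<bar>real_of_int x\<bar> \<le> R * sqrt (real n) \<longrightarrow>
    (\<integral>\<^sup>+ u. ennreal \<bar>occupation (\<xi> n) (real n * t) {x} u / (sqrt (real n) * w x)
      - L t (real_of_int x / sqrt (real n)) u\<bar> \<partial>M) \<le> ennreal \<eta>"
proof -
  \<comment> \<open>The radius is fixed before \<open>n\<close>. The final error is twice
    \<open>smoothing \<epsilon>\<close> plus two quarters of \<open>\<eta>\<close>.\<close>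
  have "\<forall>\<^sub>F \<epsilon> in at_right 0. smoothing \<epsilon> < \<eta> / 4"
    using smoothing_tendsto \<eta> by (intro order_tendstoD) auto
  then have "\<forall>\<^sub>F \<epsilon> in at_right 0. 0 < \<epsilon> \<and> smoothing \<epsilon> < \<eta> / 4"
    using eventually_at_right_less[of "0::real"] by eventually_elim simp
  then obtain \<epsilon> where \<epsilon>: "0 < \<epsilon>" "smoothing \<epsilon> < \<eta> / 4"
    by (auto dest: eventually_happens'[rotated])
  have \<eta>4: "0 < \<eta> / 4" using \<eta> by simp
  from occupation_near_density[OF \<epsilon>(1) \<eta>4] density_at_approximation[OF \<epsilon>(1) \<eta>4] eventually_ge_at_top[of 1]
  show ?thesis
  proof eventually_elim
    case (elim n)
    show ?case
    proof (intro ballI allI impI)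
      fix t x assume tT: "t \<in> {0..T}" and x: "\<bar>real_of_int x\<bar> \<le> R * sqrt (real n)"
      define y where "y = real_of_int x / sqrt (real n)"
      have q: "0 < sqrt (real n)" using elim(3) by simp
      have y: "\<bar>y\<bar> \<le> R" using x q by (simp add: y_def abs_divide pos_divide_le_eq)
      have t0: "0 \<le> t" using tT by simp
      define l where "l = (\<lambda>u. occupation (\<xi> n) (real n * t) {x} u / (sqrt (real n) * w x))"
      have l_int [simp]: "integrable M l"
        unfolding l_def using t0
        by (intro integrable_divide occupation_integrable[OF prob_space_axioms _ markov_walk_pair_measurable[OF walk[OF elim(3)]]]) auto
      note l_meas [measurable] = borel_measurable_integrable[OF l_int]
      note int [simp] = density_at_integrable[OF t0]
      note meas [measurable] = borel_measurable_integrable[OF int(1)] borel_measurable_integrable[OF int(2)]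
      note [measurable] = L[OF t0]
      let ?D = "density_at \<epsilon> (scaled_walk n) t y" and ?DX = "density_at \<epsilon> X t y"
      have 1: "expectation (\<lambda>u. \<bar>l u - ?D u\<bar>) \<le> smoothing \<epsilon> + \<eta> / 4"
        using elim(1) tT y \<epsilon> by (auto simp: l_def y_def)
      have 2: "expectation (\<lambda>u. \<bar>?D u - ?DX u\<bar>) \<le> \<eta> / 4" using elim(2) tT by blast
      have 3: "(\<integral>\<^sup>+ u. ennreal \<bar>?DX u - L t y u\<bar> \<partial>M) \<le> ennreal (smoothing \<epsilon>)"
        by (rule density_at_near_local_time[OF \<epsilon>(1) tT y L[OF t0] lim[OF t0]])
      have "(\<integral>\<^sup>+ u. ennreal \<bar>l u - L t y u\<bar> \<partial>M)
        \<le> (\<integral>\<^sup>+ u. ennreal \<bar>l u - ?D u\<bar> + (ennreal \<bar>?D u - ?DX u\<bar> + ennreal \<bar>?DX u - L t y u\<bar>) \<partial>M)"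
        by (intro nn_integral_mono) (auto simp flip: ennreal_plus intro!: ennreal_leI)
      also have "\<dots> = (\<integral>\<^sup>+ u. ennreal \<bar>l u - ?D u\<bar> \<partial>M) + ((\<integral>\<^sup>+ u. ennreal \<bar>?D u - ?DX u\<bar> \<partial>M)
          + (\<integral>\<^sup>+ u. ennreal \<bar>?DX u - L t y u\<bar> \<partial>M))"
        by (simp add: nn_integral_add)
      also have "\<dots> \<le> ennreal (smoothing \<epsilon> + \<eta> / 4) + (ennreal (\<eta> / 4) + ennreal (smoothing \<epsilon>))"
      proof (intro add_mono 3)
        show "(\<integral>\<^sup>+ u. ennreal \<bar>l u - ?D u\<bar> \<partial>M) \<le> ennreal (smoothing \<epsilon> + \<eta> / 4)"
          using 1 by (subst nn_integral_eq_integral) (auto intro!: ennreal_leI)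
        show "(\<integral>\<^sup>+ u. ennreal \<bar>?D u - ?DX u\<bar> \<partial>M) \<le> ennreal (\<eta> / 4)"
          using 2 by (subst nn_integral_eq_integral) (auto intro!: ennreal_leI)
      qed
      also have "\<dots> \<le> ennreal \<eta>"
      proof -
        have "0 \<le> smoothing \<epsilon>" using \<epsilon> C_pos by (simp add: smoothing_def)
        then show ?thesis using \<epsilon> \<eta> by (auto simp flip: ennreal_plus intro!: ennreal_leI)
      qed
      finally show "(\<integral>\<^sup>+ u. ennreal \<bar>occupation (\<xi> n) (real n * t) {x} u / (sqrt (real n) * w x)
          - L t (real_of_int x / sqrt (real n)) u\<bar> \<partial>M) \<le> ennreal \<eta>"
        by (simp add: l_def y_def)
    qed
  qed
qed

end

section \<open>Removal of null sets and the final limit\<close>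

lemma tendsto_0_ennrealI:
  fixes f :: "nat \<Rightarrow> ennreal"
  assumes "\<And>\<eta>. 0 < \<eta> \<Longrightarrow> \<forall>\<^sub>F n in sequentially. f n \<le> ennreal \<eta>"
  shows "f \<longlonglongrightarrow> 0"
proof (rule order_tendstoI)
  fix a :: ennreal assume "0 < a"
  \<comment> \<open>The bound \<open>a\<close> may be infinite; a value strictly below it is finite
    and comes from a positive real.\<close>
  then obtain b where b: "0 < b" "b < a" using dense by blast
  then have "0 < enn2real b" "b = ennreal (enn2real b)"
    by (auto simp: enn2real_positive_iff less_top[symmetric] ennreal_enn2real_if)
  with assms[of "enn2real b"] have "\<forall>\<^sub>F n in sequentially. f n \<le> b" by simp
  then show "\<forall>\<^sub>F n in sequentially. f n < a"
    by (rule eventually_mono) (use b in auto)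
qed simp

lemma (in reversible_rates) occupation_converges_to_local_time:
  fixes M :: "'b measure" and T R :: real
  assumes T: "0 < T" and R: "0 < R"
    and averages: "\<And>\<eta>. 0 < \<eta> \<Longrightarrow> \<exists>c. \<forall>a b. a \<le> b \<longrightarrow>
      \<bar>weight a b - real_of_int (b - a + 1)\<bar> \<le> \<eta> * (\<bar>real_of_int a\<bar> + \<bar>real_of_int b\<bar>) + c"
    and M: "prob_space M" and walk: "\<And>n. 1 \<le> n \<Longrightarrow> markov_walk M r 0 (\<xi> n)"
    and X: "\<And>t. 0 \<le> t \<Longrightarrow> X t \<in> borel_measurable M" "AE u in M. continuous_on {0..} (\<lambda>t. X t u)"
    and conv: "AE u in M. (\<lambda>n. skorokhod_dist T
        (\<lambda>t. 1 / sqrt (real n) * real_of_int (\<xi> n (real n * t) u)) (\<lambda>t. X t u)) \<longlonglongrightarrow> 0"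
    and L: "local_time M X L" and \<eta>: "0 < \<eta>"
  shows "\<forall>\<^sub>F n in sequentially. \<forall>t\<in>{0..T}. \<forall>x. \<bar>real_of_int x\<bar> \<le> R * sqrt (real n) \<longrightarrow>
    (\<integral>\<^sup>+ u. ennreal \<bar>scaled_occupation \<xi> n t x u / w x
      - L t (real_of_int x / sqrt (real n)) u\<bar> \<partial>M) \<le> ennreal \<eta>"
proof -
  interpret M: prob_space M by fact
  have L_lim: "AE u in M. \<forall>t\<ge>0. \<forall>x. ((\<lambda>\<epsilon>. 1 / (2 * \<epsilon>) *
      (LBINT s:{0..t}. indicat_real {y. \<bar>y - x\<bar> \<le> \<epsilon>} (X s u))) \<longlongrightarrow> L t x u) (at_right 0)"
    using L by (auto simp: local_time_def elim: eventually_mono)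
  from X(2) conv L_lim have "AE u in M. continuous_on {0..} (\<lambda>t. X t u) \<and>
      (\<lambda>n. skorokhod_dist T
        (\<lambda>t. 1 / sqrt (real n) * real_of_int (\<xi> n (real n * t) u)) (\<lambda>t. X t u)) \<longlonglongrightarrow> 0 \<and>
      (\<forall>t\<ge>0. \<forall>x. ((\<lambda>\<epsilon>. 1 / (2 * \<epsilon>) *
      (LBINT s:{0..t}. indicat_real {y. \<bar>y - x\<bar> \<le> \<epsilon>} (X s u))) \<longlongrightarrow> L t x u) (at_right 0))"
    by eventually_elim blast
  then obtain N where N: "N \<in> null_sets M"
    and cont: "\<And>u. u \<in> space M - N \<Longrightarrow> continuous_on {0..} (\<lambda>t. X t u)"
    and skor: "\<And>u. u \<in> space M - N \<Longrightarrow> (\<lambda>n. skorokhod_dist T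
        (\<lambda>t. 1 / sqrt (real n) * real_of_int (\<xi> n (real n * t) u)) (\<lambda>t. X t u)) \<longlonglongrightarrow> 0"
    and lim: "\<And>u t x. u \<in> space M - N \<Longrightarrow> 0 \<le> t \<Longrightarrow> ((\<lambda>\<epsilon>. 1 / (2 * \<epsilon>) *
      (LBINT s:{0..t}. indicat_real {y. \<bar>y - x\<bar> \<le> \<epsilon>} (X s u))) \<longlongrightarrow> L t x u) (at_right 0)"
    by (elim AE_E3) blast
  have AE_N: "AE u in M. u \<in> space M - N" using AE_not_in[OF N] AE_space by eventually_elim simp
  \<comment> \<open>The zero path replaces \<open>X\<close> on one measurable null set outside which
    continuity, Skorokhod convergence and the local time limit all hold. The new process is
    continuous everywhere, still measurable, and has the same local time almost surely.\<close>
  define X' where "X' t u = (if u \<in> N then 0 else X t u)" for t u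
  have [measurable]: "N \<in> sets M" using N by auto
  interpret coupled_walks r w K M \<xi> X' T R
  proof unfold_locales
    show "X' t \<in> borel_measurable M" if "0 \<le> t" for t
      unfolding X'_def[abs_def] using X(1)[OF that] by measurable
    show "continuous_on {0..} (\<lambda>t. X' t u)" if "u \<in> space M" for u
      using cont[of u] that by (cases "u \<in> N") (auto simp: X'_def)
    show "AE u in M. \<forall>\<delta>>0. \<forall>\<^sub>F n in sequentially. \<forall>t\<in>{0..T}.
      \<bar>1 / sqrt (real n) * real_of_int (\<xi> n (real n * t) u) - X' t u\<bar> \<le> \<delta>"
      using AE_N
    proof eventually_elim
      case (elim u)
      \<comment> \<open>Boundedness of the walk on compact time intervals ensures that the infimum
        in the Skorokhod distance is taken over a nonempty set.\<close>
      have "\<exists>B. \<forall>t\<in>{0..T}. \<bar>1 / sqrt (real n) * real_of_int (\<xi> n (real n * t) u)\<bar> \<le> B" if n: "1 \<le> n" for n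
      proof -
        have "cadlag (\<lambda>t. real_of_int (\<xi> n t u))" using walk[OF n] elim by (simp add: markov_walk_def)
        then obtain B where B: "\<And>t. t \<in> {0..real n * T} \<Longrightarrow> \<bar>real_of_int (\<xi> n t u)\<bar> \<le> B"
          using cadlag_bounded[of _ "real n * T"] T by (metis less_eq_real_def mult_nonneg_nonneg of_nat_0_le_iff)
        have "\<bar>1 / sqrt (real n) * real_of_int (\<xi> n (real n * t) u)\<bar> \<le> 1 / sqrt (real n) * B" if "t \<in> {0..T}" for t
          unfolding abs_mult using that by (intro mult_mono B) (auto intro: mult_left_mono)
        then show ?thesis by blast
      qed
      then have "\<forall>\<^sub>F n in sequentially. \<forall>t\<in>{0..T}.
          \<bar>1 / sqrt (real n) * real_of_int (\<xi> n (real n * t) u) - X t u\<bar> \<le> \<delta>" if "0 < \<delta>" for \<delta>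
        by (intro skorokhod_limit_uniform[OF less_imp_le[OF T] skor[OF elim]
              continuous_on_subset[OF cont[OF elim]] _ that]) auto
      then show ?case using elim by (simp add: X'_def)
    qed
  qed (use T R walk averages in auto)
  have occ: "scaled_occupation \<xi> n t x u / w x =
      occupation (\<xi> n) (real n * t) {x} u / (sqrt (real n) * w x)" for n t x u
    by (simp add: scaled_occupation_def occupation_def set_integral_eq_time_measure)
  show ?thesis
    unfolding occ
  proof (rule occupation_near_local_time[OF _ _ \<eta>])
    show "L t y \<in> borel_measurable M" if "0 \<le> t" for t y
      using L that by (simp add: local_time_def)
    show "AE u in M. ((\<lambda>\<epsilon>. density_at \<epsilon> X' t y u) \<longlongrightarrow> L t y u) (at_right 0)" if "0 \<le> t" for t y
      using AE_N
    proof eventually_elim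
      case (elim u)
      then show ?case
        using lim[OF elim that, of y]
        by (simp add: density_at_def sojourn_def X'_def set_integral_eq_time_measure)
    qed
  qed
qed

theorem theorem3p1:
  fixes \<mu> :: "'w measure"
    and shift :: "int \<Rightarrow> 'w \<Rightarrow> 'w"
    and j :: "'w \<Rightarrow> int \<Rightarrow> real"
    and \<pi> :: "'w \<Rightarrow> real"
    and K T R :: real
  assumes "random_environment \<mu> shift j \<pi> K"
    and "T > 0"
    and "R > 0"
  shows "AE \<omega> in \<mu>. \<forall>(M :: 'b measure) \<xi> X L.
    prob_space M \<longrightarrow>
    (\<forall>n\<ge>1. markov_walk M (\<lambda>x z. j (shift x \<omega>) z) 0 (\<xi> n)) \<longrightarrow>
    brownian_motion M (limit_variance \<mu> j \<pi>) X \<longrightarrow>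
    (AE u in M. (\<lambda>n. skorokhod_dist T
        (\<lambda>t. 1 / sqrt (real n) * real_of_int (\<xi> n (real n * t) u)) (\<lambda>t. X t u)) \<longlonglongrightarrow> 0) \<longrightarrow>
    local_time M X L \<longrightarrow>
    (\<lambda>n. SUP t\<in>{0..T}. MAX x\<in>{x :: int. \<bar>real_of_int x\<bar> \<le> R * sqrt (real n)}.
        \<integral>\<^sup>+ u. ennreal \<bar>scaled_occupation \<xi> n t x u / \<pi> (shift x \<omega>)
                       - L t (real_of_int x / sqrt (real n)) u\<bar> \<partial>M) \<longlonglongrightarrow> 0"
proof -
  interpret random_environment \<mu> shift j \<pi> K by fact
  show ?thesis
    using AE_reversible_rates AE_weight_averages
  proof eventually_elim
    case (elim \<omega>)
    interpret reversible_rates "\<lambda>x z. j (shift x \<omega>) z" "\<lambda>x. \<pi> (shift x \<omega>)" K by fact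
    have averages: "\<exists>c. \<forall>a b. a \<le> b \<longrightarrow> \<bar>weight a b - real_of_int (b - a + 1)\<bar>
        \<le> \<eta> * (\<bar>real_of_int a\<bar> + \<bar>real_of_int b\<bar>) + c" if "0 < \<eta>" for \<eta>
      using elim(2) that unfolding weight_def by blast
    show ?case
    proof (intro allI impI)
      fix M :: "'b measure" and \<xi> X L
      assume M: "prob_space M"
        and walk: "\<forall>n\<ge>1. markov_walk M (\<lambda>x z. j (shift x \<omega>) z) 0 (\<xi> n)"
        and BM: "brownian_motion M (limit_variance \<mu> j \<pi>) X"
        and conv: "AE u in M. (\<lambda>n. skorokhod_dist T
          (\<lambda>t. 1 / sqrt (real n) * real_of_int (\<xi> n (real n * t) u)) (\<lambda>t. X t u)) \<longlonglongrightarrow> 0"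
        and L: "local_time M X L"
      show "(\<lambda>n. SUP t\<in>{0..T}. MAX x\<in>{x :: int. \<bar>real_of_int x\<bar> \<le> R * sqrt (real n)}.
        \<integral>\<^sup>+ u. ennreal \<bar>scaled_occupation \<xi> n t x u / \<pi> (shift x \<omega>)
                       - L t (real_of_int x / sqrt (real n)) u\<bar> \<partial>M) \<longlonglongrightarrow> 0"
      proof (rule tendsto_0_ennrealI)
        fix \<eta> :: real assume \<eta>: "0 < \<eta>"
        have X: "\<And>t. 0 \<le> t \<Longrightarrow> X t \<in> borel_measurable M" "AE u in M. continuous_on {0..} (\<lambda>t. X t u)"
          using BM by (auto simp: brownian_motion_def)
        from occupation_converges_to_local_time[OF assms(2,3) averages M _ X conv L \<eta>] walk
        have "\<forall>\<^sub>F n in sequentially. \<forall>t\<in>{0..T}. \<forall>x. \<bar>real_of_int x\<bar> \<le> R * sqrt (real n) \<longrightarrow>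
          (\<integral>\<^sup>+ u. ennreal \<bar>scaled_occupation \<xi> n t x u / \<pi> (shift x \<omega>)
            - L t (real_of_int x / sqrt (real n)) u\<bar> \<partial>M) \<le> ennreal \<eta>"
          by blast
        then show "\<forall>\<^sub>F n in sequentially. (SUP t\<in>{0..T}. MAX x\<in>{x :: int. \<bar>real_of_int x\<bar> \<le> R * sqrt (real n)}.
          \<integral>\<^sup>+ u. ennreal \<bar>scaled_occupation \<xi> n t x u / \<pi> (shift x \<omega>)
                       - L t (real_of_int x / sqrt (real n)) u\<bar> \<partial>M) \<le> ennreal \<eta>"
        proof eventually_elim
          case (elim n)
          let ?A = "{x :: int. \<bar>real_of_int x\<bar> \<le> R * sqrt (real n)}"
          \<comment> \<open>\<open>Max\<close> has its meaning on finite nonempty sets only; the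
            site 0 always belongs to this one.\<close>
          have "?A \<subseteq> {- \<lceil>R * sqrt (real n)\<rceil>..\<lceil>R * sqrt (real n)\<rceil>}"
            by (auto simp: abs_le_iff) linarith+
          then have "finite ?A" by (rule finite_subset) simp
          moreover have "?A \<noteq> {}" using assms(3) by (auto intro!: exI[of _ 0])
          ultimately show ?case
            using elim by (intro SUP_least Max.boundedI) auto
        qed
      qed
    qed
  qed
qed

end
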